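(* Consider an MPO-injective PEPS on the square lattice satisfying the pulling-through condition, and three adjacent rectangles $A,B,C$ with $B$ separating $A$ from $C$. If the boundary states $\rho_{\partial AB},\rho_{\partial BC},\rho_{\partial B},\rho_{\partial ABC}$ are $\epsilon$-approximately factorizable with respect to $ABC$ (in the sense for MPO-injective PEPS given in the context) for some $\epsilon\le1$, then $$\|P_{AB}P_{BC}-P_{ABC}\|\le 8\epsilon ,$$ where $P_X$ is the orthogonal projector onto $\operatorname{Im}V_X$ (tensored with the identity on the sites of $ABC$ outside $X$) and $\|\cdot\|$ is the operator norm.
   Context: PEPS. Each vertex of the square lattice carries a physical space $\mathbb{C}^d$. Each edge $e$ carries a maximally entangled vector $|\omega_e\rangle=D^{-1/2}\sum_{j=1}^D|j,j\rangle\in\mathbb{C}^D\otimes\mathbb{C}^D$, one factor for each endpoint. Each vertex $v$ carries a linear map $T_v:(\mathbb{C}^D)^{\otimes 4}\to\mathbb{C}^d$ acting on the factors at $v$ of the incident edges. For a finite region $\Lambda$ let $\mathcal H_\Lambda=\bigotimes_{v\in\Lambda}\mathbb{C}^d$, let $E_\Lambda$ be the edges with both endpoints in $\Lambda$, let $\partial\Lambda$ be the edges joining $\Lambda$ to its complement, and let $\mathcal H_{\partial\Lambda}=\bigotimes_{e\in\partial\Lambda}\mathbb{C}^D$. Define the linear map $V_\Lambda:\mathcal H_{\partial\Lambda}\to\mathcal H_\Lambda$ by $V_\Lambda|X\rangle=\langle X|\bigotimes_{v\in\Lambda}T_v\bigotimes_{e\in E_\Lambda\cup\partial\Lambda}|\omega_e\rangle$,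 where $\langle X|$ contracts the factors of the edges of $\partial\Lambda$ at endpoints outside $\Lambda$ (bilinearly in the standard basis, so that $V_\Lambda$ is linear). The boundary state is $\rho_{\partial\Lambda}=V_\Lambda^\dagger V_\Lambda$; inverses and negative powers of $\rho_{\partial\Lambda}$ are taken on its support. $J_{\partial\Lambda}$ is the orthogonal projector onto $(\ker\rho_{\partial\Lambda})^\perp=(\ker V_\Lambda)^\perp$. MPO-injectivity. The PEPS is MPO-injective if $d=D^4$ and $T_v=Y_vJ_4$ with $Y_v$ invertible, where $J_N$ is a translation-invariant matrix product operator on $(\mathbb{C}^D)^{\otimes N}$ that is a projector for every $N$. Pulling-through condition. For adjacent disjoint regions $A,B$, let $\hat V_{A\to B}:\mathcal H_{\partial A\setminus\partial B}\to\mathcal H_A\otimes\mathcal H_{\partial A\cap\partial B}$ be $V_A$ with the indices on the boundary shared by $A$ and $B$ transposed from inputs to outputs, normalized so that $V_{AB}=V_B\hat V_{A\to B}$ (tensoring with identities where needed). The condition is $J_{\partial B}\hat V_{A\to B}=\hat V_{A\to B}J_{\partial AB}$ for every pair of contiguous regions $A,B$. Geometry. $A,B,C$ are three adjacent rectangles side by side, of common height, with $B$ in the middle separating $A$ from $C$; $AB$ denotes $A\cup B$, etc. The width of $B$ is at least $3\ell$ for a reference length $\ell$. The edges joining $B$ to the complement of $ABC$ are split, going from the $A$ side to the $C$ side, into three parts $B_L$ (next to $A$), $z$ (middle), $B_R$ (next to $C$), each of length at least $\ell$. Put $a=(\partial A\cap\partial ABC)\cup B_L$, $d=(\partial A\cap\partial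 B)\cup B_L$, $b=(\partial C\cap\partial ABC)\cup B_R$, $c=(\partial B\cap\partial C)\cup B_R$. Then $\partial ABC=a\cup z\cup b$, $\partial AB=a\cup z\cup c$, $\partial BC=d\cup z\cup b$, $\partial B=d\cup z\cup c$; juxtaposition of letters denotes union. Approximate factorization (MPO-injective case). The boundary states are $\epsilon$-approximately factorizable with respect to $ABC$ if there are invertible operators $\Delta_{az},\Delta_{zb},\Omega_{dz},\Omega_{zc}$, supported on the regions given by their subscripts, such that with $$\sigma_{\partial ABC}=\Delta_{zb}\Delta_{az},\quad \sigma_{\partial B}=\Omega_{zc}\Omega_{dz},\quad \sigma_{\partial AB}=\Omega_{zc}\Delta_{az},\quad \sigma_{\partial BC}=\Delta_{zb}\Omega_{dz}$$ one has, for $R\in\{ABC,AB,BC\}$, $[J_{\partial R},\sigma_{\partial R}]=0$ and $\|\rho_{\partial R}^{1/2}\sigma_{\partial R}^{-1}\rho_{\partial R}^{1/2}-J_{\partial R}\|\le\epsilon$, and moreover $\|\rho_{\partial B}^{-1/2}J_{\partial B}\sigma_{\partial B}J_{\partial B}\rho_{\partial B}^{-1/2}-J_{\partial B}\|\le\epsilon$. *)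

theory Defs
  imports "HOL-Analysis.Analysis"
begin

section \<open>Matrices over finite index sets\<close>

text \<open>
  The Hilbert spaces below depend on finite regions that vary inside one statement, so they cannot be
  types. A linear map from \<open>\<complex>\<^sup>J\<close> to \<open>\<complex>\<^sup>I\<close> is its kernel \<open>M i j\<close>, and kernels
  (and vectors) vanish off their index sets, so that equality of maps is plain equality.
\<close>

type_synonym ('i, 'j) kernel = "'i \<Rightarrow> 'j \<Rightarrow> complex"

definition vecs :: "'i set \<Rightarrow> ('i \<Rightarrow> complex) set" where
  "vecs I = {\<psi>. \<forall>i. i \<notin> I \<longrightarrow> \<psi> i = 0}"

definition ops :: "'i set \<Rightarrow> 'j set \<Rightarrow> ('i, 'j) kernel set" where
  "ops I J = {M. \<forall>i j. i \<notin> I \<or> j \<notin> J \<longrightarrow> M i j = 0}"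

definition mv :: "'j set \<Rightarrow> ('i, 'j) kernel \<Rightarrow> ('j \<Rightarrow> complex) \<Rightarrow> 'i \<Rightarrow> complex" where
  "mv J M \<psi> = (\<lambda>i. \<Sum>j\<in>J. M i j * \<psi> j)"

definition mm :: "'j set \<Rightarrow> ('i, 'j) kernel \<Rightarrow> ('j, 'k) kernel \<Rightarrow> ('i, 'k) kernel" where
  "mm J M N = (\<lambda>i k. \<Sum>j\<in>J. M i j * N j k)"

definition mdiff :: "('i, 'j) kernel \<Rightarrow> ('i, 'j) kernel \<Rightarrow> ('i, 'j) kernel" where
  "mdiff M N = (\<lambda>i j. M i j - N i j)"

definition adj :: "('i, 'j) kernel \<Rightarrow> ('j, 'i) kernel" where
  "adj M = (\<lambda>j i. cnj (M i j))"

definition idm :: "'i set \<Rightarrow> ('i, 'i) kernel" where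
  "idm I = (\<lambda>i j. if i \<in> I \<and> i = j then 1 else 0)"

definition cinner_on :: "'i set \<Rightarrow> ('i \<Rightarrow> complex) \<Rightarrow> ('i \<Rightarrow> complex) \<Rightarrow> complex" where
  "cinner_on I \<phi> \<psi> = (\<Sum>i\<in>I. cnj (\<phi> i) * \<psi> i)"

definition opnorm :: "'i set \<Rightarrow> 'j set \<Rightarrow> ('i, 'j) kernel \<Rightarrow> real" where
  "opnorm I J M = (SUP \<psi>\<in>{\<psi> \<in> vecs J. L2_set (\<lambda>j. cmod (\<psi> j)) J \<le> 1}.
                     L2_set (\<lambda>i. cmod (mv J M \<psi> i)) I)"

definition kernel_of :: "'j set \<Rightarrow> ('i, 'j) kernel \<Rightarrow> ('j \<Rightarrow> complex) set" where
  "kernel_of J M = {\<psi> \<in> vecs J. mv J M \<psi> = (\<lambda>_. 0)}"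

definition image_of :: "'j set \<Rightarrow> ('i, 'j) kernel \<Rightarrow> ('i \<Rightarrow> complex) set" where
  "image_of J M = mv J M ` vecs J"

definition ortho_compl :: "'i set \<Rightarrow> ('i \<Rightarrow> complex) set \<Rightarrow> ('i \<Rightarrow> complex) set" where
  "ortho_compl I S = {\<phi> \<in> vecs I. \<forall>\<psi>\<in>S. cinner_on I \<psi> \<phi> = 0}"

text \<open>The orthogonal projector onto a linear subspace \<open>S\<close> of \<open>\<complex>\<^sup>I\<close>.\<close>

definition orth_proj :: "'i set \<Rightarrow> ('i \<Rightarrow> complex) set \<Rightarrow> ('i, 'i) kernel" where
  "orth_proj I S = (THE P. P \<in> ops I I \<and> adj P = P \<and> mm I P P = P \<and> image_of I P = S)"

definition invertible_op :: "'i set \<Rightarrow> 'j set \<Rightarrow> ('i, 'j) kernel \<Rightarrow> bool" where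
  "invertible_op I J M \<longleftrightarrow>
     M \<in> ops I J \<and> (\<exists>X\<in>ops J I. mm J M X = idm I \<and> mm I X M = idm J)"

definition opinv :: "'i set \<Rightarrow> ('i, 'i) kernel \<Rightarrow> ('i, 'i) kernel" where
  "opinv I M = (THE X. X \<in> ops I I \<and> mm I M X = idm I \<and> mm I X M = idm I)"

definition positive_op :: "'i set \<Rightarrow> ('i, 'i) kernel \<Rightarrow> bool" where
  "positive_op I M \<longleftrightarrow> M \<in> ops I I \<and> adj M = M \<and>
     (\<forall>\<psi>\<in>vecs I. 0 \<le> Re (cinner_on I \<psi> (mv I M \<psi>)))"

definition opsqrt :: "'i set \<Rightarrow> ('i, 'i) kernel \<Rightarrow> ('i, 'i) kernel" where
  "opsqrt I M = (THE R. positive_op I R \<and> mm I R R = M)"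

definition supp_proj :: "'i set \<Rightarrow> ('i, 'i) kernel \<Rightarrow> ('i, 'i) kernel" where
  "supp_proj I M = orth_proj I (ortho_compl I (kernel_of I M))"

text \<open>Inverse of a self-adjoint \<open>M\<close> on its support, extended by zero to the kernel of \<open>M\<close>.\<close>

definition supp_inv :: "'i set \<Rightarrow> ('i, 'i) kernel \<Rightarrow> ('i, 'i) kernel" where
  "supp_inv I M = (THE X. X \<in> ops I I \<and> mm I M X = supp_proj I M \<and> mm I X M = supp_proj I M
                        \<and> mm I (supp_proj I M) X = X)"


section \<open>Tensor products over finite sets\<close>

text \<open>
  The standard basis of \<open>\<Otimes>\<^sub>s\<^sub>\<in>\<^sub>S \<complex>\<^sup>n\<close> is indexed by the labellings of \<open>S\<close>, where \<open>n\<close> is the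
  cardinality of the label type.
\<close>

definition cfg :: "'s set \<Rightarrow> ('s \<Rightarrow> 'n::finite) set" where
  "cfg S = (S \<rightarrow>\<^sub>E UNIV)"

text \<open>An operator on the factors in \<open>S\<close>, tensored with the identity on the factors in \<open>R - S\<close>.\<close>

definition ext :: "'s set \<Rightarrow> 's set \<Rightarrow> ('s \<Rightarrow> 'n::finite, 's \<Rightarrow> 'n) kernel
                     \<Rightarrow> ('s \<Rightarrow> 'n, 's \<Rightarrow> 'n) kernel" where
  "ext S R K = (\<lambda>i j. if i \<in> cfg R \<and> j \<in> cfg R \<and> (\<forall>s\<in>R - S. i s = j s)
                      then K (restrict i S) (restrict j S) else 0)"


section \<open>The square lattice\<close>

type_synonym vertex = "int \<times> int"
type_synonym edge = "vertex set"

text \<open>The four neighbours in counterclockwise order.\<close>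

definition nbr :: "vertex \<Rightarrow> nat \<Rightarrow> vertex" where
  "nbr v k = (case v of (x, y) \<Rightarrow> [(x + 1, y), (x, y + 1), (x - 1, y), (x, y - 1)] ! k)"

definition leg :: "vertex \<Rightarrow> nat \<Rightarrow> edge" where
  "leg v k = {v, nbr v k}"

definition edges :: "edge set" where
  "edges = {leg v k | v k. k < 4}"

definition inner_edges :: "vertex set \<Rightarrow> edge set" where
  "inner_edges \<Lambda> = {e \<in> edges. e \<subseteq> \<Lambda>}"

definition bd :: "vertex set \<Rightarrow> edge set" where
  "bd \<Lambda> = {e \<in> edges. e \<inter> \<Lambda> \<noteq> {} \<and> e - \<Lambda> \<noteq> {}}"

definition lattice_connected :: "vertex set \<Rightarrow> bool" where
  "lattice_connected S \<longleftrightarrow>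
     (\<forall>u\<in>S. \<forall>v\<in>S. (u, v) \<in> {(x, y). x \<in> S \<and> y \<in> S \<and> {x, y} \<in> edges}\<^sup>*)"

definition lattice_simply_connected :: "vertex set \<Rightarrow> bool" where
  "lattice_simply_connected S \<longleftrightarrow> lattice_connected S \<and> lattice_connected (- S)"

text \<open>
  Regions with several components or with holes are excluded: with them the pulling-through
  condition can fail for standard topological models. (If \<open>B\<close> has two components, both adjacent to
  \<open>A\<close>, then the projector of \<open>B\<close> is a product over the components, while that of
  \<open>A \<union> B\<close> is not, already for the toric code.)
\<close>

definition contiguous :: "vertex set \<Rightarrow> vertex set \<Rightarrow> bool" where
  "contiguous A B \<longleftrightarrow> finite A \<and> finite B \<and> A \<noteq> {} \<and> B \<noteq> {} \<and> A \<inter> B = {} \<and> bd A \<inter> bd B \<noteq> {} \<and>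
     lattice_simply_connected A \<and> lattice_simply_connected B \<and> lattice_simply_connected (A \<union> B)"


section \<open>PEPS\<close>

text \<open>
  \<open>T v p i\<close> is the matrix element of \<open>T\<^sub>v\<close> between the physical basis vector \<open>p\<close> and the basis
  vector \<open>i\<close> of the four virtual factors at \<open>v\<close>, leg \<open>k < 4\<close> being the factor of the edge
  \<open>leg v k\<close>. The bond dimension is the cardinality of \<open>'b\<close>, the physical dimension that of \<open>'p\<close>.
\<close>

type_synonym ('p, 'b) peps = "vertex \<Rightarrow> ('p, nat \<Rightarrow> 'b) kernel"

text \<open>
  The two factors of a maximally entangled pair carry the same label, so contracting all pairs with
  the site maps and with a boundary basis vector \<open>x\<close> leaves one sum over a label per edge,
  with the labels on the boundary fixed to \<open>x\<close>.
\<close>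

definition peps_map :: "('p::finite, 'b::finite) peps \<Rightarrow> vertex set
                          \<Rightarrow> (vertex \<Rightarrow> 'p, edge \<Rightarrow> 'b) kernel" where
  "peps_map T \<Lambda> = (\<lambda>p x. if p \<in> cfg \<Lambda> \<and> x \<in> cfg (bd \<Lambda>) then
       of_real ((1 / sqrt (real CARD('b))) ^ card (inner_edges \<Lambda> \<union> bd \<Lambda>)) *
       (\<Sum>j\<in>{j \<in> cfg (inner_edges \<Lambda> \<union> bd \<Lambda>). restrict j (bd \<Lambda>) = x}.
          \<Prod>v\<in>\<Lambda>. T v (p v) (\<lambda>k\<in>{..<4}. j (leg v k)))
     else 0)"

definition bd_state :: "('p::finite, 'b::finite) peps \<Rightarrow> vertex set
                          \<Rightarrow> (edge \<Rightarrow> 'b, edge \<Rightarrow> 'b) kernel" where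
  "bd_state T \<Lambda> = mm (cfg \<Lambda>) (adj (peps_map T \<Lambda>)) (peps_map T \<Lambda>)"

definition bd_proj :: "('p::finite, 'b::finite) peps \<Rightarrow> vertex set
                          \<Rightarrow> (edge \<Rightarrow> 'b, edge \<Rightarrow> 'b) kernel" where
  "bd_proj T \<Lambda> = supp_proj (cfg (bd \<Lambda>)) (bd_state T \<Lambda>)"

definition image_proj :: "('p::finite, 'b::finite) peps \<Rightarrow> vertex set
                          \<Rightarrow> (vertex \<Rightarrow> 'p, vertex \<Rightarrow> 'p) kernel" where
  "image_proj T \<Lambda> = orth_proj (cfg \<Lambda>) (image_of (cfg (bd \<Lambda>)) (peps_map T \<Lambda>))"


section \<open>MPO-injectivity\<close>

text \<open>
  The matrix product operator with site-independent tensor \<open>M\<close> of bond dimension \<open>\<kappa>\<close> on a periodic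
  chain of \<open>N\<close> sites, with kernel \<open>tr (W M\<^bsup>i\<^sub>0 j\<^sub>0\<^esup> \<cdots> M\<^bsup>i\<^sub>N\<^sub>-\<^sub>1 j\<^sub>N\<^sub>-\<^sub>1\<^esup>)\<close>. The matrix \<open>W\<close> carries the
  weights of the blocks of \<open>M\<close>; with \<open>W = 1\<close> throughout even the toric code projector
  \<open>(1 + Z\<^bsup>\<otimes>N\<^esup>) / 2\<close> would not be of this form for all \<open>N\<close>. Translation invariance is therefore
  required of the operator.
\<close>

definition mpo :: "nat \<Rightarrow> (nat \<Rightarrow> nat \<Rightarrow> complex) \<Rightarrow> ('b::finite \<Rightarrow> 'b \<Rightarrow> nat \<Rightarrow> nat \<Rightarrow> complex)
                     \<Rightarrow> nat \<Rightarrow> (nat \<Rightarrow> 'b, nat \<Rightarrow> 'b) kernel" where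
  "mpo \<kappa> W M N = (\<lambda>i j. if i \<in> cfg {..<N} \<and> j \<in> cfg {..<N} then
      (\<Sum>\<beta>\<in>{..N} \<rightarrow>\<^sub>E {..<\<kappa>}. W (\<beta> N) (\<beta> 0) * (\<Prod>k<N. M (i k) (j k) (\<beta> k) (\<beta> (Suc k))))
    else 0)"

definition rotate_cfg :: "nat \<Rightarrow> (nat \<Rightarrow> 'b) \<Rightarrow> nat \<Rightarrow> 'b" where
  "rotate_cfg N i = (\<lambda>k\<in>{..<N}. i (Suc k mod N))"

definition ti_mpo_projector :: "(nat \<Rightarrow> (nat \<Rightarrow> 'b::finite, nat \<Rightarrow> 'b) kernel) \<Rightarrow> bool" where
  "ti_mpo_projector J \<longleftrightarrow>
     (\<exists>\<kappa> W M. \<forall>N\<ge>1. J N = mpo \<kappa> W M N) \<and>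
     (\<forall>N\<ge>1. \<forall>i\<in>cfg {..<N}. \<forall>j\<in>cfg {..<N}. J N (rotate_cfg N i) (rotate_cfg N j) = J N i j) \<and>
     (\<forall>N\<ge>1. mm (cfg {..<N}) (J N) (J N) = J N)"

definition mpo_injective :: "('p::finite, 'b::finite) peps \<Rightarrow> bool" where
  "mpo_injective T \<longleftrightarrow> CARD('p) = CARD('b) ^ 4 \<and>
     (\<exists>J Y. ti_mpo_projector J \<and>
        (\<forall>v. invertible_op UNIV (cfg {..<4}) (Y v)) \<and>
        (\<forall>v p. \<forall>i\<in>cfg {..<4}. T v p i = mm (cfg {..<4}) (Y v) (J 4) p i))"


section \<open>Pulling through\<close>

text \<open>
  The power of \<open>\<surd>D\<close> compensates that the entangled pairs on the shared edges are counted in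
  both \<open>V\<^sub>A\<close> and \<open>V\<^sub>B\<close>, but only once in \<open>V\<^sub>A\<^sub>B\<close>.
\<close>

definition vhat :: "('p::finite, 'b::finite) peps \<Rightarrow> vertex set \<Rightarrow> vertex set
                      \<Rightarrow> ((vertex \<Rightarrow> 'p) \<times> (edge \<Rightarrow> 'b), edge \<Rightarrow> 'b) kernel" where
  "vhat T A B = (\<lambda>(p, y) x.
     if y \<in> cfg (bd A \<inter> bd B) \<and> x \<in> cfg (bd A - bd B) then
       of_real (sqrt (real CARD('b)) ^ card (bd A \<inter> bd B)) *
       peps_map T A p (\<lambda>e\<in>bd A. if e \<in> bd B then y e else x e)
     else 0)"

text \<open>\<open>vhat\<close> tensored with the identity on the edges in \<open>bd B - bd A\<close>, and an operator on
  the boundary of \<open>B\<close> tensored with the identity on the sites of \<open>A\<close>.\<close>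

definition vhat_ext :: "('p::finite, 'b::finite) peps \<Rightarrow> vertex set \<Rightarrow> vertex set
                      \<Rightarrow> ((vertex \<Rightarrow> 'p) \<times> (edge \<Rightarrow> 'b), edge \<Rightarrow> 'b) kernel" where
  "vhat_ext T A B = (\<lambda>(p, y) x.
     if y \<in> cfg (bd B) \<and> x \<in> cfg (bd (A \<union> B)) \<and> (\<forall>e\<in>bd B - bd A. y e = x e) then
       vhat T A B (p, restrict y (bd A \<inter> bd B)) (restrict x (bd A - bd B))
     else 0)"

definition id_tensor :: "'i set \<Rightarrow> ('j, 'k) kernel \<Rightarrow> ('i \<times> 'j, 'i \<times> 'k) kernel" where
  "id_tensor I K = (\<lambda>(p, y) (q, x). idm I p q * K y x)"

definition pulling_through :: "('p::finite, 'b::finite) peps \<Rightarrow> bool" where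
  "pulling_through T \<longleftrightarrow> (\<forall>A B. contiguous A B \<longrightarrow>
     mm (cfg A \<times> cfg (bd B)) (id_tensor (cfg A) (bd_proj T B)) (vhat_ext T A B) =
     mm (cfg (bd (A \<union> B))) (vhat_ext T A B) (bd_proj T (A \<union> B)))"


section \<open>Three rectangles and approximate factorization\<close>

definition rect :: "int \<Rightarrow> int \<Rightarrow> int \<Rightarrow> int \<Rightarrow> vertex set" where
  "rect x x' y y' = {x..<x'} \<times> {y..<y'}"

text \<open>The edges joining row \<open>y - 1\<close> to row \<open>y\<close> in the columns from \<open>x\<close> to \<open>x' - 1\<close>.\<close>

definition row_cut :: "int \<Rightarrow> int \<Rightarrow> int \<Rightarrow> edge set" where
  "row_cut y x x' = (\<lambda>t. {(t, y - 1), (t, y)}) ` {x..<x'}"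

text \<open>
  The edges joining \<open>B\<close> to the outside of the three rectangles form a lower and an upper row. Each
  row is cut, at columns \<open>s, t\<close> and \<open>s', t'\<close> respectively, into three segments of
  length at least \<open>l\<close>.
\<close>

definition three_rectangles :: "int \<Rightarrow> vertex set \<Rightarrow> vertex set \<Rightarrow> vertex set
                                  \<Rightarrow> edge set \<Rightarrow> edge set \<Rightarrow> edge set \<Rightarrow> bool" where
  "three_rectangles l A B C B\<^sub>L z B\<^sub>R \<longleftrightarrow>
     (\<exists>x\<^sub>0 x\<^sub>1 x\<^sub>2 x\<^sub>3 y y' s t s' t'.
        0 < l \<and> x\<^sub>0 < x\<^sub>1 \<and> x\<^sub>1 < x\<^sub>2 \<and> x\<^sub>2 < x\<^sub>3 \<and> y < y' \<and> 3 * l \<le> x\<^sub>2 - x\<^sub>1 \<and>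
        A = rect x\<^sub>0 x\<^sub>1 y y' \<and> B = rect x\<^sub>1 x\<^sub>2 y y' \<and> C = rect x\<^sub>2 x\<^sub>3 y y' \<and>
        l \<le> s - x\<^sub>1 \<and> l \<le> t - s \<and> l \<le> x\<^sub>2 - t \<and>
        l \<le> s' - x\<^sub>1 \<and> l \<le> t' - s' \<and> l \<le> x\<^sub>2 - t' \<and>
        B\<^sub>L = row_cut y x\<^sub>1 s \<union> row_cut y' x\<^sub>1 s' \<and>
        z = row_cut y s t \<union> row_cut y' s' t' \<and>
        B\<^sub>R = row_cut y t x\<^sub>2 \<union> row_cut y' t' x\<^sub>2)"

text \<open>The commutator condition and the condition \<open>\<parallel>\<rho>\<^bsup>1/2\<^esup> \<sigma>\<^bsup>-1\<^esup> \<rho>\<^bsup>1/2\<^esup> - J\<parallel> \<le> \<epsilon>\<close> for the region \<open>R\<close>.\<close>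

definition approximates_bd_state :: "('p::finite, 'b::finite) peps \<Rightarrow> real \<Rightarrow> vertex set
                          \<Rightarrow> (edge \<Rightarrow> 'b, edge \<Rightarrow> 'b) kernel \<Rightarrow> bool" where
  "approximates_bd_state T \<epsilon> R \<sigma> \<longleftrightarrow>
     (let I = cfg (bd R); J = bd_proj T R; r = opsqrt I (bd_state T R) in
        mm I J \<sigma> = mm I \<sigma> J \<and>
        opnorm I I (mdiff (mm I r (mm I (opinv I \<sigma>) r)) J) \<le> \<epsilon>)"

text \<open>The condition \<open>\<parallel>\<rho>\<^bsup>-1/2\<^esup> J \<sigma> J \<rho>\<^bsup>-1/2\<^esup> - J\<parallel> \<le> \<epsilon>\<close> for the region \<open>R\<close>.\<close>

definition approximates_bd_state_inv :: "('p::finite, 'b::finite) peps \<Rightarrow> real \<Rightarrow> vertex set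
                          \<Rightarrow> (edge \<Rightarrow> 'b, edge \<Rightarrow> 'b) kernel \<Rightarrow> bool" where
  "approximates_bd_state_inv T \<epsilon> R \<sigma> \<longleftrightarrow>
     (let I = cfg (bd R); J = bd_proj T R; q = supp_inv I (opsqrt I (bd_state T R)) in
        opnorm I I (mdiff (mm I q (mm I J (mm I \<sigma> (mm I J q)))) J) \<le> \<epsilon>)"

definition approx_factorizable :: "('p::finite, 'b::finite) peps \<Rightarrow> real
     \<Rightarrow> vertex set \<Rightarrow> vertex set \<Rightarrow> vertex set \<Rightarrow> edge set \<Rightarrow> edge set \<Rightarrow> edge set \<Rightarrow> bool" where
  "approx_factorizable T \<epsilon> A B C B\<^sub>L z B\<^sub>R \<longleftrightarrow>
     (let ABC = A \<union> B \<union> C; AB = A \<union> B; BC = B \<union> C;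
          a = (bd A \<inter> bd ABC) \<union> B\<^sub>L; d = (bd A \<inter> bd B) \<union> B\<^sub>L;
          b = (bd C \<inter> bd ABC) \<union> B\<^sub>R; c = (bd B \<inter> bd C) \<union> B\<^sub>R
      in \<exists>\<Delta>az \<Delta>zb \<Omega>dz \<Omega>zc.
           invertible_op (cfg (a \<union> z)) (cfg (a \<union> z)) \<Delta>az \<and>
           invertible_op (cfg (z \<union> b)) (cfg (z \<union> b)) \<Delta>zb \<and>
           invertible_op (cfg (d \<union> z)) (cfg (d \<union> z)) \<Omega>dz \<and>
           invertible_op (cfg (z \<union> c)) (cfg (z \<union> c)) \<Omega>zc \<and>
           approximates_bd_state T \<epsilon> ABC
             (mm (cfg (bd ABC)) (ext (z \<union> b) (bd ABC) \<Delta>zb) (ext (a \<union> z) (bd ABC) \<Delta>az)) \<and>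
           approximates_bd_state T \<epsilon> AB
             (mm (cfg (bd AB)) (ext (z \<union> c) (bd AB) \<Omega>zc) (ext (a \<union> z) (bd AB) \<Delta>az)) \<and>
           approximates_bd_state T \<epsilon> BC
             (mm (cfg (bd BC)) (ext (z \<union> b) (bd BC) \<Delta>zb) (ext (d \<union> z) (bd BC) \<Omega>dz)) \<and>
           approximates_bd_state_inv T \<epsilon> B
             (mm (cfg (bd B)) (ext (z \<union> c) (bd B) \<Omega>zc) (ext (d \<union> z) (bd B) \<Omega>dz)))"

end

theory Submission
  imports Defs
begin

text \<open>
  Write \<open>V = U \<rho>\<^bsup>1/2\<^esup>\<close> with \<open>U = V \<rho>\<^bsup>-1/2\<^esup>\<close> a partial isometry, so that \<open>U U\<^sup>\<dagger>\<close> is the projector onto the image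
  of \<open>V\<close>. Then \<open>\<parallel>\<rho>\<^bsup>1/2\<^esup> \<sigma>\<^bsup>-1\<^esup> \<rho>\<^bsup>1/2\<^esup> - J\<parallel> \<le> \<epsilon>\<close> says that \<open>Q = V \<sigma>\<^bsup>-1\<^esup> V\<^sup>\<dagger>\<close> is \<open>\<epsilon>\<close>-close to that projector.

  Let \<open>F\<^sub>1, F\<^sub>2\<close> be the maps with \<open>V\<^bsub>AB\<^esub> = V\<^bsub>B\<^esub> F\<^sub>1\<close> and \<open>V\<^bsub>BC\<^esub> = V\<^bsub>B\<^esub> F\<^sub>2\<close>, and let \<open>s\<^sub>1, s\<^sub>2\<close> be
  the inverses of \<open>\<sigma>\<^bsub>AB\<^esub>, \<sigma>\<^bsub>BC\<^esub>\<close>. The factors of \<open>\<sigma>\<close> commute with the maps \<open>F\<close> that do not touch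
  their edges, which yields
  \<open>Q\<^bsub>AB\<^esub> Q\<^bsub>BC\<^esub> = V\<^bsub>AB\<^esub> s\<^sub>1 F\<^sub>1\<^sup>\<dagger> \<rho>\<^bsub>B\<^esub> F\<^sub>2 s\<^sub>2 V\<^bsub>BC\<^esub>\<^sup>\<dagger>\<close> and
  \<open>Q\<^bsub>ABC\<^esub> = V\<^bsub>AB\<^esub> s\<^sub>1 F\<^sub>1\<^sup>\<dagger> \<sigma>\<^bsub>B\<^esub> F\<^sub>2 s\<^sub>2 V\<^bsub>BC\<^esub>\<^sup>\<dagger>\<close>.
  Pulling through puts \<open>J\<^bsub>B\<^esub>\<close> on both sides of \<open>\<rho>\<^bsub>B\<^esub> - \<sigma>\<^bsub>B\<^esub>\<close>, and \<open>\<rho>\<^bsub>B\<^esub>\<^bsup>1/2\<^esup> F\<^sub>2 s\<^sub>2 V\<^bsub>BC\<^esub>\<^sup>\<dagger>\<close> has the same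
  norm as \<open>Q\<^bsub>BC\<^esub>\<close>, so the two products differ by at most \<open>\<epsilon> (1 + \<epsilon>)\<^sup>2 \<le> 4 \<epsilon>\<close>. Replacing the \<open>Q\<close>'s
  by the projectors costs another \<open>\<epsilon> + (1 + \<epsilon>) \<epsilon> + \<epsilon> \<le> 4 \<epsilon>\<close>.
\<close>

section \<open>Operators over finite index sets\<close>

abbreviation vnorm :: "'i set \<Rightarrow> ('i \<Rightarrow> complex) \<Rightarrow> real" where
  "vnorm I \<psi> \<equiv> L2_set (\<lambda>i. cmod (\<psi> i)) I"

text \<open>Quantifies over all functions, not only over \<open>vecs J\<close>: both sides read
  \<open>\<psi>\<close> on \<open>J\<close> alone. A relation with an explicit constant composes
  without handling suprema; \<open>opnorm_le\<close> and \<open>opbound_opnorm\<close> connect it to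
  \<open>opnorm\<close>.\<close>

definition opbound :: "'i set \<Rightarrow> 'j set \<Rightarrow> ('i, 'j) kernel \<Rightarrow> real \<Rightarrow> bool" where
  "opbound I J M c \<longleftrightarrow> (\<forall>\<psi>. vnorm I (mv J M \<psi>) \<le> c * vnorm J \<psi>)"

section \<open>Algebra of kernels and their adjoints\<close>

lemma mm_assoc: "mm K (mm J M N) L = mm J M (mm K N L)"
proof (intro ext)
  fix i l
  have "mm K (mm J M N) L i l = (\<Sum>k\<in>K. \<Sum>j\<in>J. M i j * (N j k * L k l))"
    by (simp add: mm_def sum_distrib_right mult.assoc)
  also have "\<dots> = mm J M (mm K N L) i l"
    by (subst sum.swap) (simp add: mm_def sum_distrib_left)
  finally show "mm K (mm J M N) L i l = mm J M (mm K N L) i l" .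
qed

lemma mv_mv: "mv J M (mv K N \<psi>) = mv K (mm J M N) \<psi>"
proof
  fix i
  have "mv J M (mv K N \<psi>) i = (\<Sum>j\<in>J. \<Sum>k\<in>K. M i j * N j k * \<psi> k)"
    by (simp add: mv_def sum_distrib_left mult.assoc)
  also have "\<dots> = mv K (mm J M N) \<psi> i"
    by (subst sum.swap) (simp add: mv_def mm_def sum_distrib_right)
  finally show "mv J M (mv K N \<psi>) i = mv K (mm J M N) \<psi> i" .
qed

lemma adj_adj [simp]: "adj (adj M) = M"
  by (simp add: adj_def)

lemma adj_mm: "adj (mm J M N) = mm J (adj N) (adj M)"
  by (intro ext) (simp add: adj_def mm_def mult.commute)

lemma adj_mdiff: "adj (mdiff M N) = mdiff (adj M) (adj N)"
  by (simp add: adj_def mdiff_def)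

lemma mm_mdiff_left: "mm J (mdiff M N) L = mdiff (mm J M L) (mm J N L)"
  by (intro ext) (simp add: mm_def mdiff_def left_diff_distrib sum_subtractf)

lemma mm_mdiff_right: "mm J L (mdiff M N) = mdiff (mm J L M) (mm J L N)"
  by (intro ext) (simp add: mm_def mdiff_def right_diff_distrib sum_subtractf)

lemma mv_mdiff: "mv J (mdiff M N) \<psi> = (\<lambda>i. mv J M \<psi> i - mv J N \<psi> i)"
  by (intro ext) (simp add: mv_def mdiff_def left_diff_distrib sum_subtractf)

lemma mdiff_self_iff: "mdiff M N = (\<lambda>_ _. 0) \<longleftrightarrow> M = N"
  by (auto simp: mdiff_def fun_eq_iff)

lemma ops_mm [intro]: "M \<in> ops I J \<Longrightarrow> N \<in> ops J' K \<Longrightarrow> mm L M N \<in> ops I K"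
  by (auto simp: ops_def mm_def)

lemma ops_adj [intro]: "M \<in> ops I J \<Longrightarrow> adj M \<in> ops J I"
  by (auto simp: ops_def adj_def)

lemma ops_mdiff [intro]: "M \<in> ops I J \<Longrightarrow> N \<in> ops I J \<Longrightarrow> mdiff M N \<in> ops I J"
  by (auto simp: ops_def mdiff_def)

lemma ops_idm [intro]: "idm I \<in> ops I I"
  by (auto simp: ops_def idm_def)

lemma adj_idm [simp]: "adj (idm I) = idm I"
  by (auto simp: adj_def idm_def fun_eq_iff)

lemma mm_idm_left:
  assumes "finite I" "M \<in> ops I J"
  shows "mm I (idm I) M = M"
proof (intro ext)
  fix i k
  have "mm I (idm I) M i k = (\<Sum>j\<in>I. if i = j then M j k else 0)"
    by (auto simp: mm_def idm_def intro!: sum.cong)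
  also have "\<dots> = M i k" using assms by (auto simp: ops_def)
  finally show "mm I (idm I) M i k = M i k" .
qed

lemma mm_idm_right: "finite J \<Longrightarrow> M \<in> ops I J \<Longrightarrow> mm J M (idm J) = M"
  using mm_idm_left[of J "adj M" I] by (metis adj_adj adj_idm adj_mm ops_adj)

lemma mv_idm:
  assumes "finite I" "i \<in> I"
  shows "mv I (idm I) \<psi> i = \<psi> i"
proof -
  have "mv I (idm I) \<psi> i = (\<Sum>j\<in>I. if i = j then \<psi> j else 0)"
    unfolding mv_def idm_def using assms(2) by (intro sum.cong) simp_all
  then show ?thesis using assms by simp
qed

lemma mv_vecs: "M \<in> ops I J \<Longrightarrow> mv J M \<psi> \<in> vecs I"
  by (auto simp: mv_def ops_def vecs_def)

section \<open>Inner product and Euclidean norm\<close>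

lemma cinner_on_mv: "cinner_on I \<phi> (mv J M \<psi>) = cinner_on J (mv I (adj M) \<phi>) \<psi>"
proof -
  have "cinner_on I \<phi> (mv J M \<psi>) = (\<Sum>i\<in>I. \<Sum>j\<in>J. cnj (\<phi> i) * M i j * \<psi> j)"
    by (simp add: cinner_on_def mv_def sum_distrib_left mult.assoc)
  also have "\<dots> = cinner_on J (mv I (adj M) \<phi>) \<psi>"
    by (subst sum.swap) (simp add: cinner_on_def mv_def adj_def sum_distrib_left sum_distrib_right mult_ac)
  finally show ?thesis .
qed

lemma cinner_on_self: "cinner_on I \<psi> \<psi> = of_real ((vnorm I \<psi>)\<^sup>2)"
proof -
  have "cinner_on I \<psi> \<psi> = of_real (\<Sum>i\<in>I. (cmod (\<psi> i))\<^sup>2)"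
    unfolding cinner_on_def of_real_sum by (rule sum.cong) (simp_all only: complex_norm_square mult.commute)
  then show ?thesis by (simp only: L2_set_def real_sqrt_pow2 sum_nonneg zero_le_power2)
qed

lemma cinner_on_commute: "cnj (cinner_on I \<phi> \<psi>) = cinner_on I \<psi> \<phi>"
  by (simp add: cinner_on_def mult.commute)

lemma cinner_on_diff_right:
  "cinner_on I \<phi> (\<lambda>i. \<psi> i - \<xi> i) = cinner_on I \<phi> \<psi> - cinner_on I \<phi> \<xi>"
  by (simp add: cinner_on_def right_diff_distrib sum_subtractf)

lemma cinner_on_diff_left:
  "cinner_on I (\<lambda>i. \<psi> i - \<xi> i) \<phi> = cinner_on I \<psi> \<phi> - cinner_on I \<xi> \<phi>"
  by (simp add: cinner_on_def left_diff_distrib sum_subtractf)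

lemma Cauchy_Schwarz_cinner_on: "cmod (cinner_on I \<phi> \<psi>) \<le> vnorm I \<phi> * vnorm I \<psi>"
proof -
  have "cmod (cinner_on I \<phi> \<psi>) \<le> (\<Sum>i\<in>I. \<bar>cmod (\<phi> i)\<bar> * \<bar>cmod (\<psi> i)\<bar>)"
    unfolding cinner_on_def by (rule order_trans[OF norm_sum]) (simp add: norm_mult)
  also note L2_set_mult_ineq
  finally show ?thesis .
qed

lemma vnorm_diff: "vnorm I (\<lambda>i. \<phi> i - \<psi> i) \<le> vnorm I \<phi> + vnorm I \<psi>"
proof -
  have "vnorm I (\<lambda>i. \<phi> i - \<psi> i) \<le> L2_set (\<lambda>i. cmod (\<phi> i) + cmod (\<psi> i)) I"
    by (rule L2_set_mono) (auto simp: norm_triangle_ineq4)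
  also note L2_set_triangle_ineq
  finally show ?thesis .
qed

lemma vnorm_eq_0: "finite I \<Longrightarrow> \<psi> \<in> vecs I \<Longrightarrow> vnorm I \<psi> = 0 \<longleftrightarrow> \<psi> = (\<lambda>_. 0)"
  by (auto simp: L2_set_eq_0_iff vecs_def fun_eq_iff)

text \<open>The squared norm of an image depends on the operator only through its Gram operator.
  This lets a PEPS map be traded for the square root of its boundary state without changing
  norms.\<close>

lemma vnorm_mv_cong:
  assumes "mm I (adj M) M = mm J (adj N) N"
  shows "vnorm I (mv K M \<psi>) = vnorm J (mv K N \<psi>)"
proof -
  have "cinner_on I (mv K M \<psi>) (mv K M \<psi>) = cinner_on J (mv K N \<psi>) (mv K N \<psi>)"
    unfolding cinner_on_mv mv_mv assms ..
  then have "(vnorm I (mv K M \<psi>))\<^sup>2 = (vnorm J (mv K N \<psi>))\<^sup>2"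
    unfolding cinner_on_self of_real_eq_iff .
  then show ?thesis by simp
qed

section \<open>Calculus of operator bounds\<close>

lemma opbound_mm:
  assumes "opbound I J M c" "opbound J K N d" "0 \<le> c"
  shows "opbound I K (mm J M N) (c * d)"
  unfolding opbound_def
proof
  fix \<psi>
  have "vnorm I (mv K (mm J M N) \<psi>) \<le> c * vnorm J (mv K N \<psi>)"
    using assms(1) unfolding opbound_def mv_mv[symmetric] by blast
  also have "\<dots> \<le> c * (d * vnorm K \<psi>)"
    using assms(2,3) unfolding opbound_def by (intro mult_left_mono) auto
  finally show "vnorm I (mv K (mm J M N) \<psi>) \<le> c * d * vnorm K \<psi>" by simp
qed

lemma opbound_mdiff:
  assumes "opbound I J M c" "opbound I J N d"
  shows "opbound I J (mdiff M N) (c + d)"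
  unfolding opbound_def mv_mdiff
proof
  fix \<psi>
  have "vnorm I (\<lambda>i. mv J M \<psi> i - mv J N \<psi> i) \<le> vnorm I (mv J M \<psi>) + vnorm I (mv J N \<psi>)"
    by (rule vnorm_diff)
  also have "\<dots> \<le> c * vnorm J \<psi> + d * vnorm J \<psi>"
    using assms unfolding opbound_def by (intro add_mono) auto
  finally show "vnorm I (\<lambda>i. mv J M \<psi> i - mv J N \<psi> i) \<le> (c + d) * vnorm J \<psi>"
    by (simp add: distrib_right)
qed

lemma opbound_mdiff_swap: "opbound I J (mdiff M N) c \<Longrightarrow> opbound I J (mdiff N M) c"
  unfolding opbound_def mv_mdiff by (simp add: norm_minus_commute)

lemma opbound_triangle:
  assumes "opbound I J (mdiff M N) c" "opbound I J (mdiff N L) d"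
  shows "opbound I J (mdiff M L) (c + d)"
proof -
  have "mdiff M L = mdiff (mdiff M N) (mdiff L N)" by (simp add: mdiff_def)
  then show ?thesis using opbound_mdiff[OF assms(1) opbound_mdiff_swap[OF assms(2)]] by simp
qed

lemma opbound_near:
  assumes "opbound I J (mdiff M N) c" "opbound I J N d"
  shows "opbound I J M (c + d)"
proof -
  have "M = mdiff (mdiff M N) (mdiff (\<lambda>_ _. 0) N)" by (simp add: mdiff_def)
  moreover have "opbound I J (mdiff (\<lambda>_ _. 0) N) d"
    using assms(2) by (simp add: opbound_def mdiff_def mv_def sum_negf)
  ultimately show ?thesis using opbound_mdiff[OF assms(1)] by metis
qed

lemma opbound_mono: "opbound I J M c \<Longrightarrow> c \<le> d \<Longrightarrow> opbound I J M d"
  unfolding opbound_def by (meson L2_set_nonneg mult_right_mono order_trans)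

text \<open>The squared norm of \<open>?\<phi>\<close> is the inner product of \<open>\<psi>\<close>
  with \<open>M ?\<phi>\<close>. Cauchy-Schwarz bounds it by \<open>c\<close> times both norms, and
  one factor cancels.\<close>

lemma opbound_adj:
  assumes "opbound I J M c" "0 \<le> c"
  shows "opbound J I (adj M) c"
  unfolding opbound_def
proof
  fix \<psi>
  let ?\<phi> = "mv I (adj M) \<psi>"
  have "(vnorm J ?\<phi>)\<^sup>2 = cmod (cinner_on J ?\<phi> ?\<phi>)"
    by (simp add: cinner_on_self norm_power del: of_real_power)
  also have "\<dots> = cmod (cinner_on I \<psi> (mv J M ?\<phi>))"
    by (simp add: cinner_on_mv)
  also have "\<dots> \<le> vnorm I \<psi> * vnorm I (mv J M ?\<phi>)" by (rule Cauchy_Schwarz_cinner_on)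
  also have "\<dots> \<le> vnorm I \<psi> * (c * vnorm J ?\<phi>)"
    using assms(1) unfolding opbound_def by (intro mult_left_mono) (auto simp: L2_set_nonneg)
  finally have *: "vnorm J ?\<phi> * vnorm J ?\<phi> \<le> (c * vnorm I \<psi>) * vnorm J ?\<phi>"
    by (simp add: power2_eq_square mult_ac)
  show "vnorm J ?\<phi> \<le> c * vnorm I \<psi>"
  proof (cases "vnorm J ?\<phi> = 0")
    case True
    then show ?thesis using assms(2) by (simp add: L2_set_nonneg)
  next
    case False
    then show ?thesis using * mult_right_le_imp_le L2_set_nonneg
      by (metis less_eq_real_def)
  qed
qed

section \<open>Comparison with the operator norm\<close>

lemma mv_cong: "(\<And>j. j \<in> J \<Longrightarrow> \<psi> j = \<phi> j) \<Longrightarrow> mv J M \<psi> = mv J M \<phi>"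
  by (simp add: mv_def)

lemma mv_scale: "mv J M (\<lambda>j. a * \<psi> j) = (\<lambda>i. a * mv J M \<psi> i)"
  by (simp add: mv_def sum_distrib_left mult_ac)

lemma vnorm_scale: "vnorm I (\<lambda>i. a * \<psi> i) = cmod a * vnorm I \<psi>"
  by (simp add: norm_mult L2_set_right_distrib)

text \<open>The sum of the moduli of all entries is a crude bound, good enough to make the supremum
  in \<open>opnorm\<close> finite.\<close>

lemma opbound_exists:
  assumes "finite I" "finite J"
  shows "\<exists>c\<ge>0. opbound I J M c"
proof (intro exI conjI)
  show "0 \<le> (\<Sum>i\<in>I. \<Sum>j\<in>J. cmod (M i j))" by (simp add: sum_nonneg)
  show "opbound I J M (\<Sum>i\<in>I. \<Sum>j\<in>J. cmod (M i j))"
    unfolding opbound_def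
  proof
    fix \<psi>
    have "vnorm I (mv J M \<psi>) \<le> (\<Sum>i\<in>I. cmod (mv J M \<psi> i))"
      by (rule L2_set_le_sum) simp
    also have "\<dots> \<le> (\<Sum>i\<in>I. \<Sum>j\<in>J. cmod (M i j) * vnorm J \<psi>)"
      unfolding mv_def
      by (intro sum_mono order_trans[OF norm_sum])
        (simp add: norm_mult mult_left_mono member_le_L2_set[OF assms(2), of _ "\<lambda>j. cmod (\<psi> j)"])
    finally show "vnorm I (mv J M \<psi>) \<le> (\<Sum>i\<in>I. \<Sum>j\<in>J. cmod (M i j)) * vnorm J \<psi>"
      by (simp add: sum_distrib_right)
  qed
qed

lemma opnorm_le:
  assumes "opbound I J M c" "0 \<le> c"
  shows "opnorm I J M \<le> c"
  unfolding opnorm_def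
proof (rule cSUP_least)
  show "{\<psi> \<in> vecs J. vnorm J \<psi> \<le> 1} \<noteq> {}"
    by (auto intro!: exI[of _ "\<lambda>_. 0"] simp: vecs_def L2_set_def)
next
  fix \<psi> assume "\<psi> \<in> {\<psi> \<in> vecs J. vnorm J \<psi> \<le> 1}"
  then have "c * vnorm J \<psi> \<le> c * 1" using assms(2) by (intro mult_left_mono) auto
  then show "vnorm I (mv J M \<psi>) \<le> c"
    using assms(1) unfolding opbound_def by (metis mult.right_neutral order_trans)
qed

lemma bdd_above_vnorm_mv:
  assumes "finite I" "finite J"
  shows "bdd_above ((\<lambda>\<psi>. vnorm I (mv J M \<psi>)) ` {\<psi> \<in> vecs J. vnorm J \<psi> \<le> 1})"
proof -
  obtain c where c: "0 \<le> c" "opbound I J M c" using opbound_exists[OF assms] by blast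
  show ?thesis
  proof (rule bdd_aboveI2)
    fix \<psi> assume "\<psi> \<in> {\<psi> \<in> vecs J. vnorm J \<psi> \<le> 1}"
    then have "c * vnorm J \<psi> \<le> c * 1" using c(1) by (intro mult_left_mono) auto
    then show "vnorm I (mv J M \<psi>) \<le> c"
      using c(2) unfolding opbound_def by (metis mult.right_neutral order_trans)
  qed
qed

lemma opbound_opnorm:
  assumes "finite I" "finite J"
  shows "opbound I J M (opnorm I J M)"
  unfolding opbound_def
proof
  fix \<psi>
  obtain c where c: "0 \<le> c" "opbound I J M c" using opbound_exists[OF assms] by blast
  note bdd = bdd_above_vnorm_mv[OF assms, of M]
  show "vnorm I (mv J M \<psi>) \<le> opnorm I J M * vnorm J \<psi>"
  proof (cases "vnorm J \<psi> = 0")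
    \<comment> \<open>A vector of norm zero cannot be normalized; the crude bound \<open>c\<close>
      shows that its image has norm zero too.\<close>
    case True
    then show ?thesis using c(2) unfolding opbound_def by (metis mult_zero_right)
  next
    case False
    define n where "n = vnorm J \<psi>"
    have n: "0 < n" using False L2_set_nonneg[of "\<lambda>j. cmod (\<psi> j)" J] unfolding n_def by linarith
    \<comment> \<open>Scaled to norm one and cut off outside \<open>J\<close>, so that it belongs to
      the set over which \<open>opnorm\<close> takes its supremum.\<close>
    define \<phi> where "\<phi> j = (if j \<in> J then of_real (inverse n) * \<psi> j else 0)" for j
    have "vnorm J \<phi> = vnorm J (\<lambda>j. of_real (inverse n) * \<psi> j)"
      by (rule L2_set_cong) (simp_all add: \<phi>_def)
    also have "\<dots> = inverse n * n" using n by (simp add: vnorm_scale n_def[symmetric] del: of_real_inverse)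
    finally have "vnorm J \<phi> = 1" using n by simp
    then have "vnorm I (mv J M \<phi>) \<le> opnorm I J M"
      unfolding opnorm_def by (intro cSUP_upper bdd) (auto simp: vecs_def \<phi>_def)
    moreover have "mv J M \<psi> = (\<lambda>i. of_real n * mv J M \<phi> i)"
      unfolding mv_scale[symmetric] by (rule mv_cong) (use n in \<open>simp add: \<phi>_def\<close>)
    ultimately show ?thesis using n by (simp add: vnorm_scale n_def[symmetric] mult.commute)
  qed
qed

lemma opnorm_nonneg:
  assumes "finite I" "finite J"
  shows "0 \<le> opnorm I J M"
proof -
  have "vnorm I (mv J M (\<lambda>_. 0)) \<le> opnorm I J M"
    unfolding opnorm_def
    by (rule cSUP_upper[OF _ bdd_above_vnorm_mv[OF assms]]) (simp add: vecs_def L2_set_def)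
  then show ?thesis using L2_set_nonneg order_trans by metis
qed

lemma mv_delta: "finite J \<Longrightarrow> k \<in> J \<Longrightarrow> mv J M (\<lambda>j. if j = k then 1 else 0) = (\<lambda>i. M i k)"
  by (simp add: mv_def if_distrib[of "\<lambda>a. _ * a"] cong: if_cong)

lemma vnorm_delta: "finite J \<Longrightarrow> k \<in> J \<Longrightarrow> vnorm J (\<lambda>j. if j = k then 1 else 0) = 1"
  by (simp add: L2_set_def if_distrib[of cmod] if_distrib[of "\<lambda>a. a\<^sup>2"] cong: if_cong)

text \<open>The entry is one coordinate of the image of the unit vector at \<open>j\<close>.\<close>

lemma opbound_entry:
  assumes "opbound I J M c" "finite I" "finite J" "i \<in> I" "j \<in> J"
  shows "cmod (M i j) \<le> c"
proof -
  have "cmod (M i j) \<le> vnorm I (\<lambda>i. M i j)"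
    using member_le_L2_set[of I i "\<lambda>i. cmod (M i j)"] assms(2,4) by simp
  also have "\<dots> \<le> c"
    using assms(1)[unfolded opbound_def, rule_format, of "\<lambda>k. if k = j then 1 else 0"] assms(3,5)
    by (simp add: mv_delta vnorm_delta)
  finally show ?thesis .
qed

lemma adj_mm_self_eq_0:
  assumes "finite I" "M \<in> ops I J" "finite J" "mm I (adj M) M = (\<lambda>_ _. 0)"
  shows "M = (\<lambda>_ _. 0)"
proof (intro ext)
  fix i j
  show "M i j = 0"
  proof (cases "i \<in> I \<and> j \<in> J")
    case True
    \<comment> \<open>Comparison with the zero operator, whose Gram operator is the same.\<close>
    have "vnorm I (mv J M \<psi>) = vnorm J (mv J (\<lambda>(_::'b) _. 0) \<psi>)" for \<psi>
      by (rule vnorm_mv_cong) (simp only: assms(4), simp add: mm_def)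
    then have "opbound I J M 0" by (simp add: opbound_def mv_def L2_set_def)
    then show ?thesis using opbound_entry[OF _ assms(1,3)] True by fastforce
  qed (use assms(2) in \<open>auto simp: ops_def\<close>)
qed

section \<open>Orthogonal projectors and inverses on the support\<close>

definition is_projector :: "'i set \<Rightarrow> ('i, 'i) kernel \<Rightarrow> bool" where
  "is_projector I P \<longleftrightarrow> P \<in> ops I I \<and> adj P = P \<and> mm I P P = P"

lemma mdiff_zero [simp]: "mdiff M (\<lambda>_ _. 0) = M"
  by (simp add: mdiff_def)

lemma mm_zero_right [simp]: "mm J M (\<lambda>_ _. 0) = (\<lambda>_ _. 0)"
  by (simp add: mm_def)

lemma mm_zero_left [simp]: "mm J (\<lambda>_ _. 0) M = (\<lambda>_ _. 0)"
  by (simp add: mm_def)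

lemma mv_zero [simp]: "mv J M (\<lambda>_. 0) = (\<lambda>_. 0)"
  by (simp add: mv_def)

lemma ops_mono: "M \<in> ops I J \<Longrightarrow> I \<subseteq> I' \<Longrightarrow> J \<subseteq> J' \<Longrightarrow> M \<in> ops I' J'"
  by (auto simp: ops_def)

section \<open>Existence and uniqueness of orthogonal projectors\<close>

lemma is_projector_compl:
  assumes "finite I" "is_projector I P"
  shows "is_projector I (mdiff (idm I) P)"
proof -
  have P: "P \<in> ops I I" "adj P = P" "mm I P P = P" using assms(2) by (auto simp: is_projector_def)
  then have "mm I (mdiff (idm I) P) (mdiff (idm I) P) = mdiff (idm I) P"
    using assms(1)
    by (simp add: mm_mdiff_left mm_mdiff_right mm_idm_left[OF _ ops_idm] mm_idm_left mm_idm_right)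
      (simp add: mdiff_def)
  then show ?thesis unfolding is_projector_def using P by (auto simp: adj_mdiff)
qed

text \<open>Gram-Schmidt over the columns of \<open>V\<close>: \<open>Q\<close> projects away the
  span of the columns treated so far. The kernel \<open>W\<close> certifies that the complementary
  projector has its range inside that span.\<close>

lemma complement_projector_exists:
  assumes "finite I" "finite N" "V \<in> ops I N"
  shows "\<exists>Q W. is_projector I Q \<and> mm I Q V = (\<lambda>_ _. 0) \<and> W \<in> ops N I
           \<and> mdiff (idm I) Q = mm N V W"
  using assms(2,3)
proof (induction N arbitrary: V rule: finite_induct)
  case empty
  then have "V = (\<lambda>_ _. 0)" by (auto simp: ops_def fun_eq_iff)
  then show ?case using assms(1)
    by (intro exI[of _ "idm I"] exI[of _ "\<lambda>_ _. 0"])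
      (auto simp: is_projector_def mm_idm_left[OF _ ops_idm] mdiff_def mm_def[of "{}"] ops_def[of "{}"])
next
  case (insert n N)
  \<comment> \<open>Column \<open>n\<close> is cleared so that the induction hypothesis
    applies.\<close>
  define V0 where "V0 = (\<lambda>i j. if j \<in> N then V i j else 0)"
  have V0: "V0 \<in> ops I N" using insert.prems by (auto simp: V0_def ops_def)
  obtain Q W where Q: "is_projector I Q" "mm I Q V0 = (\<lambda>_ _. 0)" "W \<in> ops N I"
      "mdiff (idm I) Q = mm N V0 W"
    using insert.IH[OF V0] by blast
  have Qops: "Q \<in> ops I I" and Qadj: "adj Q = Q" and QQ: "mm I Q Q = Q"
    using Q(1) by (auto simp: is_projector_def)
  \<comment> \<open>The new column as a kernel on a one-point set, so that the product laws cover
    it; \<open>u\<close> below is its part orthogonal to the earlier columns.\<close>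
  define v :: "('a, unit) kernel" where "v = (\<lambda>i _. V i n)"
  have v: "v \<in> ops I UNIV" using insert.prems by (auto simp: ops_def v_def)
  define u where "u = mm I Q v"
  have Qu: "mm I Q u = u" by (simp add: u_def mm_assoc[symmetric] QQ)
  have VN: "V i j = (if j \<in> N then V0 i j else if j = n then v i () else 0)" for i j
    using insert.prems by (auto simp: V0_def v_def ops_def)
  show ?case
  proof (cases "u = (\<lambda>_ _. 0)")
    \<comment> \<open>The new column depends on the earlier ones. \<open>Q\<close> and
      \<open>W\<close> stay, since row \<open>n\<close> of \<open>W\<close> is zero.\<close>
    case True
    have "mm I Q V i j = 0" for i j
    proof -
      have "mm I Q V i j = (if j \<in> N then mm I Q V0 i j else if j = n then u i () else 0)"
        unfolding mm_def u_def VN[abs_def] by auto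
      then show ?thesis by (simp add: Q(2) True)
    qed
    moreover have "mm (insert n N) V W = mm N V0 W"
    proof (intro ext)
      fix i k
      have "W n k = 0" using Q(3) insert.hyps by (auto simp: ops_def)
      then show "mm (insert n N) V W i k = mm N V0 W i k"
        unfolding mm_def using insert.hyps by (simp add: V0_def)
    qed
    ultimately show ?thesis using Q
      by (intro exI[of _ Q] exI[of _ W]) (auto simp: fun_eq_iff intro: ops_mono)
  next
    case False
    define s where "s = vnorm I (\<lambda>i. u i ())"
    have uops: "u \<in> ops I UNIV" unfolding u_def using Qops v by blast
    have s: "0 < s"
    proof -
      have "s \<noteq> 0"
      proof
        assume "s = 0"
        moreover have "(\<lambda>i. u i ()) \<in> vecs I" using uops by (auto simp: ops_def vecs_def)
        ultimately have "(\<lambda>i. u i ()) = (\<lambda>_. 0)" unfolding s_def using vnorm_eq_0[OF assms(1)] by blast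
        then show False using False by (auto simp: fun_eq_iff)
      qed
      then show ?thesis using L2_set_nonneg[of "\<lambda>i. cmod (u i ())" I] unfolding s_def by linarith
    qed
    define w where "w = (\<lambda>i (x::unit). u i x / of_real s)"
    have w: "w \<in> ops I UNIV" using uops by (auto simp: ops_def w_def)
    have us: "u = (\<lambda>i x. of_real s * w i x)" using s by (simp add: w_def)
    have Qw: "mm I Q w = w"
      using Qu by (auto simp: w_def mm_def fun_eq_iff simp flip: sum_divide_distrib)
    have adjQw: "mm I (adj w) Q = adj w"
      using arg_cong[OF Qw, of adj] by (simp add: adj_mm Qadj)
    have ww: "mm I (adj w) w = idm UNIV"
    proof (intro ext)
      fix x y :: unit
      have "mm I (adj w) w x y = cinner_on I (\<lambda>i. w i ()) (\<lambda>i. w i ())"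
        by (simp add: mm_def adj_def cinner_on_def)
      also have "\<dots> = cinner_on I (\<lambda>i. u i ()) (\<lambda>i. u i ()) / of_real (s * s)"
        unfolding cinner_on_def w_def by (simp add: sum_divide_distrib)
      also have "\<dots> = 1"
        unfolding cinner_on_self s_def[symmetric] using s by (simp add: power2_eq_square)
      finally show "mm I (adj w) w x y = idm UNIV x y" by (simp add: idm_def)
    qed
    have wv: "mm I (adj w) v = (\<lambda>x y. of_real s)"
    proof -
      have "mm I (adj w) v = mm I (mm I (adj w) Q) v" by (simp add: adjQw)
      also have "\<dots> = mm I (adj w) u" by (simp add: mm_assoc u_def)
      also have "\<dots> = (\<lambda>x y. of_real s * mm I (adj w) w x y)"
        by (simp add: us mm_def sum_distrib_left mult_ac)
      finally show ?thesis by (simp add: ww idm_def)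
    qed
    have wV0: "mm I (adj w) V0 = (\<lambda>_ _. 0)"
    proof -
      have "mm I (adj w) V0 = mm I (mm I (adj w) Q) V0" by (simp add: adjQw)
      then show ?thesis by (simp add: mm_assoc Q(2))
    qed
    \<comment> \<open>Subtracts the projector onto the line of the unit vector \<open>w\<close>. As
      \<open>Q\<close> fixes \<open>w\<close>, the result is a projector again.\<close>
    define Q' where "Q' = mdiff Q (mm UNIV w (adj w))"
    have id1: "mm UNIV w (idm UNIV) = w" "mm UNIV (idm UNIV) (adj w) = adj w"
      using w by (auto intro!: mm_idm_left mm_idm_right)
    have "is_projector I Q'"
      unfolding is_projector_def
    proof (intro conjI)
      show "Q' \<in> ops I I" unfolding Q'_def using Qops w by blast
      show "adj Q' = Q'" by (simp add: Q'_def adj_mdiff adj_mm Qadj)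
      have "mm I (mm UNIV w (adj w)) (mm UNIV w (adj w)) = mm UNIV w (mm UNIV (mm I (adj w) w) (adj w))"
        by (simp only: mm_assoc)
      also have "\<dots> = mm UNIV w (adj w)" by (simp only: ww id1)
      finally have 1: "mm I (mm UNIV w (adj w)) (mm UNIV w (adj w)) = mm UNIV w (adj w)" .
      have 2: "mm I Q (mm UNIV w (adj w)) = mm UNIV w (adj w)"
        by (simp add: mm_assoc[symmetric] Qw)
      have 3: "mm I (mm UNIV w (adj w)) Q = mm UNIV w (adj w)"
        by (simp add: mm_assoc adjQw)
      show "mm I Q' Q' = Q'"
        by (simp add: Q'_def mm_mdiff_left mm_mdiff_right 1 2 3 QQ) (simp add: mdiff_def)
    qed
    moreover have "mm I Q' V = (\<lambda>_ _. 0)"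
    proof -
      have "mm I Q' V0 = (\<lambda>_ _. 0)"
        by (simp add: Q'_def mm_mdiff_left mm_assoc Q(2) wV0)
      moreover have "mm I Q' v = (\<lambda>_ _. 0)"
        by (simp add: Q'_def mm_mdiff_left mm_assoc wv u_def[symmetric])
          (simp add: us mm_def mdiff_def UNIV_unit mult.commute)
      moreover have "mm I Q' V i j = (if j \<in> N then mm I Q' V0 i j else if j = n then mm I Q' v i () else 0)"
        for i j unfolding mm_def VN[abs_def] by auto
      ultimately show ?thesis by (auto simp: fun_eq_iff)
    qed
    moreover define t where "t = mm I W v"
    \<comment> \<open>Since \<open>w\<close> is \<open>(v - V0 t) / s\<close>, adding the projector
      onto \<open>w\<close> to \<open>V0 W\<close> puts the adjoint of \<open>w\<close>, divided by
      \<open>s\<close>, into row \<open>n\<close> and subtracts \<open>t\<close> times that row from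
      the other rows.\<close>
    moreover define W' where "W' = (\<lambda>j k. if j = n then cnj (w k ()) / of_real s
        else W j k - t j () * (cnj (w k ()) / of_real s))"
    have t: "t \<in> ops N UNIV" unfolding t_def using Q(3) v by blast
    have u_eq: "u i () = v i () - (\<Sum>j\<in>N. V0 i j * t j ())" for i
    proof -
      have "mm I (mdiff (idm I) Q) v = mm N V0 t" by (simp add: Q(4) t_def mm_assoc)
      then have "mdiff v u = mm N V0 t"
        using assms(1) v by (simp add: mm_mdiff_left mm_idm_left u_def)
      then have "v i () - u i () = mm N V0 t i ()" by (metis mdiff_def)
      then show ?thesis by (simp add: mm_def algebra_simps)
    qed
    have "W' \<in> ops (insert n N) I"
      using Q(3) w t by (auto simp: ops_def W'_def)
    moreover have "mdiff (idm I) Q' = mm (insert n N) V W'"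
    proof (intro ext)
      fix i k
      have "mm (insert n N) V W' i k = v i () * (cnj (w k ()) / of_real s) +
          (\<Sum>j\<in>N. V0 i j * (W j k - t j () * (cnj (w k ()) / of_real s)))"
        unfolding mm_def using insert.hyps
        by (auto simp: W'_def v_def V0_def intro!: sum.cong)
      also have "\<dots> = mm N V0 W i k + u i () * (cnj (w k ()) / of_real s)"
        unfolding u_eq mm_def
        by (simp add: algebra_simps sum_subtractf sum_distrib_left sum_distrib_right
            sum_divide_distrib)
      also have "u i () * (cnj (w k ()) / of_real s) = w i () * cnj (w k ())"
        using s by (simp add: us)
      also have "mm N V0 W i k + w i () * cnj (w k ()) = mdiff (idm I) Q' i k"
        unfolding Q(4)[symmetric] by (simp add: Q'_def mdiff_def mm_def adj_def UNIV_unit)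
      finally show "mdiff (idm I) Q' i k = mm (insert n N) V W' i k" ..
    qed
    ultimately show ?thesis by blast
  qed
qed

lemma range_projector_exists:
  assumes "finite I" "finite N" "V \<in> ops I N"
  shows "\<exists>P W. is_projector I P \<and> mm I P V = V \<and> W \<in> ops N I \<and> P = mm N V W"
proof -
  obtain Q W where Q: "is_projector I Q" "mm I Q V = (\<lambda>_ _. 0)" "W \<in> ops N I"
      "mdiff (idm I) Q = mm N V W"
    using complement_projector_exists[OF assms] by blast
  have "mm I (mdiff (idm I) Q) V = V"
    using assms by (simp add: mm_mdiff_left Q(2) mm_idm_left)
  then show ?thesis
    using is_projector_compl[OF assms(1) Q(1)] Q(3,4) by blast
qed

text \<open>Each column of \<open>P'\<close> is the image of a basis vector, so it lies in the range
  of \<open>P\<close> and is fixed by \<open>P\<close>.\<close>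

lemma mm_projector_of_image_subset:
  assumes "finite I" "is_projector I P" "P' \<in> ops I J" "finite J"
    and "image_of J P' \<subseteq> image_of I P"
  shows "mm I P P' = P'"
proof (intro ext)
  fix i k
  show "mm I P P' i k = P' i k"
  proof (cases "k \<in> J")
    case True
    have "(\<lambda>i. P' i k) \<in> image_of J P'"
      unfolding image_of_def using True assms(4)
      by (intro image_eqI[of _ _ "\<lambda>j. if j = k then 1 else 0"]) (auto simp: mv_delta vecs_def)
    then obtain \<psi> where "(\<lambda>i. P' i k) = mv I P \<psi>" using assms(5) by (auto simp: image_of_def)
    then have "mv I P (\<lambda>i. P' i k) = (\<lambda>i. P' i k)"
      using assms(2) by (simp add: mv_mv is_projector_def)
    then show ?thesis by (metis mm_def mv_def)
  qed (use assms(3) in \<open>auto simp: mm_def ops_def\<close>)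
qed

text \<open>Each projector fixes the columns of the other; taking adjoints in one of the two
  equations identifies them.\<close>

lemma is_projector_unique:
  assumes "finite I" "is_projector I P" "is_projector I P'" "image_of I P = image_of I P'"
  shows "P = P'"
proof -
  have "mm I P P' = P'" "mm I P' P = P"
    using assms by (auto intro!: mm_projector_of_image_subset simp: is_projector_def)
  then show ?thesis using assms(2,3) unfolding is_projector_def by (metis adj_mm)
qed

lemma orth_proj_eqI:
  assumes "finite I" "is_projector I P" "image_of I P = S"
  shows "orth_proj I S = P"
  unfolding orth_proj_def
proof (rule the_equality)
  show "P \<in> ops I I \<and> adj P = P \<and> mm I P P = P \<and> image_of I P = S"
    using assms(2,3) unfolding is_projector_def by blast
  fix P' assume P': "P' \<in> ops I I \<and> adj P' = P' \<and> mm I P' P' = P' \<and> image_of I P' = S"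
  show "P' = P"
    by (rule is_projector_unique[OF assms(1) _ assms(2)])
      (use P' assms(3) in \<open>simp_all only: is_projector_def simp_thms\<close>)
qed

section \<open>Support projectors and inverses on the support\<close>

lemma image_of_projector:
  assumes "is_projector I P"
  shows "image_of I P = {\<psi> \<in> vecs I. mv I P \<psi> = \<psi>}"
proof -
  have "mv I P (mv I P \<psi>) = mv I P \<psi>" for \<psi>
    using assms by (simp add: mv_mv is_projector_def)
  moreover have "mv I P \<psi> \<in> vecs I" for \<psi>
    using assms by (intro mv_vecs) (simp add: is_projector_def)
  ultimately show ?thesis unfolding image_of_def by (intro equalityI subsetI) (auto intro: image_eqI[OF sym])
qed

text \<open>As \<open>M\<close> is self-adjoint, adjoints give \<open>M P = M\<close> and
  \<open>P = adj W M\<close>, so \<open>M\<close> and \<open>P\<close> have the same kernel. The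
  orthogonal complement of the kernel of a projector is its range.\<close>

lemma supp_proj_eqI:
  assumes "finite I" "is_projector I P" "adj M = M" "mm I P M = M" "P = mm I M W"
  shows "supp_proj I M = P"
proof -
  have P: "P \<in> ops I I" "adj P = P" "mm I P P = P" using assms(2) by (auto simp: is_projector_def)
  have "mm I M P = M" using arg_cong[OF assms(4), of adj] by (simp add: adj_mm assms(3) P(2))
  moreover have "P = mm I (adj W) M" using P(2) assms(3,5) by (metis adj_mm)
  ultimately have "mv I M \<psi> = (\<lambda>_. 0) \<longleftrightarrow> mv I P \<psi> = (\<lambda>_. 0)" for \<psi>
  proof -
    assume a: "mm I M P = M" "P = mm I (adj W) M"
    have "mv I P \<psi> = mv I (adj W) (mv I M \<psi>)" "mv I M \<psi> = mv I M (mv I P \<psi>)"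
      using a by (simp_all add: mv_mv)
    then show ?thesis by (metis mv_zero)
  qed
  then have ker: "kernel_of I M = kernel_of I P" by (simp add: kernel_of_def)
  have "image_of I P = ortho_compl I (kernel_of I P)"
  proof (intro equalityI subsetI)
    fix \<phi> assume "\<phi> \<in> image_of I P"
    then have \<phi>: "\<phi> \<in> vecs I" "mv I P \<phi> = \<phi>" by (auto simp: image_of_projector[OF assms(2)])
    have "cinner_on I \<psi> \<phi> = 0" if "\<psi> \<in> kernel_of I P" for \<psi>
    proof -
      have "cinner_on I \<psi> \<phi> = cinner_on I (mv I P \<psi>) \<phi>"
        using cinner_on_mv[of I \<psi> I P \<phi>] by (simp add: \<phi>(2) P(2))
      then show ?thesis using that by (simp add: kernel_of_def cinner_on_def)
    qed
    then show "\<phi> \<in> ortho_compl I (kernel_of I P)" using \<phi>(1) by (simp add: ortho_compl_def)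
  next
    fix \<phi> assume \<phi>: "\<phi> \<in> ortho_compl I (kernel_of I P)"
    \<comment> \<open>This defect lies in the kernel of \<open>P\<close>, hence is orthogonal to
      \<open>\<phi>\<close>; it is also orthogonal to \<open>P \<phi>\<close>, therefore to
      itself.\<close>
    define \<psi> where "\<psi> = (\<lambda>i. \<phi> i - mv I P \<phi> i)"
    have v: "\<phi> \<in> vecs I" "mv I P \<phi> \<in> vecs I" using \<phi> P(1) by (auto simp: ortho_compl_def intro: mv_vecs)
    have v': "\<psi> \<in> vecs I" using v by (auto simp: \<psi>_def vecs_def)
    have "mv I P \<psi> = (\<lambda>i. mv I P \<phi> i - mv I P (mv I P \<phi>) i)"
      by (simp add: mv_def \<psi>_def right_diff_distrib sum_subtractf)
    then have P\<psi>: "mv I P \<psi> = (\<lambda>_. 0)" by (simp add: mv_mv P(3))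
    then have "cinner_on I \<psi> \<phi> = 0" using \<phi> v' by (simp add: ortho_compl_def kernel_of_def)
    moreover have "cinner_on I \<psi> (mv I P \<phi>) = 0"
      unfolding cinner_on_mv P(2) P\<psi> by (simp add: cinner_on_def)
    ultimately have "cinner_on I \<psi> \<psi> = 0"
      using cinner_on_diff_right[of I \<psi> \<phi> "mv I P \<phi>"] by (simp add: \<psi>_def)
    then have "\<psi> = (\<lambda>_. 0)"
      using vnorm_eq_0[OF assms(1) v'] by (simp add: cinner_on_self del: of_real_power)
    then have "mv I P \<phi> = \<phi>" by (auto simp: \<psi>_def fun_eq_iff)
    then show "\<phi> \<in> image_of I P" using v(1) by (simp add: image_of_projector[OF assms(2)])
  qed
  then show ?thesis
    unfolding supp_proj_def ker by (intro orth_proj_eqI[OF assms(1,2)])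
qed

text \<open>The range projector comes with a factor \<open>W\<close> such that
  \<open>P = M W\<close>, and the inverse on the support is built from it as
  \<open>adj W M W\<close>.\<close>

lemma supp_inv_hermitian:
  assumes "finite I" "M \<in> ops I I" "adj M = M"
  defines "P \<equiv> supp_proj I M" and "X \<equiv> supp_inv I M"
  shows "is_projector I P" "mm I P M = M" "mm I M P = M"
    and "X \<in> ops I I" "adj X = X" "mm I M X = P" "mm I X M = P" "mm I P X = X" "mm I X P = X"
    and "\<exists>W. P = mm I M W"
proof -
  obtain P' W where W: "is_projector I P'" "mm I P' M = M" "W \<in> ops I I" "P' = mm I M W"
    using range_projector_exists[OF assms(1,1,2)] by blast
  have PP': "P = P'" unfolding P_def by (rule supp_proj_eqI[OF assms(1) W(1) assms(3) W(2,4)])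
  then show P: "is_projector I P" and PM: "mm I P M = M" and exW: "\<exists>W. P = mm I M W"
    using W by auto
  have Pops: "P \<in> ops I I" and adjP: "adj P = P" and PP: "mm I P P = P"
    using P by (auto simp: is_projector_def)
  show MP: "mm I M P = M" using arg_cong[OF PM, of adj] by (simp add: adj_mm assms(3) adjP)
  have PW: "P = mm I M W" using W(4) PP' by simp
  then have PW': "P = mm I (adj W) M" using adjP assms(3) by (metis adj_mm)
  \<comment> \<open>From \<open>P = M W = adj W M\<close> this equals both \<open>P W\<close> and
    \<open>adj W P\<close>: the first form shows that it is a right inverse, the second a left
    inverse, and the symmetric form is self-adjoint.\<close>
  define Y where "Y = mm I (adj W) (mm I M W)"
  have Y: "Y \<in> ops I I" "mm I M Y = P" "mm I Y M = P" "mm I P Y = Y"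
  proof -
    show "Y \<in> ops I I" unfolding Y_def using W(3) assms(2) by blast
    have Y1: "Y = mm I P W" unfolding Y_def by (simp only: mm_assoc[symmetric] PW'[symmetric])
    have Y2: "Y = mm I (adj W) P" unfolding Y_def PW[symmetric] ..
    show "mm I M Y = P" unfolding Y1 mm_assoc[symmetric] MP PW[symmetric] ..
    show "mm I Y M = P" unfolding Y2 mm_assoc PM PW'[symmetric] ..
    show "mm I P Y = Y" unfolding Y1 mm_assoc[symmetric] PP ..
  qed
  have "X = Y"
    unfolding X_def supp_inv_def P_def[symmetric]
  proof (rule the_equality)
    show "Y \<in> ops I I \<and> mm I M Y = P \<and> mm I Y M = P \<and> mm I P Y = Y" using Y by blast
    \<comment> \<open>Uniqueness is the chain
      \<open>Z = P Z = Y M Z = Y P = Y M Y = P Y = Y\<close>.\<close>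
    fix Z assume Z: "Z \<in> ops I I \<and> mm I M Z = P \<and> mm I Z M = P \<and> mm I P Z = Z"
    then have "Z = mm I (mm I Y M) Z" using Y(3) by simp
    also have "\<dots> = mm I Y (mm I M Y)" using Z Y(2) by (simp add: mm_assoc)
    also have "\<dots> = mm I P Y" by (simp only: mm_assoc[symmetric] Y(3))
    finally show "Z = Y" using Y(4) by simp
  qed
  then show "X \<in> ops I I" "mm I M X = P" "mm I X M = P" "mm I P X = X" using Y by auto
  show "adj X = X" unfolding \<open>X = Y\<close> Y_def by (simp add: adj_mm assms(3) mm_assoc)
  then show "mm I X P = X" using arg_cong[OF \<open>mm I P X = X\<close>, of adj] by (simp add: adj_mm adjP)
qed

section \<open>Square roots of Gram operators\<close>

lemma mv_add_right: "mv J M (\<lambda>j. \<phi> j + \<psi> j) = (\<lambda>i. mv J M \<phi> i + mv J M \<psi> i)"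
  by (simp add: mv_def distrib_left sum.distrib)

lemma mv_smult: "mv J (\<lambda>i j. a * M i j) \<psi> = (\<lambda>i. a * mv J M \<psi> i)"
  by (simp add: mv_def sum_distrib_left mult_ac)

lemma opbound_smult: "opbound I J M c \<Longrightarrow> opbound I J (\<lambda>i j. a * M i j) (cmod a * c)"
  by (simp add: opbound_def mv_smult vnorm_scale mult_left_mono mult.assoc)

lemma opbound_add:
  assumes "opbound I J M c" "opbound I J N d"
  shows "opbound I J (\<lambda>i j. M i j + N i j) (c + d)"
proof -
  have "opbound I J (\<lambda>i j. - 1 * N i j) (cmod (- 1) * d)" by (rule opbound_smult[OF assms(2)])
  then have "opbound I J (mdiff M (\<lambda>i j. - N i j)) (c + d)" using opbound_mdiff[OF assms(1)] by simp
  then show ?thesis by (simp add: mdiff_def)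
qed

lemma cinner_on_cong: "(\<And>i. i \<in> I \<Longrightarrow> \<phi> i = \<phi>' i) \<Longrightarrow> (\<And>i. i \<in> I \<Longrightarrow> \<psi> i = \<psi>' i)
    \<Longrightarrow> cinner_on I \<phi> \<psi> = cinner_on I \<phi>' \<psi>'"
  by (simp add: cinner_on_def)

text \<open>Expanding the square gives the squared norm of \<open>\<psi>\<close>, minus twice that
  of \<open>V \<psi>\<close>, plus that of \<open>?g\<close>. The last term is at most the squared
  norm of \<open>V \<psi>\<close> because \<open>adj V\<close> is a contraction as well.\<close>

lemma opbound_idm_minus_gram:
  assumes "finite N" "opbound I N V 1"
  shows "opbound N N (mdiff (idm N) (mm I (adj V) V)) 1"
  unfolding opbound_def
proof
  fix \<psi>
  let ?G = "mm I (adj V) V"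
  let ?\<phi> = "mv N (mdiff (idm N) ?G) \<psi>"
  let ?g = "mv N ?G \<psi>"
  have G: "?g = mv I (adj V) (mv N V \<psi>)" by (simp add: mv_mv)
  have 1: "cinner_on N \<psi> ?g = of_real ((vnorm I (mv N V \<psi>))\<^sup>2)"
    unfolding G by (simp add: cinner_on_mv cinner_on_self)
  have 2: "cinner_on N ?g \<psi> = of_real ((vnorm I (mv N V \<psi>))\<^sup>2)"
    using 1 cinner_on_commute[of N \<psi> ?g] by simp
  \<comment> \<open>\<open>\<psi>\<close> may be nonzero off \<open>N\<close>, where
    \<open>idm N\<close> cuts it; the inner product does not see the difference.\<close>
  have "cinner_on N ?\<phi> ?\<phi> = cinner_on N (\<lambda>i. \<psi> i - ?g i) (\<lambda>i. \<psi> i - ?g i)"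
    by (rule cinner_on_cong) (simp_all add: mv_mdiff mv_idm assms(1))
  also have "\<dots> = of_real ((vnorm N \<psi>)\<^sup>2 - 2 * (vnorm I (mv N V \<psi>))\<^sup>2 + (vnorm N ?g)\<^sup>2)"
    unfolding cinner_on_diff_left cinner_on_diff_right 1 2 cinner_on_self by simp
  finally have "(vnorm N ?\<phi>)\<^sup>2 = (vnorm N \<psi>)\<^sup>2 - 2 * (vnorm I (mv N V \<psi>))\<^sup>2 + (vnorm N ?g)\<^sup>2"
    unfolding cinner_on_self of_real_eq_iff .
  moreover have "(vnorm N ?g)\<^sup>2 \<le> (vnorm I (mv N V \<psi>))\<^sup>2"
    using opbound_adj[OF assms(2)] unfolding G opbound_def by (intro power_mono) auto
  ultimately have "(vnorm N ?\<phi>)\<^sup>2 \<le> (vnorm N \<psi>)\<^sup>2"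
    using zero_le_power2[of "vnorm I (mv N V \<psi>)"] by linarith
  then show "vnorm N ?\<phi> \<le> 1 * vnorm N \<psi>"
    using power2_le_imp_le by (simp add: L2_set_nonneg)
qed

text \<open>The iteration \<open>Y \<mapsto> (X + Y\<^sup>2) / 2\<close> from \<open>0\<close> converges to \<open>1 - (1 - X)\<^bsup>1/2\<^esup>\<close>; its increments are
  majorized by those of the scalar iteration \<open>y \<mapsto> (1 + y\<^sup>2) / 2\<close>, which increases and stays
  below \<open>1\<close>.\<close>

lemma sqrt_iteration_limit:
  assumes fin: "finite N" and X: "X \<in> ops N N" "adj X = X" "opbound N N X 1"
  shows "\<exists>L \<in> ops N N. adj L = L \<and> opbound N N L 1 \<and> (\<forall>i j. 2 * L i j = X i j + mm N L L i j)
    \<and> (\<forall>R. mm N R X = mm N X R \<longrightarrow> mm N R L = mm N L R)"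
proof -
  define F where "F Y = (\<lambda>i j. 1 / 2 * (X i j + mm N Y Y i j))" for Y
  define Y where "Y k = (F ^^ k) (\<lambda>_ _. 0)" for k
  define y :: "nat \<Rightarrow> real" where "y k = ((\<lambda>t. 1 / 2 * (1 + t * t)) ^^ k) 0" for k
  have Y0: "Y 0 = (\<lambda>_ _. 0)" and YS: "Y (Suc k) = F (Y k)" for k by (simp_all add: Y_def)
  have y0: "y 0 = 0" and yS: "y (Suc k) = 1 / 2 * (1 + y k * y k)" for k by (simp_all add: y_def)
  have y01: "0 \<le> y k \<and> y k \<le> 1" for k
  proof (induction k)
    case (Suc k)
    then have "y k * y k \<le> 1 * 1" by (intro mult_mono) auto
    then show ?case by (simp add: yS)
  qed (simp add: y0)
  \<comment> \<open>The increment is half the square of \<open>1 - y k\<close>.\<close>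
  have ymono: "y k \<le> y (Suc k)" for k
    using zero_le_power2[of "1 - y k"] by (simp add: yS power2_eq_square algebra_simps)
  have Yops: "Y k \<in> ops N N" for k
    by (induction k) (use X(1) in \<open>auto simp: Y0 YS F_def ops_def mm_def\<close>)
  have Yadj: "adj (Y k) = Y k" for k
  proof (induction k)
    case (Suc k)
    have "cnj (X j i) = X i j" "cnj (mm N (Y k) (Y k) j i) = mm N (Y k) (Y k) i j" for i j
      using X(2) adj_mm[of N "Y k" "Y k"] unfolding Suc by (metis adj_def)+
    then show ?case by (simp add: YS F_def adj_def)
  qed (simp add: Y0 adj_def)
  have Ybound: "opbound N N (Y k) (y k)" for k
  proof (induction k)
    case 0
    show ?case by (simp add: Y0 y0 opbound_def mv_def L2_set_def)
  next
    case (Suc k)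
    have "opbound N N (\<lambda>i j. 1 / 2 * (X i j + mm N (Y k) (Y k) i j)) (cmod (1 / 2) * (1 + y k * y k))"
      by (intro opbound_smult opbound_add X(3) opbound_mm Suc) (use y01 in auto)
    then show ?case by (simp add: YS F_def yS)
  qed
  have Ydiff: "opbound N N (mdiff (Y (Suc k)) (Y k)) (y (Suc k) - y k)" for k
  proof (induction k)
    case 0
    have "mdiff (Y (Suc 0)) (Y 0) = (\<lambda>i j. 1 / 2 * X i j)" by (simp add: YS Y0 F_def)
    then show ?case using opbound_smult[OF X(3), of "1 / 2"] by (simp add: yS y0)
  next
    case (Suc k)
    let ?D = "mdiff (Y (Suc k)) (Y k)" and ?d = "y (Suc k) - y k"
    \<comment> \<open>A difference of squares splits as \<open>Y (Suc k) ?D + ?D Y k\<close> without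
      commuting anything.\<close>
    have "mdiff (Y (Suc (Suc k))) (Y (Suc k))
        = (\<lambda>i j. 1 / 2 * (mm N (Y (Suc k)) ?D i j + mm N ?D (Y k) i j))"
      unfolding mm_mdiff_left mm_mdiff_right
      by (simp add: YS[of "Suc k"] YS[of k] F_def[of "Y (Suc k)"] F_def[of "Y k"] mdiff_def algebra_simps)
        (simp add: YS F_def algebra_simps)
    moreover have "opbound N N (\<lambda>i j. 1 / 2 * (mm N (Y (Suc k)) ?D i j + mm N ?D (Y k) i j))
        (cmod (1 / 2) * (y (Suc k) * ?d + ?d * y k))"
      by (intro opbound_smult opbound_add opbound_mm Suc Ybound)
        (use y01 ymono in auto)
    moreover have "cmod (1 / 2) * (y (Suc k) * ?d + ?d * y k) = y (Suc (Suc k)) - y (Suc k)"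
      by (simp add: yS[of "Suc k"] yS[of k] algebra_simps)
    ultimately show ?case by (simp only:)
  qed
  have conv: "convergent (\<lambda>k. Y k i j)" for i j
  proof (cases "i \<in> N \<and> j \<in> N")
    case True
    have bound: "cmod (Y (Suc k) i j - Y k i j) \<le> y (Suc k) - y k" for k
      using opbound_entry[OF Ydiff fin fin] True by (simp add: mdiff_def)
    have "convergent y"
    proof (rule Bseq_monoseq_convergent)
      show "Bseq y" using y01 by (intro BseqI'[of _ 1]) simp
      show "monoseq y" using ymono by (auto simp: monoseq_Suc)
    qed
    \<comment> \<open>The majorant telescopes along the convergent \<open>y\<close>; comparison
      makes the increments of each entry summable.\<close>
    then have "summable (\<lambda>k. y (Suc k) - y k)"
      unfolding convergent_def using telescope_summable by blast
    then have "summable (\<lambda>k. Y (Suc k) i j - Y k i j)"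
      by (rule summable_comparison_test'[where N = 0]) (rule bound)
    then have "convergent (\<lambda>n. \<Sum>k<n. Y (Suc k) i j - Y k i j)" by (simp add: summable_iff_convergent)
    then show ?thesis by (simp add: sum_lessThan_telescope[of "\<lambda>k. Y k i j"] Y0)
  next
    case False
    then have "Y k i j = 0" for k using Yops[of k] by (auto simp: ops_def)
    then show ?thesis by (simp add: convergent_const)
  qed
  define L where "L i j = lim (\<lambda>k. Y k i j)" for i j
  have lim: "(\<lambda>k. Y k i j) \<longlonglongrightarrow> L i j" for i j
    using conv by (simp add: L_def convergent_LIMSEQ_iff)
  have lim_mm_right: "(\<lambda>k. mm N R (Y k) i j) \<longlonglongrightarrow> mm N R L i j" for R i j
    unfolding mm_def by (intro tendsto_intros lim)
  have lim_mm_left: "(\<lambda>k. mm N (Y k) R i j) \<longlonglongrightarrow> mm N L R i j" for R i j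
    unfolding mm_def by (intro tendsto_intros lim)
  show ?thesis
  proof (intro bexI[of _ L] conjI allI impI)
    have "L i j = 0" if "i \<notin> N \<or> j \<notin> N" for i j
    proof -
      have "Y k i j = 0" for k using Yops[of k] that by (auto simp: ops_def)
      then show ?thesis by (simp add: L_def lim_const)
    qed
    then show "L \<in> ops N N" by (auto simp: ops_def)
    have "cnj (L j i) = L i j" for i j
    proof (rule LIMSEQ_unique[OF _ lim])
      have "cnj (Y k j i) = Y k i j" for k using Yadj[of k] by (metis adj_def)
      then show "(\<lambda>k. Y k i j) \<longlonglongrightarrow> cnj (L j i)" using tendsto_cnj[OF lim, of j i] by simp
    qed
    then show "adj L = L" by (simp add: adj_def)
    show "opbound N N L 1"
      unfolding opbound_def
    proof
      fix \<psi>
      have "(\<lambda>k. vnorm N (mv N (Y k) \<psi>)) \<longlonglongrightarrow> vnorm N (mv N L \<psi>)"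
        unfolding L2_set_def mv_def by (intro tendsto_intros lim)
      moreover have "vnorm N (mv N (Y k) \<psi>) \<le> 1 * vnorm N \<psi>" for k
        using opbound_mono[OF Ybound, of k 1] y01 unfolding opbound_def by blast
      ultimately show "vnorm N (mv N L \<psi>) \<le> 1 * vnorm N \<psi>"
        by (intro LIMSEQ_le_const2) auto
    qed
    show "2 * L i j = X i j + mm N L L i j" for i j
    proof -
      have "(\<lambda>k. 1 / 2 * (X i j + mm N (Y k) (Y k) i j)) \<longlonglongrightarrow> 1 / 2 * (X i j + mm N L L i j)"
        unfolding mm_def by (intro tendsto_intros lim)
      then have "(\<lambda>k. Y (Suc k) i j) \<longlonglongrightarrow> 1 / 2 * (X i j + mm N L L i j)"
        unfolding YS F_def .
      moreover have "(\<lambda>k. Y (Suc k) i j) \<longlonglongrightarrow> L i j" using lim by (rule LIMSEQ_Suc)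
      ultimately have "L i j = 1 / 2 * (X i j + mm N L L i j)" using LIMSEQ_unique by blast
      then show ?thesis by (simp add: mult.commute)
    qed
    \<comment> \<open>Every iterate is a polynomial in \<open>X\<close>, so whatever commutes with
      \<open>X\<close> commutes with the iterates and their limit. Uniqueness of the square root
      rests on this.\<close>
    show "mm N R L = mm N L R" if RX: "mm N R X = mm N X R" for R
    proof -
      have comm: "mm N R (Y k) = mm N (Y k) R" for k
      proof (induction k)
        case (Suc k)
        have "mm N R (mm N (Y k) (Y k)) = mm N (mm N (Y k) (Y k)) R"
          by (simp add: mm_assoc[symmetric] Suc) (simp add: mm_assoc Suc)
        moreover have "mm N R (F (Y k)) = (\<lambda>i j. 1 / 2 * (mm N R X i j + mm N R (mm N (Y k) (Y k)) i j))"
          unfolding F_def mm_def[of N R]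
          by (simp add: distrib_left sum.distrib sum_divide_distrib add_divide_distrib)
        moreover have "mm N (F (Y k)) R = (\<lambda>i j. 1 / 2 * (mm N X R i j + mm N (mm N (Y k) (Y k)) R i j))"
          unfolding F_def mm_def[of N _ R]
          by (simp add: distrib_left distrib_right sum.distrib sum_divide_distrib add_divide_distrib)
        ultimately show ?case by (simp add: YS RX)
      qed (simp add: Y0)
      show ?thesis
      proof (intro ext)
        fix i j
        show "mm N R L i j = mm N L R i j"
          using lim_mm_right[of R i j] lim_mm_left[of R i j] unfolding comm by (rule LIMSEQ_unique)
      qed
    qed
  qed
qed

text \<open>Once \<open>V\<close> is rescaled to a contraction, the iteration for
  \<open>X = 1 - adj V' V'\<close> yields \<open>L\<close> with \<open>1 - L\<close> squaring to
  \<open>1 - X\<close>. The root is \<open>c (1 - L)\<close>, positive because \<open>L\<close> is a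
  contraction, and it inherits the commutation clause from \<open>L\<close>.\<close>

lemma positive_sqrt_exists:
  assumes fin: "finite I" "finite N" and V: "V \<in> ops I N"
  shows "\<exists>R. positive_op N R \<and> mm N R R = mm I (adj V) V
    \<and> (\<forall>S \<in> ops N N. mm N S (mm I (adj V) V) = mm N (mm I (adj V) V) S \<longrightarrow> mm N S R = mm N R S)"
proof -
  obtain c0 where c0: "0 \<le> c0" "opbound I N V c0" using opbound_exists[OF fin] by blast
  \<comment> \<open>Adding one makes the bound strictly positive, as the division by
    \<open>c\<close> requires.\<close>
  define c where "c = c0 + 1"
  have c: "0 < c" "opbound I N V c" using c0(1) opbound_mono[OF c0(2)] by (simp_all add: c_def)
  define G where "G = mm I (adj V) V"
  define V' where "V' = (\<lambda>i j. of_real (1 / c) * V i j)"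
  have V'1: "opbound I N V' 1"
    using opbound_smult[OF c(2), of "of_real (1 / c)"] c(1) unfolding V'_def by (simp add: norm_divide)
  define X where "X = mdiff (idm N) (mm I (adj V') V')"
  have G': "mm I (adj V') V' = (\<lambda>i j. of_real (1 / c\<^sup>2) * G i j)"
    by (simp add: mm_def V'_def G_def adj_def sum_distrib_left power2_eq_square mult_ac)
  have Xeq: "X i j = idm N i j - of_real (1 / c\<^sup>2) * G i j" for i j
    by (simp add: X_def G' mdiff_def)
  have V'ops: "V' \<in> ops I N" using V by (auto simp: V'_def ops_def)
  have "X \<in> ops N N" unfolding X_def using V'ops by blast
  moreover have "adj X = X" by (simp add: X_def adj_mdiff adj_mm)
  moreover have "opbound N N X 1" unfolding X_def by (rule opbound_idm_minus_gram[OF fin(2) V'1])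
  ultimately obtain L where L: "L \<in> ops N N" "adj L = L" "opbound N N L 1"
      "\<And>i j. 2 * L i j = X i j + mm N L L i j"
      "\<And>R. mm N R X = mm N X R \<Longrightarrow> mm N R L = mm N L R"
    using sqrt_iteration_limit[OF fin(2)] by metis
  define E where "E = mdiff (idm N) L"
  define R where "R = (\<lambda>i j. of_real c * E i j)"
  have E: "E \<in> ops N N" "adj E = E" using L(1,2) by (auto simp: E_def adj_mdiff)
  \<comment> \<open>\<open>E\<close> squares to \<open>1 - 2 L + L L\<close>, and
    \<open>2 L = X + L L\<close>.\<close>
  have EE: "mm N E E i j = idm N i j - X i j" for i j
    using L(1) L(4)[of i j] fin(2)
    by (simp add: E_def mm_mdiff_left mm_mdiff_right mm_idm_left mm_idm_right mm_idm_left[OF _ ops_idm])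
      (simp add: mdiff_def algebra_simps)
  show ?thesis
  proof (intro exI[of _ R] conjI ballI impI)
    show "positive_op N R"
      unfolding positive_op_def
    proof (intro conjI ballI)
      show "R \<in> ops N N" using E(1) by (auto simp: R_def ops_def)
      have "cnj (E j i) = E i j" for i j using E(2) by (metis adj_def)
      then show "adj R = R" by (simp add: R_def adj_def)
      fix \<psi>
      have "Re (cinner_on N \<psi> (mv N L \<psi>)) \<le> vnorm N \<psi> * vnorm N (mv N L \<psi>)"
        by (rule order_trans[OF complex_Re_le_cmod Cauchy_Schwarz_cinner_on])
      also have "\<dots> \<le> vnorm N \<psi> * (1 * vnorm N \<psi>)"
        using L(3) unfolding opbound_def by (intro mult_left_mono) (auto simp: L2_set_nonneg)
      finally have *: "Re (cinner_on N \<psi> (mv N L \<psi>)) \<le> (vnorm N \<psi>)\<^sup>2" by (simp add: power2_eq_square)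
      have "cinner_on N \<psi> (mv N R \<psi>) = cinner_on N \<psi> (\<lambda>i. of_real c * (\<psi> i - mv N L \<psi> i))"
        by (rule cinner_on_cong) (simp_all add: R_def E_def mv_smult mv_mdiff mv_idm fin(2))
      also have "\<dots> = of_real c * cinner_on N \<psi> (\<lambda>i. \<psi> i - mv N L \<psi> i)"
        by (simp add: cinner_on_def sum_distrib_left mult_ac)
      also have "\<dots> = of_real c * (of_real ((vnorm N \<psi>)\<^sup>2) - cinner_on N \<psi> (mv N L \<psi>))"
        by (simp only: cinner_on_diff_right cinner_on_self)
      finally have "Re (cinner_on N \<psi> (mv N R \<psi>)) = c * ((vnorm N \<psi>)\<^sup>2 - Re (cinner_on N \<psi> (mv N L \<psi>)))"
        by (simp only: Re_complex_of_real minus_complex.simps times_complex.simps Im_complex_of_real)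
      then show "0 \<le> Re (cinner_on N \<psi> (mv N R \<psi>))" using * c(1) by simp
    qed
    have "mm N R R i j = G i j" for i j
    proof -
      have "mm N R R i j = of_real (c\<^sup>2) * mm N E E i j"
        by (simp add: mm_def R_def sum_distrib_left power2_eq_square mult_ac)
      then show ?thesis using c(1) by (simp add: EE Xeq)
    qed
    then show "mm N R R = mm I (adj V) V" by (simp add: fun_eq_iff G_def)
    fix S assume S: "S \<in> ops N N" "mm N S (mm I (adj V) V) = mm N (mm I (adj V) V) S"
    have X': "X = mdiff (idm N) (\<lambda>i j. of_real (1 / c\<^sup>2) * G i j)" by (simp add: X_def G')
    have "mm N S (\<lambda>i j. of_real (1 / c\<^sup>2) * G i j) = (\<lambda>i j. of_real (1 / c\<^sup>2) * mm N S G i j)"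
      "mm N (\<lambda>i j. of_real (1 / c\<^sup>2) * G i j) S = (\<lambda>i j. of_real (1 / c\<^sup>2) * mm N G S i j)"
      by (simp_all add: mm_def sum_distrib_left mult_ac)
    then have "mm N S X = mm N X S"
      using S fin(2)
      by (simp add: X' mm_mdiff_left mm_mdiff_right mm_idm_left mm_idm_right G_def)
    then have "mm N S L = mm N L S" by (rule L(5))
    then have "mm N S E = mm N E S"
      using S(1) fin(2) by (simp add: E_def mm_mdiff_left mm_mdiff_right mm_idm_left mm_idm_right)
    moreover have "mm N S R = (\<lambda>i j. of_real c * mm N S E i j)" "mm N R S = (\<lambda>i j. of_real c * mm N E S i j)"
      by (simp_all add: mm_def R_def sum_distrib_left mult_ac)
    ultimately show "mm N S R = mm N R S" by simp
  qed
qed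

text \<open>Commuting roots of the same operator satisfy \<open>(R + S) (R - S) = 0\<close>. On the
  range of \<open>D = R - S\<close> the two nonnegative quadratic forms are therefore opposite and
  vanish, so the form of \<open>D\<close> vanishes on its own range.\<close>

lemma commuting_positive_sqrt_unique:
  assumes fin: "finite N" and R: "positive_op N R" and S: "positive_op N S"
    and eq: "mm N R R = mm N S S" and comm: "mm N R S = mm N S R"
  shows "R = S"
proof -
  define D where "D = mdiff R S"
  have ops: "R \<in> ops N N" "S \<in> ops N N" "D \<in> ops N N"
    and adj: "adj R = R" "adj S = S" "adj D = D"
    using R S by (auto simp: positive_op_def D_def adj_mdiff)
  have RD: "mv N R (mv N D \<psi>) = (\<lambda>i. - mv N S (mv N D \<psi>) i)" for \<psi>
    unfolding mv_mv by (simp add: D_def mm_mdiff_right mv_mdiff eq comm)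
  have zero: "Re (cinner_on N (mv N D \<psi>) (mv N D (mv N D \<psi>))) = 0" for \<psi>
  proof -
    let ?\<phi> = "mv N D \<psi>"
    have \<phi>: "?\<phi> \<in> vecs N" using ops(3) by (rule mv_vecs)
    have "cinner_on N ?\<phi> (mv N R ?\<phi>) = - cinner_on N ?\<phi> (mv N S ?\<phi>)"
      unfolding RD by (simp add: cinner_on_def sum_negf)
    moreover have "0 \<le> Re (cinner_on N ?\<phi> (mv N R ?\<phi>))" "0 \<le> Re (cinner_on N ?\<phi> (mv N S ?\<phi>))"
      using R S \<phi> by (auto simp: positive_op_def)
    moreover have "cinner_on N ?\<phi> (mv N D ?\<phi>) = cinner_on N ?\<phi> (mv N R ?\<phi>) - cinner_on N ?\<phi> (mv N S ?\<phi>)"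
      by (simp add: D_def mv_mdiff cinner_on_diff_right)
    ultimately show ?thesis by simp
  qed
  have add_left: "cinner_on N (\<lambda>i. \<alpha> i + \<beta> i) \<gamma> = cinner_on N \<alpha> \<gamma> + cinner_on N \<beta> \<gamma>" for \<alpha> \<beta> \<gamma>
    by (simp add: cinner_on_def distrib_right sum.distrib)
  have add_right: "cinner_on N \<gamma> (\<lambda>i. \<alpha> i + \<beta> i) = cinner_on N \<gamma> \<alpha> + cinner_on N \<gamma> \<beta>" for \<alpha> \<beta> \<gamma>
    by (simp add: cinner_on_def distrib_left sum.distrib)
  have "vnorm N (mv N D \<psi>) = 0" for \<psi>
  proof -
    let ?a = "mv N D \<psi>"
    let ?b = "mv N D ?a"
    let ?c = "mv N D ?b"
    \<comment> \<open>\<open>zero\<close> at \<open>\<psi> + D \<psi>\<close>: after the terms known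
      to vanish, twice the squared norm of \<open>?b\<close> remains. So \<open>D\<close> squared
      kills \<open>\<psi>\<close>, and then \<open>D\<close> does.\<close>
    have "Re (cinner_on N (\<lambda>i. ?a i + ?b i) (\<lambda>i. ?b i + ?c i)) = 0"
      using zero[of "\<lambda>i. \<psi> i + ?a i"] by (simp add: mv_add_right)
    moreover have "cinner_on N ?a ?c = cinner_on N ?b ?b"
      unfolding cinner_on_mv[of N ?a] adj(3) ..
    ultimately have "Re (cinner_on N ?b ?b) = 0"
      using zero[of \<psi>] zero[of ?a] by (simp add: add_left add_right)
    then have "vnorm N ?b = 0" by (simp add: cinner_on_self)
    moreover have "?b \<in> vecs N" using ops(3) by (rule mv_vecs)
    ultimately have "?b = (\<lambda>_. 0)" using vnorm_eq_0[OF fin] by blast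
    moreover have "cinner_on N ?a ?a = cinner_on N \<psi> ?b" by (simp add: cinner_on_mv adj(3))
    ultimately have "cinner_on N ?a ?a = 0" by (simp add: cinner_on_def)
    then show ?thesis by (simp add: cinner_on_self)
  qed
  then have "opbound N N D 0" by (simp add: opbound_def)
  then have "D i j = 0" for i j
    using opbound_entry[OF _ fin fin, of D 0 i j] ops(3)
    by (cases "i \<in> N \<and> j \<in> N") (auto simp: ops_def)
  then show ?thesis by (simp add: D_def mdiff_def fun_eq_iff)
qed

text \<open>Any positive root commutes with its own square, hence with the root constructed above.
  This reduces uniqueness to the commuting case and evaluates the description in
  \<open>opsqrt\<close>.\<close>

lemma opsqrt_gram:
  assumes fin: "finite I" "finite N" and V: "V \<in> ops I N"
  defines "r \<equiv> opsqrt N (mm I (adj V) V)"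
  shows "r \<in> ops N N" "adj r = r" "mm N r r = mm I (adj V) V"
proof -
  obtain R where R: "positive_op N R" "mm N R R = mm I (adj V) V"
    "\<And>S. S \<in> ops N N \<Longrightarrow> mm N S (mm I (adj V) V) = mm N (mm I (adj V) V) S \<Longrightarrow> mm N S R = mm N R S"
    using positive_sqrt_exists[OF assms(1-3)] by metis
  have "r = R"
    unfolding r_def opsqrt_def
  proof (rule the_equality)
    fix S assume S: "positive_op N S \<and> mm N S S = mm I (adj V) V"
    have "mm N S (mm N S S) = mm N (mm N S S) S" by (simp add: mm_assoc)
    then have "mm N S R = mm N R S" using S R(3) unfolding positive_op_def by (simp only: simp_thms)
    then show "S = R"
      using S R(2) by (intro commuting_positive_sqrt_unique[OF fin(2) _ R(1)]) simp_all
  qed (use R in blast)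
  then show "r \<in> ops N N" "adj r = r" "mm N r r = mm I (adj V) V"
    using R(1,2) unfolding positive_op_def by blast+
qed

text \<open>The squared norm of \<open>P \<psi>\<close> is the inner product of
  \<open>\<psi>\<close> and \<open>P \<psi>\<close>; Cauchy-Schwarz and cancellation finish.\<close>

lemma opbound_projector:
  assumes "is_projector I P"
  shows "opbound I I P 1"
  unfolding opbound_def
proof
  fix \<psi>
  have P: "adj P = P" "mm I P P = P" using assms by (auto simp: is_projector_def)
  have "(vnorm I (mv I P \<psi>))\<^sup>2 = cmod (cinner_on I (mv I P \<psi>) (mv I P \<psi>))"
    by (simp add: cinner_on_self norm_power del: of_real_power)
  also have "\<dots> = cmod (cinner_on I \<psi> (mv I P \<psi>))"
    using cinner_on_mv[of I \<psi> I P "mv I P \<psi>"] by (simp add: mv_mv P)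
  also have "\<dots> \<le> vnorm I \<psi> * vnorm I (mv I P \<psi>)" by (rule Cauchy_Schwarz_cinner_on)
  finally have *: "vnorm I (mv I P \<psi>) * vnorm I (mv I P \<psi>) \<le> vnorm I \<psi> * vnorm I (mv I P \<psi>)"
    by (simp add: power2_eq_square)
  show "vnorm I (mv I P \<psi>) \<le> 1 * vnorm I \<psi>"
  proof (cases "vnorm I (mv I P \<psi>) = 0")
    case False
    then have "0 < vnorm I (mv I P \<psi>)"
      using L2_set_nonneg[of "\<lambda>i. cmod (mv I P \<psi> i)" I] by linarith
    then show ?thesis using * by simp
  qed (simp add: L2_set_nonneg)
qed

section \<open>Approximate projectors\<close>

text \<open>Polar decomposition of \<open>V\<close>. The kernels of \<open>r\<close> and
  \<open>\<rho>\<close> coincide, so \<open>J\<close> is also the support projector of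
  \<open>r\<close>; then \<open>V q\<close> is a partial isometry with initial projector
  \<open>J\<close> and final projector \<open>P\<close>.\<close>

lemma gram_facts:
  assumes fin: "finite I" "finite N" and V: "V \<in> ops I N"
  defines "\<rho> \<equiv> mm I (adj V) V"
  defines "r \<equiv> opsqrt N \<rho>" and "J \<equiv> supp_proj N \<rho>"
  defines "q \<equiv> supp_inv N r" and "P \<equiv> orth_proj I (image_of N V)"
  shows "r \<in> ops N N" "adj r = r" "mm N r r = \<rho>" "is_projector N J" "mm N J r = r" "mm N r J = r"
    and "q \<in> ops N N" "adj q = q" "mm N r q = J" "mm N q r = J" "mm N J q = q" "mm N q J = q"
    and "mm N V J = V" "is_projector I P" "P = mm N (mm N V q) (adj (mm N V q))"
    and "opbound I N (mm N V q) 1"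
proof -
  note r = opsqrt_gram[OF fin V, folded \<rho>_def, folded r_def]
  show r1: "r \<in> ops N N" and r2: "adj r = r" and r3: "mm N r r = \<rho>" using r by auto
  have "mv N r \<psi> = (\<lambda>_. 0) \<longleftrightarrow> mv N \<rho> \<psi> = (\<lambda>_. 0)" for \<psi>
  proof
    assume "mv N \<rho> \<psi> = (\<lambda>_. 0)"
    then have "cinner_on N (mv N r \<psi>) (mv N r \<psi>) = 0"
      using cinner_on_mv[of N \<psi> N r "mv N r \<psi>"] by (simp add: mv_mv r2 r3 cinner_on_def)
    then show "mv N r \<psi> = (\<lambda>_. 0)"
      using vnorm_eq_0[OF fin(2) mv_vecs[OF r1]] by (simp add: cinner_on_self)
  next
    assume "mv N r \<psi> = (\<lambda>_. 0)"
    then show "mv N \<rho> \<psi> = (\<lambda>_. 0)" by (simp add: r3[symmetric] mv_mv[symmetric])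
  qed
  then have "kernel_of N r = kernel_of N \<rho>" by (simp add: kernel_of_def)
  then have J: "supp_proj N r = J" by (simp add: supp_proj_def J_def)
  note f = supp_inv_hermitian[OF fin(2) r1 r2, folded q_def, unfolded J]
  show Jp: "is_projector N J" and Jr: "mm N J r = r" and rJ: "mm N r J = r"
    and q1: "q \<in> ops N N" and q2: "adj q = q" and rq: "mm N r q = J" and qr: "mm N q r = J"
    and Jq: "mm N J q = q" and qJ: "mm N q J = q"
    using f by auto
  have J2: "J \<in> ops N N" "adj J = J" "mm N J J = J" using Jp by (auto simp: is_projector_def)
  \<comment> \<open>\<open>J\<close> is absorbed by \<open>\<rho>\<close> on both sides, so
    \<open>V - V J\<close> has Gram operator zero.\<close>
  have "\<rho> = mm N \<rho> J" "\<rho> = mm N J \<rho>"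
    using r3 Jr rJ by (metis mm_assoc)+
  then have "mm I (adj (mdiff V (mm N V J))) (mdiff V (mm N V J)) = (\<lambda>_ _. 0)"
    using r3 Jr rJ
    by (simp add: adj_mdiff adj_mm J2 mm_mdiff_left mm_mdiff_right mm_assoc[symmetric] \<rho>_def[symmetric])
      (simp add: mm_assoc \<rho>_def[symmetric] mdiff_def)
  then have "mdiff V (mm N V J) = (\<lambda>_ _. 0)"
    by (intro adj_mm_self_eq_0[OF fin(1) _ fin(2)]) (use V J2 in auto)
  then show VJ: "mm N V J = V" unfolding mdiff_self_iff by simp
  define U where "U = mm N V q"
  define P' where "P' = mm N U (adj U)"
  have UU: "mm I (adj U) U = J"
  proof -
    have "mm I (adj U) U = mm N q (mm N \<rho> q)"
      by (simp add: U_def adj_mm q2 mm_assoc \<rho>_def)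
    also have "\<dots> = mm N (mm N q r) (mm N r q)" by (simp add: r3[symmetric] mm_assoc)
    finally show ?thesis by (simp add: rq qr J2)
  qed
  have UJ: "mm N U J = U" by (simp add: U_def mm_assoc qJ)
  have "is_projector I P'"
    unfolding is_projector_def
  proof (intro conjI)
    show "P' \<in> ops I I" unfolding P'_def U_def using V q1 by blast
    show "adj P' = P'" by (simp add: P'_def adj_mm)
    have "mm I P' P' = mm N (mm N U (mm I (adj U) U)) (adj U)" by (simp add: P'_def mm_assoc)
    then show "mm I P' P' = P'" by (simp add: UU UJ P'_def)
  qed
  \<comment> \<open>\<open>P'\<close> factors through \<open>V\<close> on the left, and conversely
    \<open>P' V = V\<close>.\<close>
  moreover have "image_of I P' = image_of N V"
  proof (intro equalityI subsetI)
    fix \<phi> assume "\<phi> \<in> image_of I P'"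
    then obtain \<psi> where "\<phi> = mv I P' \<psi>" by (auto simp: image_of_def)
    then have "\<phi> = mv N V (mv I (mm N q (adj U)) \<psi>)" by (simp add: P'_def mv_mv U_def mm_assoc)
    moreover have "mm N q (adj U) \<in> ops N I" using q1 V by (auto simp: U_def)
    ultimately show "\<phi> \<in> image_of N V" unfolding image_of_def using mv_vecs by blast
  next
    fix \<phi> assume "\<phi> \<in> image_of N V"
    then obtain \<psi> where \<psi>: "\<phi> = mv N V \<psi>" by (auto simp: image_of_def)
    have "mm I P' V = mm N U (mm N q \<rho>)" by (simp add: P'_def U_def adj_mm q2 mm_assoc \<rho>_def)
    also have "\<dots> = mm N V (mm N q (mm N (mm N q r) r))" by (simp add: U_def r3[symmetric] mm_assoc)
    also have "\<dots> = V" by (simp add: qr Jr VJ)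
    finally have "\<phi> = mv I P' \<phi>" by (simp add: \<psi> mv_mv)
    moreover have "\<phi> \<in> vecs I" unfolding \<psi> using V by (rule mv_vecs)
    ultimately show "\<phi> \<in> image_of I P'" unfolding image_of_def by blast
  qed
  ultimately have "P = P'" "is_projector I P"
    unfolding P_def using orth_proj_eqI[OF fin(1)] by auto
  then show "P = mm N (mm N V q) (adj (mm N V q))" "is_projector I P"
    by (simp_all add: P'_def U_def)
  have "vnorm I (mv N U \<psi>) = vnorm N (mv N J \<psi>)" for \<psi>
    by (rule vnorm_mv_cong) (simp add: UU J2)
  then show "opbound I N (mm N V q) 1"
    using opbound_projector[OF Jp] by (simp add: opbound_def U_def)
qed

text \<open>Conjugation with the contraction \<open>V q\<close> turns \<open>r s r\<close> into
  \<open>V s (adj V)\<close> and \<open>J\<close> into the projector onto the image of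
  \<open>V\<close>.\<close>

lemma gram_approximate_projector:
  assumes fin: "finite I" "finite N" and V: "V \<in> ops I N"
  defines "\<rho> \<equiv> mm I (adj V) V"
  assumes bound: "opbound N N
      (mdiff (mm N (opsqrt N \<rho>) (mm N s (opsqrt N \<rho>))) (supp_proj N \<rho>)) \<epsilon>" "0 \<le> \<epsilon>"
  shows "opbound I I (mdiff (mm N V (mm N s (adj V))) (orth_proj I (image_of N V))) \<epsilon>"
proof -
  define r where "r = opsqrt N \<rho>"
  define J where "J = supp_proj N \<rho>"
  define q where "q = supp_inv N r"
  note f = gram_facts[OF fin V, folded \<rho>_def, folded r_def J_def, folded q_def]
  have Vqr: "mm N V (mm N q r) = V" by (simp add: f)
  have rqV: "mm N r (mm N q (adj V)) = adj V"
  proof -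
    have "adj (mm N V (mm N q r)) = mm N r (mm N q (adj V))"
      by (simp only: adj_mm mm_assoc f(2,8))
    then show ?thesis by (simp only: Vqr)
  qed
  let ?U = "mm N V q"
  have "mm N ?U (mm N (mm N r (mm N s r)) (adj ?U)) = mm N (mm N V (mm N q r)) (mm N s (mm N r (mm N q (adj V))))"
    by (simp only: mm_assoc adj_mm f(8))
  then have 1: "mm N ?U (mm N (mm N r (mm N s r)) (adj ?U)) = mm N V (mm N s (adj V))"
    by (simp add: Vqr rqV)
  have "mm N ?U (mm N J (adj ?U)) = mm N (mm N ?U J) (adj ?U)" by (simp only: mm_assoc)
  also have "mm N ?U J = ?U" by (simp only: mm_assoc f)
  also have "mm N ?U (adj ?U) = orth_proj I (image_of N V)" by (rule f(15)[symmetric])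
  finally have 2: "mm N ?U (mm N J (adj ?U)) = orth_proj I (image_of N V)" .
  have "mdiff (mm N V (mm N s (adj V))) (orth_proj I (image_of N V))
      = mm N ?U (mm N (mdiff (mm N r (mm N s r)) J) (adj ?U))"
    unfolding mm_mdiff_left mm_mdiff_right 1 2 ..
  moreover have "opbound I I (mm N ?U (mm N (mdiff (mm N r (mm N s r)) J) (adj ?U))) (1 * (\<epsilon> * 1))"
    using bound f(16) opbound_adj[OF f(16)] unfolding r_def J_def
    by (intro opbound_mm) simp_all
  ultimately show ?thesis by simp
qed

text \<open>The estimate stripped of the lattice. \<open>S\<close> indexes the sites of all three
  regions; \<open>K0\<close>, \<open>K1\<close>, \<open>K2\<close> index the boundaries of
  \<open>B\<close>, \<open>AB\<close>, \<open>BC\<close> together with the spectator sites.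
  \<open>\<sigma>\<close> belongs to \<open>B\<close>, and \<open>Q3\<close>, \<open>P3\<close> to
  the whole region.\<close>

lemma product_of_approximate_projectors:
  fixes s1 s2 :: "('k, 'k) kernel"
  assumes V12: "V1 = mm K0 V0 F1" "V2 = mm K0 V0 F2"
    and Q1: "Q1 = mm K1 V1 (mm K1 s1 (adj V1))" and Q2: "Q2 = mm K2 V2 (mm K2 s2 (adj V2))"
    and Q3: "Q3 = mm K1 V1 (mm K1 s1 (mm K0 (adj F1) (mm K0 \<sigma> (mm K2 F2 (mm K2 s2 (adj V2))))))"
    and r: "adj r = r" "mm K0 r r = mm S (adj V0) V0"
    and J: "adj J = J" "mm K0 J r = r" "mm K0 J J = J"
    and q: "mm K0 r q = J" "mm K0 q r = J"
    and J1: "mm K0 J (mm K1 F1 (mm K1 (adj s1) (adj V1))) = mm K1 F1 (mm K1 (adj s1) (adj V1))"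
    and J2: "mm K0 J (mm K2 F2 (mm K2 s2 (adj V2))) = mm K2 F2 (mm K2 s2 (adj V2))"
    and B: "opbound K0 K0 (mdiff (mm K0 q (mm K0 J (mm K0 \<sigma> (mm K0 J q)))) J) \<epsilon>"
    and QP: "opbound S S (mdiff Q1 P1) \<epsilon>" "opbound S S (mdiff Q2 P2) \<epsilon>" "opbound S S (mdiff Q3 P3) \<epsilon>"
    and P: "opbound S S P1 1" "opbound S S P2 1"
    and \<epsilon>: "0 \<le> \<epsilon>" "\<epsilon> \<le> 1"
  shows "opbound S S (mdiff (mm S P1 P2) P3) (8 * \<epsilon>)"
proof -
  define X1 where "X1 = mm K1 F1 (mm K1 (adj s1) (adj V1))"
  define X2 where "X2 = mm K2 F2 (mm K2 s2 (adj V2))"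
  have Q1': "opbound S S Q1 (1 + \<epsilon>)" and Q2': "opbound S S Q2 (1 + \<epsilon>)"
    using opbound_near[OF QP(1) P(1)] opbound_near[OF QP(2) P(2)] by (simp_all add: add.commute)
  have X1: "mm K0 V0 X1 = adj Q1"
    by (simp add: X1_def Q1 V12 adj_mm mm_assoc)
  have X2: "mm K0 V0 X2 = Q2"
    by (simp add: X2_def Q2 V12 mm_assoc)
  \<comment> \<open>\<open>r X\<close> and \<open>V0 X\<close> have the same Gram operator, so the
    bounds on the approximate projectors pass to \<open>r X1\<close> and
    \<open>r X2\<close>.\<close>
  have gram: "mm K0 (adj (mm K0 r X)) (mm K0 r X) = mm S (adj (mm K0 V0 X)) (mm K0 V0 X)" for X
  proof -
    have "mm K0 (adj (mm K0 r X)) (mm K0 r X) = mm K0 (adj X) (mm K0 (mm K0 r r) X)"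
      by (simp add: adj_mm r(1) mm_assoc)
    then show ?thesis by (simp add: adj_mm r(2) mm_assoc)
  qed
  have A: "opbound K0 S (mm K0 r X1) (1 + \<epsilon>)"
    using opbound_adj[OF Q1'] \<epsilon>(1) vnorm_mv_cong[OF gram[of X1]] unfolding X1 by (simp add: opbound_def)
  have B': "opbound K0 S (mm K0 r X2) (1 + \<epsilon>)"
    using Q2' vnorm_mv_cong[OF gram[of X2]] unfolding X2 by (simp add: opbound_def)
  have JX: "mm K0 J X1 = X1" "mm K0 J X2 = X2" using J1 J2 by (simp_all add: X1_def X2_def)
  have adjX1: "adj X1 = mm K1 V1 (mm K1 s1 (adj F1))" by (simp add: X1_def adj_mm mm_assoc)
  have rJ: "mm K0 r J = r" using arg_cong[OF J(2), of adj] by (simp add: adj_mm r(1) J(1))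
  \<comment> \<open>Inserting \<open>J\<close> on both sides of \<open>\<sigma>\<close> matters
    because the hypothesis \<open>B\<close> controls only the compression of \<open>\<sigma>\<close>
    by \<open>J\<close>.\<close>
  have "mm K0 (adj X1) (mm K0 (mm K0 J (mm K0 \<sigma> J)) X2) = mm K0 (adj (mm K0 J X1)) (mm K0 \<sigma> (mm K0 J X2))"
    by (simp add: adj_mm J(1) mm_assoc)
  then have Q3': "Q3 = mm K0 (adj X1) (mm K0 (mm K0 J (mm K0 \<sigma> J)) X2)"
    by (simp only: JX) (simp add: Q3 adjX1 X2_def mm_assoc)
  let ?E = "mdiff (mm K0 q (mm K0 J (mm K0 \<sigma> (mm K0 J q)))) J"
  \<comment> \<open>The outer factors \<open>r\<close> cancel \<open>q\<close> up to
    \<open>J\<close>, which recovers the compressed \<open>\<sigma>\<close> from the operator in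
    \<open>B\<close>.\<close>
  have "mm K0 r (mm K0 (mm K0 q (mm K0 J (mm K0 \<sigma> (mm K0 J q)))) r)
      = mm K0 (mm K0 r q) (mm K0 J (mm K0 \<sigma> (mm K0 J (mm K0 q r))))"
    by (simp add: mm_assoc)
  then have 1: "mm K0 r (mm K0 (mm K0 q (mm K0 J (mm K0 \<sigma> (mm K0 J q)))) r) = mm K0 J (mm K0 \<sigma> J)"
    by (simp add: q J(3) mm_assoc[symmetric])
  have 2: "mm K0 r (mm K0 J r) = mm S (adj V0) V0" by (simp add: J(2) r(2))
  have Q12: "mm S Q1 Q2 = mm K0 (adj X1) (mm K0 (mm S (adj V0) V0) X2)"
    using arg_cong[OF X1, of adj] by (simp add: adj_mm X2[symmetric] mm_assoc[symmetric])
  have "mdiff Q3 (mm S Q1 Q2) = mm K0 (adj X1) (mm K0 (mdiff (mm K0 J (mm K0 \<sigma> J)) (mm S (adj V0) V0)) X2)"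
    unfolding Q12 Q3' mm_mdiff_left mm_mdiff_right ..
  also have "mdiff (mm K0 J (mm K0 \<sigma> J)) (mm S (adj V0) V0) = mm K0 r (mm K0 ?E r)"
    unfolding mm_mdiff_left mm_mdiff_right 1 2 ..
  also have "mm K0 (adj X1) (mm K0 (mm K0 r (mm K0 ?E r)) X2) = mm K0 (adj (mm K0 r X1)) (mm K0 ?E (mm K0 r X2))"
    by (simp add: adj_mm r(1) mm_assoc)
  finally have D: "mdiff Q3 (mm S Q1 Q2) = mm K0 (adj (mm K0 r X1)) (mm K0 ?E (mm K0 r X2))" .
  have b1: "opbound S S (mdiff Q3 (mm S Q1 Q2)) ((1 + \<epsilon>) * (\<epsilon> * (1 + \<epsilon>)))"
    unfolding D using A B B' \<epsilon>(1) by (intro opbound_mm opbound_adj) simp_all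
  have b2: "opbound S S (mdiff (mm S Q1 Q2) (mm S Q1 P2)) ((1 + \<epsilon>) * \<epsilon>)"
    unfolding mm_mdiff_right[symmetric] using Q1' QP(2) \<epsilon>(1) by (intro opbound_mm) simp_all
  have b3: "opbound S S (mdiff (mm S Q1 P2) (mm S P1 P2)) (\<epsilon> * 1)"
    unfolding mm_mdiff_left[symmetric] using QP(1) P(2) \<epsilon>(1) by (intro opbound_mm) simp_all
  \<comment> \<open>The chain runs through \<open>P3\<close>, \<open>Q3\<close>,
    \<open>Q1 Q2\<close>, \<open>Q1 P2\<close>, \<open>P1 P2\<close>.\<close>
  have "opbound S S (mdiff P3 (mm S P1 P2)) (\<epsilon> + ((1 + \<epsilon>) * (\<epsilon> * (1 + \<epsilon>)) + ((1 + \<epsilon>) * \<epsilon> + \<epsilon> * 1)))"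
    by (intro opbound_triangle[OF opbound_mdiff_swap[OF QP(3)]] opbound_triangle[OF b1]
        opbound_triangle[OF b2] b3)
  moreover have "\<epsilon> + ((1 + \<epsilon>) * (\<epsilon> * (1 + \<epsilon>)) + ((1 + \<epsilon>) * \<epsilon> + \<epsilon> * 1)) \<le> 8 * \<epsilon>"
  proof -
    have e2: "\<epsilon> * \<epsilon> \<le> \<epsilon>" using mult_left_mono[OF \<epsilon>(2) \<epsilon>(1)] by simp
    have e3: "\<epsilon> * (\<epsilon> * \<epsilon>) \<le> \<epsilon>" using mult_left_mono[OF e2 \<epsilon>(1)] e2 by linarith
    \<comment> \<open>For \<open>\<epsilon> \<le> 1\<close> every power is at most
      \<open>\<epsilon>\<close>, and the coefficients 4, 3, 1 add up to 8.\<close>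
    have "\<epsilon> + ((1 + \<epsilon>) * (\<epsilon> * (1 + \<epsilon>)) + ((1 + \<epsilon>) * \<epsilon> + \<epsilon> * 1)) = 4 * \<epsilon> + 3 * (\<epsilon> * \<epsilon>) + \<epsilon> * (\<epsilon> * \<epsilon>)"
      by (simp add: algebra_simps)
    then show ?thesis using e2 e3 by linarith
  qed
  ultimately show ?thesis using opbound_mono opbound_mdiff_swap by blast
qed

section \<open>Operators tensored with the identity\<close>

text \<open>
  A triple \<open>(I, f, g)\<close> presents \<open>\<complex>\<^sup>I\<close> as a tensor product, \<open>f\<close> and \<open>g\<close> giving the two
  components of a basis index; \<open>tens\<close> tensors an operator on the first components with the identity
  on the second ones.
\<close>

definition factorizes :: "'i set \<times> ('i \<Rightarrow> 'j) \<times> ('i \<Rightarrow> 'c) \<Rightarrow> 'j set \<Rightarrow> 'c set \<Rightarrow> bool" where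
  "factorizes a J C \<longleftrightarrow> bij_betw (\<lambda>i. (fst (snd a) i, snd (snd a) i)) (fst a) (J \<times> C)"

definition tens :: "'i set \<times> ('i \<Rightarrow> 'j) \<times> ('i \<Rightarrow> 'c) \<Rightarrow> 'k set \<times> ('k \<Rightarrow> 'l) \<times> ('k \<Rightarrow> 'c)
    \<Rightarrow> ('j, 'l) kernel \<Rightarrow> ('i, 'k) kernel" where
  "tens a b M = (\<lambda>i k. if i \<in> fst a \<and> k \<in> fst b \<and> snd (snd a) i = snd (snd b) k
      then M (fst (snd a) i) (fst (snd b) k) else 0)"

lemma factorizesI:
  assumes "\<And>i. i \<in> I \<Longrightarrow> f i \<in> J \<and> g i \<in> C"
    and "\<And>j c. j \<in> J \<Longrightarrow> c \<in> C \<Longrightarrow> h j c \<in> I \<and> f (h j c) = j \<and> g (h j c) = c"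
    and "\<And>i. i \<in> I \<Longrightarrow> h (f i) (g i) = i"
  shows "factorizes (I, f, g) J C"
  unfolding factorizes_def
  by (rule bij_betwI[where g = "\<lambda>(j, c). h j c"]) (use assms in auto)

lemma adj_tens: "adj (tens a b M) = tens b a (adj M)"
  by (auto simp: adj_def tens_def fun_eq_iff)

lemma mdiff_tens: "mdiff (tens a b M) (tens a b N) = tens a b (mdiff M N)"
  by (auto simp: mdiff_def tens_def fun_eq_iff)

lemma ops_tens: "tens a b M \<in> ops (fst a) (fst b)"
  by (simp add: ops_def tens_def)

text \<open>The middle sum runs over \<open>J \<times> C\<close>; the identity on the second
  components leaves a single term of the sum over \<open>C\<close>. The hypothesis on
  \<open>a\<close> ensures that this term is present.\<close>

lemma tens_mm:
  assumes b: "factorizes b J C" and fin: "finite C" and a: "\<And>i. i \<in> fst a \<Longrightarrow> snd (snd a) i \<in> C"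
  shows "mm (fst b) (tens a b M) (tens b c N) = tens a c (mm J M N)"
proof (intro ext)
  fix i k
  let ?f = "fst (snd a)" and ?g = "snd (snd a)" and ?f' = "fst (snd c)" and ?g' = "snd (snd c)"
  define H where "H = (\<lambda>(j, x). if i \<in> fst a \<and> k \<in> fst c \<and> ?g i = x \<and> x = ?g' k then M (?f i) j * N j (?f' k) else 0)"
  have "mm (fst b) (tens a b M) (tens b c N) i k = (\<Sum>t\<in>fst b. H (fst (snd b) t, snd (snd b) t))"
    unfolding mm_def tens_def H_def by (intro sum.cong) auto
  also have "\<dots> = (\<Sum>p\<in>J \<times> C. H p)"
    using b unfolding factorizes_def by (rule sum.reindex_bij_betw)
  also have "\<dots> = (\<Sum>j\<in>J. \<Sum>x\<in>C. H (j, x))" by (simp add: sum.cartesian_product)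
  also have "\<dots> = (\<Sum>j\<in>J. if i \<in> fst a \<and> k \<in> fst c \<and> ?g i = ?g' k then M (?f i) j * N j (?f' k) else 0)"
  proof (rule sum.cong[OF refl])
    fix j
    have "(\<Sum>x\<in>C. H (j, x)) = (\<Sum>x\<in>C. if ?g i = x then H (j, ?g i) else 0)"
      by (intro sum.cong) (auto simp: H_def)
    also have "\<dots> = (if ?g i \<in> C then H (j, ?g i) else 0)" using fin by simp
    finally have "(\<Sum>x\<in>C. H (j, x)) = (if ?g i \<in> C then H (j, ?g i) else 0)" .
    then show "(\<Sum>x\<in>C. H (j, x)) = (if i \<in> fst a \<and> k \<in> fst c \<and> ?g i = ?g' k then M (?f i) j * N j (?f' k) else 0)"
      by (simp only:) (use a[of i] in \<open>auto simp: H_def\<close>)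
  qed
  also have "\<dots> = tens a c (mm J M N) i k" by (auto simp: tens_def mm_def)
  finally show "mm (fst b) (tens a b M) (tens b c N) i k = tens a c (mm J M N) i k" .
qed

text \<open>The squared norm is a sum over \<open>C\<close> of squared norms of slices, and the
  operator acts on each slice by \<open>M\<close>.\<close>

lemma opbound_tens:
  fixes b :: "'k set \<times> ('k \<Rightarrow> 'l) \<times> ('k \<Rightarrow> 'c)"
  assumes a: "factorizes a J C" and b: "factorizes b K C" and fin: "finite C"
    and M: "opbound J K M c" and c: "0 \<le> c"
  shows "opbound (fst a) (fst b) (tens a b M) c"
  unfolding opbound_def
proof
  fix \<psi> :: "'k \<Rightarrow> complex"
  \<comment> \<open>\<open>h\<close> reassembles an index from its two components;
    \<open>\<phi> x\<close> is the slice of \<open>\<psi>\<close> at second component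
    \<open>x\<close>.\<close>
  define h where "h = inv_into (fst b) (\<lambda>k. (fst (snd b) k, snd (snd b) k))"
  define \<phi> where "\<phi> x = (\<lambda>k. \<psi> (h (k, x)))" for x
  have inj: "inj_on (\<lambda>k. (fst (snd b) k, snd (snd b) k)) (fst b)"
    using b by (simp add: factorizes_def bij_betw_def)
  have h: "h (fst (snd b) t, snd (snd b) t) = t" if "t \<in> fst b" for t
    unfolding h_def by (rule inv_into_f_f[OF inj that])
  have aC: "snd (snd a) i \<in> C" if "i \<in> fst a" for i
    using a that unfolding factorizes_def bij_betw_def by auto
  have mv: "mv (fst b) (tens a b M) \<psi> i = mv K M (\<phi> (snd (snd a) i)) (fst (snd a) i)"
    if i: "i \<in> fst a" for i
  proof -
    define H where "H = (\<lambda>(k, x). if snd (snd a) i = x then M (fst (snd a) i) k * \<phi> x k else 0)"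
    have "mv (fst b) (tens a b M) \<psi> i = (\<Sum>t\<in>fst b. H (fst (snd b) t, snd (snd b) t))"
      unfolding mv_def tens_def H_def by (intro sum.cong) (auto simp: \<phi>_def h i)
    also have "\<dots> = (\<Sum>p\<in>K \<times> C. H p)"
      using b unfolding factorizes_def by (rule sum.reindex_bij_betw)
    also have "\<dots> = (\<Sum>k\<in>K. \<Sum>x\<in>C. H (k, x))" by (simp add: sum.cartesian_product)
    also have "\<dots> = mv K M (\<phi> (snd (snd a) i)) (fst (snd a) i)"
      using fin aC[OF i] by (simp add: H_def mv_def)
    finally show ?thesis .
  qed
  have "(vnorm (fst a) (mv (fst b) (tens a b M) \<psi>))\<^sup>2
      = (\<Sum>i\<in>fst a. (\<lambda>(j, x). (cmod (mv K M (\<phi> x) j))\<^sup>2) (fst (snd a) i, snd (snd a) i))"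
    by (simp add: L2_set_def sum_nonneg mv)
  also have "\<dots> = (\<Sum>p\<in>J \<times> C. (\<lambda>(j, x). (cmod (mv K M (\<phi> x) j))\<^sup>2) p)"
    using a unfolding factorizes_def by (rule sum.reindex_bij_betw)
  also have "\<dots> = (\<Sum>j\<in>J. \<Sum>x\<in>C. (cmod (mv K M (\<phi> x) j))\<^sup>2)" by (simp add: sum.cartesian_product)
  also have "\<dots> = (\<Sum>x\<in>C. (vnorm J (mv K M (\<phi> x)))\<^sup>2)"
    by (subst sum.swap) (simp add: L2_set_def sum_nonneg)
  also have "\<dots> \<le> (\<Sum>x\<in>C. (c * vnorm K (\<phi> x))\<^sup>2)"
    using M unfolding opbound_def by (intro sum_mono power_mono) (auto simp: L2_set_nonneg)
  also have "\<dots> = c\<^sup>2 * (\<Sum>k\<in>K. \<Sum>x\<in>C. (cmod (\<phi> x k))\<^sup>2)"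
    by (subst sum.swap) (simp add: L2_set_def sum_nonneg power_mult_distrib sum_distrib_left)
  also have "(\<Sum>k\<in>K. \<Sum>x\<in>C. (cmod (\<phi> x k))\<^sup>2) = (\<Sum>p\<in>K \<times> C. (\<lambda>(k, x). (cmod (\<phi> x k))\<^sup>2) p)"
    by (simp add: sum.cartesian_product)
  also have "\<dots> = (\<Sum>t\<in>fst b. (\<lambda>(k, x). (cmod (\<phi> x k))\<^sup>2) (fst (snd b) t, snd (snd b) t))"
    using b unfolding factorizes_def by (rule sum.reindex_bij_betw[symmetric])
  also have "\<dots> = (vnorm (fst b) \<psi>)\<^sup>2"
    by (simp add: L2_set_def sum_nonneg \<phi>_def h)
  finally have "(vnorm (fst a) (mv (fst b) (tens a b M) \<psi>))\<^sup>2 \<le> (c * vnorm (fst b) \<psi>)\<^sup>2"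
    by (simp add: power_mult_distrib)
  then show "vnorm (fst a) (mv (fst b) (tens a b M) \<psi>) \<le> c * vnorm (fst b) \<psi>"
    by (rule power2_le_imp_le) (use c in \<open>simp add: L2_set_nonneg\<close>)
qed

lemma tens_idm: "factorizes a J C \<Longrightarrow> tens a a (idm J) = idm (fst a)"
  unfolding factorizes_def bij_betw_def
  by (intro ext) (auto simp: tens_def idm_def inj_on_def)

section \<open>Configuration spaces as tensor products\<close>

lemma finite_cfg [intro, simp]: "finite S \<Longrightarrow> finite (cfg S)"
  by (simp add: cfg_def finite_PiE)

lemma restrict_cfg [simp]: "restrict f S \<in> cfg S"
  by (simp add: cfg_def)

lemma cfg_eqI: "f \<in> cfg S \<Longrightarrow> g \<in> cfg S \<Longrightarrow> (\<And>s. s \<in> S \<Longrightarrow> f s = g s) \<Longrightarrow> f = g"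
  unfolding cfg_def by (rule PiE_ext)

lemma restrict_eq_iff: "restrict f S = restrict g S \<longleftrightarrow> (\<forall>s\<in>S. f s = g s)"
  by (auto simp: restrict_def fun_eq_iff)

definition split_cfg :: "'s set \<Rightarrow> 's set \<Rightarrow> ('s \<Rightarrow> 'n::finite) set \<times> (('s \<Rightarrow> 'n) \<Rightarrow> 's \<Rightarrow> 'n) \<times> (('s \<Rightarrow> 'n) \<Rightarrow> 's \<Rightarrow> 'n)" where
  "split_cfg R C = (cfg (R \<union> C), \<lambda>s. restrict s R, \<lambda>s. restrict s C)"

lemma factorizes_split_cfg:
  assumes "R \<inter> C = {}"
  shows "factorizes (split_cfg R C) (cfg R) (cfg C)"
  unfolding split_cfg_def
proof (rule factorizesI[where h = "\<lambda>u w. \<lambda>s\<in>R \<union> C. if s \<in> R then u s else w s"])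
  fix u w :: "'a \<Rightarrow> 'b" assume "u \<in> cfg R" "w \<in> cfg C"
  then show "(\<lambda>s\<in>R \<union> C. if s \<in> R then u s else w s) \<in> cfg (R \<union> C) \<and>
      restrict (\<lambda>s\<in>R \<union> C. if s \<in> R then u s else w s) R = u \<and>
      restrict (\<lambda>s\<in>R \<union> C. if s \<in> R then u s else w s) C = w"
    using assms by (auto intro!: cfg_eqI)
next
  fix s :: "'a \<Rightarrow> 'b" assume "s \<in> cfg (R \<union> C)"
  then show "(\<lambda>x\<in>R \<union> C. if x \<in> R then restrict s R x else restrict s C x) = s"
    by (intro cfg_eqI[of _ "R \<union> C"]) auto
qed simp

text \<open>The spectator index comes first in the pair, as in \<open>id_tensor\<close>.\<close>

definition second_factor :: "'c set \<Rightarrow> 'j set \<Rightarrow> ('c \<times> 'j) set \<times> ('c \<times> 'j \<Rightarrow> 'j) \<times> ('c \<times> 'j \<Rightarrow> 'c)" where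
  "second_factor C J = (C \<times> J, snd, fst)"

lemma factorizes_second_factor: "factorizes (second_factor C J) J C"
  unfolding second_factor_def
  by (rule factorizesI[where h = "\<lambda>j c. (c, j)"]) auto

text \<open>Detaches the sites of \<open>C\<close> from the site part of a mixed index of sites and
  boundary edges.\<close>

definition split_fst :: "'s set \<Rightarrow> 's set \<Rightarrow> 'j set \<Rightarrow>
    (('s \<Rightarrow> 'n::finite) \<times> 'j) set \<times> (('s \<Rightarrow> 'n) \<times> 'j \<Rightarrow> ('s \<Rightarrow> 'n) \<times> 'j) \<times> (('s \<Rightarrow> 'n) \<times> 'j \<Rightarrow> 's \<Rightarrow> 'n)" where
  "split_fst A C J = (cfg (A \<union> C) \<times> J, \<lambda>(q, y). (restrict q A, y), \<lambda>(q, y). restrict q C)"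

lemma factorizes_split_fst:
  assumes "A \<inter> C = {}"
  shows "factorizes (split_fst A C J) (cfg A \<times> J) (cfg C)"
  unfolding split_fst_def
proof (rule factorizesI[where h = "\<lambda>(u, y) w. (\<lambda>s\<in>A \<union> C. if s \<in> A then u s else w s, y)"])
  fix u :: "('a \<Rightarrow> 'b) \<times> 'c" and w :: "'a \<Rightarrow> 'b" assume "u \<in> cfg A \<times> J" "w \<in> cfg C"
  then show "(case u of (u, y) \<Rightarrow> \<lambda>w. (\<lambda>s\<in>A \<union> C. if s \<in> A then u s else w s, y)) w \<in> cfg (A \<union> C) \<times> J \<and>
      (case (case u of (u, y) \<Rightarrow> \<lambda>w. (\<lambda>s\<in>A \<union> C. if s \<in> A then u s else w s, y)) w of
         (q, y) \<Rightarrow> (restrict q A, y)) = u \<and>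
      (case (case u of (u, y) \<Rightarrow> \<lambda>w. (\<lambda>s\<in>A \<union> C. if s \<in> A then u s else w s, y)) w of
         (q, y) \<Rightarrow> restrict q C) = w"
    using assms by (auto intro!: cfg_eqI)
next
  fix i :: "('a \<Rightarrow> 'b) \<times> 'c" assume "i \<in> cfg (A \<union> C) \<times> J"
  then show "(case (case i of (q, y) \<Rightarrow> (restrict q A, y)) of
      (u, y) \<Rightarrow> \<lambda>w. (\<lambda>s\<in>A \<union> C. if s \<in> A then u s else w s, y)) (case i of (q, y) \<Rightarrow> restrict q C) = i"
    by (auto intro!: cfg_eqI[of _ "A \<union> C"])
qed auto

text \<open>Makes \<open>ext\<close> an instance of \<open>tens\<close>, from which its product
  rule, unit and norm bound are inherited.\<close>

lemma ext_eq_tens: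
  assumes "S \<subseteq> R"
  shows "ext S R K = tens (split_cfg S (R - S)) (split_cfg S (R - S)) K"
  using assms by (auto simp: ext_def tens_def split_cfg_def restrict_eq_iff fun_eq_iff Un_absorb1)

lemma mm_ext:
  fixes K L :: "('s \<Rightarrow> 'n::finite, 's \<Rightarrow> 'n) kernel"
  assumes "S \<subseteq> R" "finite R"
  shows "mm (cfg R) (ext S R K) (ext S R L) = ext S R (mm (cfg S) K L)"
proof -
  have "fst (split_cfg S (R - S)) = (cfg R :: ('s \<Rightarrow> 'n) set)"
    using assms(1) by (simp add: split_cfg_def Un_absorb1)
  then show ?thesis
    using tens_mm[OF factorizes_split_cfg, of S "R - S" "split_cfg S (R - S)" K "split_cfg S (R - S)" L] assms
    by (simp add: ext_eq_tens) (simp add: split_cfg_def)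
qed

lemma ext_idm:
  assumes "S \<subseteq> R"
  shows "ext S R (idm (cfg S)) = idm (cfg R)"
  using tens_idm[OF factorizes_split_cfg, of S "R - S"] assms
  by (simp add: ext_eq_tens) (simp add: split_cfg_def Un_absorb1)

lemma adj_ext: "adj (ext S R K) = ext S R (adj K)"
  by (auto simp: ext_def adj_def fun_eq_iff)

lemma ext_ops: "ext S R K \<in> ops (cfg R) (cfg R)"
  by (auto simp: ext_def ops_def)

lemma opbound_ext:
  fixes K :: "('s \<Rightarrow> 'n::finite, 's \<Rightarrow> 'n) kernel"
  assumes "S \<subseteq> R" "finite R" "opbound (cfg S) (cfg S) K c" "0 \<le> c"
  shows "opbound (cfg R) (cfg R) (ext S R K) c"
proof -
  have "fst (split_cfg S (R - S)) = (cfg R :: ('s \<Rightarrow> 'n) set)"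
    using assms(1) by (simp add: split_cfg_def Un_absorb1)
  then show ?thesis
    using opbound_tens[OF factorizes_split_cfg[of S "R - S"] factorizes_split_cfg[of S "R - S"], of K c] assms
    by (simp add: ext_eq_tens)
qed

section \<open>PEPS maps\<close>

lemma nbr_neq: "k < 4 \<Longrightarrow> nbr v k \<noteq> v"
  by (cases v) (auto simp: nbr_def numeral_eq_Suc less_Suc_eq)

lemma edges_cases:
  assumes "e \<in> edges"
  obtains u v where "e = {u, v}" "u \<noteq> v"
  using assms nbr_neq unfolding edges_def leg_def by blast

lemma edge_eq_leg:
  assumes "e \<in> edges" "w \<in> e"
  shows "\<exists>k<4. e = leg w k"
proof -
  obtain v k where k: "k < 4" "e = {v, nbr v k}" using assms(1) by (auto simp: edges_def leg_def)
  \<comment> \<open>The neighbours are listed counterclockwise, so the opposite direction is two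
    places further on.\<close>
  have "nbr (nbr v k) ((k + 2) mod 4) = v"
  proof -
    consider "k = 0" | "k = 1" | "k = 2" | "k = 3" using k(1) by linarith
    then show ?thesis by cases (cases v; simp add: nbr_def)+
  qed
  moreover have "(k + 2) mod 4 < 4" by simp
  ultimately show ?thesis using k assms(2) unfolding leg_def by (metis doubleton_eq_iff insert_iff singletonD)
qed

text \<open>The edges whose labels enter \<open>peps_map\<close>, by one condition instead of a
  union of inner and boundary edges.\<close>

definition touch :: "vertex set \<Rightarrow> edge set" where
  "touch \<Lambda> = {e \<in> edges. e \<inter> \<Lambda> \<noteq> {}}"

lemma inner_edges_Un_bd: "inner_edges \<Lambda> \<union> bd \<Lambda> = touch \<Lambda>"
  by (auto simp: inner_edges_def bd_def touch_def elim: edges_cases)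

lemma bd_subset_touch: "bd \<Lambda> \<subseteq> touch \<Lambda>"
  by (auto simp: bd_def touch_def)

lemma finite_touch: "finite \<Lambda> \<Longrightarrow> finite (touch \<Lambda>)"
proof -
  assume "finite \<Lambda>"
  moreover have "touch \<Lambda> \<subseteq> (\<lambda>(v, k). leg v k) ` (\<Lambda> \<times> {..<4})"
    using edge_eq_leg by (fastforce simp: touch_def)
  ultimately show ?thesis using finite_subset by blast
qed

lemma finite_bd [simp]: "finite \<Lambda> \<Longrightarrow> finite (bd \<Lambda>)"
  using finite_touch bd_subset_touch finite_subset by metis

lemma touch_Un: "touch (A \<union> B) = touch A \<union> touch B"
  by (auto simp: touch_def)

lemma touch_Int:
  assumes "A \<inter> B = {}"
  shows "touch A \<inter> touch B = bd A \<inter> bd B"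
  using assms by (auto simp: touch_def bd_def)

text \<open>An edge has two ends. One lying on both boundaries joins \<open>A\<close> to
  \<open>B\<close> and becomes inner in the union; the other boundary edges keep an end
  outside.\<close>

lemma bd_Un:
  assumes "A \<inter> B = {}"
  shows "bd (A \<union> B) = (bd A - bd B) \<union> (bd B - bd A)"
proof (intro equalityI subsetI)
  fix e assume e: "e \<in> bd (A \<union> B)"
  then have "e \<in> edges" by (simp add: bd_def)
  then obtain u v where "e = {u, v}" "u \<noteq> v" by (rule edges_cases)
  then show "e \<in> (bd A - bd B) \<union> (bd B - bd A)" using e assms by (auto simp: bd_def)
next
  fix e assume e: "e \<in> (bd A - bd B) \<union> (bd B - bd A)"
  then have "e \<in> edges" by (auto simp: bd_def)
  then obtain u v where "e = {u, v}" "u \<noteq> v" by (rule edges_cases)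
  then show "e \<in> bd (A \<union> B)" using e assms by (auto simp: bd_def)
qed

lemma leg_in_touch: "v \<in> \<Lambda> \<Longrightarrow> k < 4 \<Longrightarrow> leg v k \<in> touch \<Lambda>"
proof -
  assume "v \<in> \<Lambda>" "k < 4"
  then have "leg v k \<in> edges" "v \<in> leg v k" by (auto simp only: edges_def leg_def)
  then show ?thesis using \<open>v \<in> \<Lambda>\<close> by (auto simp: touch_def)
qed

section \<open>Edge labellings and gluing of PEPS maps\<close>

definition site_weight :: "('p::finite, 'b::finite) peps \<Rightarrow> vertex set \<Rightarrow> (vertex \<Rightarrow> 'p) \<Rightarrow> (edge \<Rightarrow> 'b) \<Rightarrow> complex" where
  "site_weight T \<Lambda> p j = (\<Prod>v\<in>\<Lambda>. T v (p v) (\<lambda>k\<in>{..<4}. j (leg v k)))"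

lemma site_weight_cong:
  assumes "\<And>v. v \<in> \<Lambda> \<Longrightarrow> p v = p' v" "\<And>e. e \<in> touch \<Lambda> \<Longrightarrow> j e = j' e"
  shows "site_weight T \<Lambda> p j = site_weight T \<Lambda> p' j'"
  unfolding site_weight_def
  by (intro prod.cong refl arg_cong2[where f = "T _"] restrict_ext assms(2))
    (auto simp: assms(1) leg_in_touch)

lemma site_weight_Un:
  assumes "finite A" "finite B" "A \<inter> B = {}"
  shows "site_weight T (A \<union> B) p j = site_weight T A p j * site_weight T B p j"
  unfolding site_weight_def using assms by (rule prod.union_disjoint)

text \<open>The amplitude of each basis vector in a maximally entangled pair;
  \<open>bond_factor\<close> is its inverse.\<close>

definition edge_norm :: "'b::finite itself \<Rightarrow> complex" where
  "edge_norm _ = of_real (1 / sqrt (real CARD('b)))"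

lemma peps_map_eq:
  fixes T :: "('p::finite, 'b::finite) peps"
  assumes "p \<in> cfg \<Lambda>" "x \<in> cfg (bd \<Lambda>)"
  shows "peps_map T \<Lambda> p x = edge_norm TYPE('b) ^ card (touch \<Lambda>) *
      (\<Sum>j | j \<in> cfg (touch \<Lambda>) \<and> restrict j (bd \<Lambda>) = x. site_weight T \<Lambda> p j)"
  using assms by (simp add: peps_map_def inner_edges_Un_bd site_weight_def edge_norm_def)

lemma peps_map_outside: "p \<notin> cfg \<Lambda> \<Longrightarrow> peps_map T \<Lambda> p x = 0"
  by (simp add: peps_map_def)

lemma peps_map_ops: "peps_map T \<Lambda> \<in> ops (cfg \<Lambda>) (cfg (bd \<Lambda>))"
  by (auto simp: peps_map_def ops_def)

definition bond_factor :: "'b::finite itself \<Rightarrow> complex" where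
  "bond_factor _ = of_real (sqrt (real CARD('b)))"

lemma edge_norm_bond_factor: "edge_norm TYPE('b::finite) * bond_factor TYPE('b) = 1"
  by (simp add: edge_norm_def bond_factor_def)

lemma vhat_ext_eq:
  fixes T :: "('p::finite, 'b::finite) peps"
  assumes "y \<in> cfg (bd B)" "x \<in> cfg (bd (A \<union> B))"
  shows "vhat_ext T A B (p, y) x = (if \<forall>e\<in>bd B - bd A. y e = x e
      then bond_factor TYPE('b) ^ card (bd A \<inter> bd B) *
        peps_map T A p (\<lambda>e\<in>bd A. if e \<in> bd B then y e else x e) else 0)"
proof -
  have "(\<lambda>e\<in>bd A. if e \<in> bd B then restrict y (bd A \<inter> bd B) e else restrict x (bd A - bd B) e)
      = (\<lambda>e\<in>bd A. if e \<in> bd B then y e else x e)"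
    by (auto simp: fun_eq_iff)
  then show ?thesis using assms by (simp add: vhat_ext_def vhat_def bond_factor_def)
qed

lemma vhat_ext_outside:
  "p \<notin> cfg A \<or> y \<notin> cfg (bd B) \<or> x \<notin> cfg (bd (A \<union> B)) \<Longrightarrow> vhat_ext T A B (p, y) x = 0"
  by (auto simp: vhat_ext_def vhat_def peps_map_outside)

text \<open>The identity on \<open>C\<close> fixes the first component, so the sum over
  \<open>C \<times> J\<close> collapses to one over \<open>J\<close>.\<close>

lemma mm_tens_second_factor:
  assumes "finite C" "i \<in> fst a" "snd (snd a) i \<in> C"
  shows "mm (C \<times> J) (tens a (second_factor C J) M) N i k = (\<Sum>j\<in>J. M (fst (snd a) i) j * N (snd (snd a) i, j) k)"
proof -
  have "mm (C \<times> J) (tens a (second_factor C J) M) N i k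
      = (\<Sum>(c, j)\<in>C \<times> J. if snd (snd a) i = c then M (fst (snd a) i) j * N (snd (snd a) i, j) k else 0)"
    unfolding mm_def using assms(2) by (intro sum.cong) (auto simp: tens_def second_factor_def)
  also have "\<dots> = (\<Sum>j\<in>J. \<Sum>c\<in>C. if snd (snd a) i = c then M (fst (snd a) i) j * N (snd (snd a) i, j) k else 0)"
    by (subst sum.swap) (simp add: sum.cartesian_product)
  finally show ?thesis using assms(1,3) by simp
qed

lemma sum_single:
  assumes "finite S" "a \<in> S" "\<And>s. s \<in> S \<Longrightarrow> s \<noteq> a \<Longrightarrow> f s = 0"
  shows "sum f S = f a"
  using sum.mono_neutral_right[of S "{a}" f] assms by auto

text \<open>A labelling of the edges touching \<open>A \<union> B\<close> is a pair of labellings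
  agreeing on the shared edges, and the site weights multiply. The normalization of the shared
  edges, counted in both regions, is corrected by the factor in \<open>vhat\<close>.\<close>

lemma peps_map_Un:
  fixes T :: "('p::finite, 'b::finite) peps"
  assumes fin: "finite A" "finite B" and dis: "A \<inter> B = {}"
  shows "peps_map T (A \<union> B) = mm (cfg A \<times> cfg (bd B))
      (tens (split_cfg B A) (second_factor (cfg A) (cfg (bd B))) (peps_map T B)) (vhat_ext T A B)"
proof (intro ext)
  fix s x
  let ?rhs = "mm (cfg A \<times> cfg (bd B)) (tens (split_cfg B A) (second_factor (cfg A) (cfg (bd B))) (peps_map T B)) (vhat_ext T A B)"
  show "peps_map T (A \<union> B) s x = ?rhs s x"
  proof (cases "s \<in> cfg (A \<union> B) \<and> x \<in> cfg (bd (A \<union> B))")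
    case False
    then have "?rhs s x = 0"
      by (auto simp: mm_def tens_def split_cfg_def Un_commute vhat_ext_outside intro!: sum.neutral)
    then show ?thesis using False by (auto simp: peps_map_def)
  next
    case True
    then have s: "s \<in> cfg (A \<union> B)" and x: "x \<in> cfg (bd (A \<union> B))" by auto
    let ?tA = "touch A" and ?tB = "touch B"
    let ?n = "edge_norm TYPE('b)" and ?m = "bond_factor TYPE('b) ^ card (bd A \<inter> bd B)"
    let ?ok = "\<lambda>y. \<forall>e\<in>bd B - bd A. y e = x e"
    let ?mix = "\<lambda>y. \<lambda>e\<in>bd A. if e \<in> bd B then y e else x e"
    have finc: "finite (cfg ?tA :: (edge \<Rightarrow> 'b) set)" "finite (cfg ?tB :: (edge \<Rightarrow> 'b) set)"
      using fin by (simp_all add: finite_touch)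
    \<comment> \<open>The contraction of \<open>A\<close> alone, its shared boundary labels taken
      from \<open>y\<close> and the others from \<open>x\<close>.\<close>
    define a where "a y = (\<Sum>j | j \<in> cfg ?tA \<and> restrict j (bd A) = ?mix y. site_weight T A s j)" for y
    have "?rhs s x = (\<Sum>y\<in>cfg (bd B). peps_map T B (restrict s B) y * vhat_ext T A B (restrict s A, y) x)"
      using mm_tens_second_factor[of "cfg A" s "split_cfg B A" "cfg (bd B)" "peps_map T B" "vhat_ext T A B" x] s fin
      by (simp add: split_cfg_def Un_commute)
    \<comment> \<open>The summand is rewritten to depend on \<open>y\<close> only through the
      labelling \<open>j\<close> that restricts to it, so that the two sums can be merged.\<close>
    also have "\<dots> = (\<Sum>y\<in>cfg (bd B). \<Sum>j | j \<in> cfg ?tB \<and> restrict j (bd B) = y.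
        if ?ok j then ?n ^ card ?tA * ?n ^ card ?tB * ?m * (site_weight T B s j * a j) else 0)"
    proof (rule sum.cong[OF refl])
      fix y :: "edge \<Rightarrow> 'b" assume y: "y \<in> cfg (bd B)"
      have B: "peps_map T B (restrict s B) y = ?n ^ card ?tB *
          (\<Sum>j | j \<in> cfg ?tB \<and> restrict j (bd B) = y. site_weight T B s j)"
        unfolding peps_map_eq[OF restrict_cfg y]
        by (intro arg_cong2[where f = "(*)"] refl sum.cong site_weight_cong) auto
      have A: "peps_map T A (restrict s A) (?mix y) = ?n ^ card ?tA * a y"
        unfolding peps_map_eq[OF restrict_cfg restrict_cfg] a_def
        by (intro arg_cong2[where f = "(*)"] refl sum.cong site_weight_cong) auto
      have "peps_map T B (restrict s B) y * vhat_ext T A B (restrict s A, y) x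
         = (\<Sum>j | j \<in> cfg ?tB \<and> restrict j (bd B) = y.
             if ?ok y then ?n ^ card ?tA * ?n ^ card ?tB * ?m * (site_weight T B s j * a y) else 0)"
      proof (cases "?ok y")
        case True
        then show ?thesis
          unfolding vhat_ext_eq[OF y x] A B by (simp add: sum_distrib_left sum_distrib_right mult_ac)
      next
        case False
        then show ?thesis
          unfolding vhat_ext_eq[OF y x] by (simp only: if_False mult_zero_right sum.neutral_const)
      qed
      also have "\<dots> = (\<Sum>j | j \<in> cfg ?tB \<and> restrict j (bd B) = y.
             if ?ok j then ?n ^ card ?tA * ?n ^ card ?tB * ?m * (site_weight T B s j * a j) else 0)"
      proof (rule sum.cong[OF refl])
        fix j assume "j \<in> {j. j \<in> cfg ?tB \<and> restrict j (bd B) = y}"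
        then have j: "y e = j e" if "e \<in> bd B" for e using that by auto
        have "?ok y = ?ok j" using j by auto
        moreover have "?mix y = ?mix j" using j by (auto simp: fun_eq_iff)
        then have "a y = a j" unfolding a_def by simp
        ultimately show "(if ?ok y then ?n ^ card ?tA * ?n ^ card ?tB * ?m * (site_weight T B s j * a y) else 0) =
            (if ?ok j then ?n ^ card ?tA * ?n ^ card ?tB * ?m * (site_weight T B s j * a j) else 0)" by simp
      qed
      finally show "peps_map T B (restrict s B) y * vhat_ext T A B (restrict s A, y) x
         = (\<Sum>j | j \<in> cfg ?tB \<and> restrict j (bd B) = y.
             if ?ok j then ?n ^ card ?tA * ?n ^ card ?tB * ?m * (site_weight T B s j * a j) else 0)" .
    qed
    also have "\<dots> = (\<Sum>j\<in>cfg ?tB. if ?ok j then ?n ^ card ?tA * ?n ^ card ?tB * ?m * (site_weight T B s j * a j) else 0)"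
      using finc fin by (intro sum.group) auto
    also have "\<dots> = (\<Sum>j | j \<in> cfg ?tB \<and> ?ok j. ?n ^ card ?tA * ?n ^ card ?tB * ?m * (site_weight T B s j * a j))"
      using finc(2) by (rule sum.inter_filter[symmetric])
    also have "\<dots> = ?n ^ card ?tA * ?n ^ card ?tB * ?m * (\<Sum>j | j \<in> cfg ?tB \<and> ?ok j.
        \<Sum>i | i \<in> cfg ?tA \<and> restrict i (bd A) = ?mix j. site_weight T A s i * site_weight T B s j)"
      by (simp add: a_def sum_distrib_left sum_distrib_right mult_ac)
    \<comment> \<open>Inclusion-exclusion for \<open>touch\<close>: the surplus factors belong to
      the shared edges and cancel against \<open>?m\<close>.\<close>
    also have "?n ^ card ?tA * ?n ^ card ?tB * ?m = ?n ^ card (touch (A \<union> B))"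
    proof -
      have "card ?tA + card ?tB = card (touch (A \<union> B)) + card (bd A \<inter> bd B)"
        unfolding touch_Un touch_Int[OF dis, symmetric] using fin by (intro card_Un_Int finite_touch)
      then have "?n ^ card ?tA * ?n ^ card ?tB = ?n ^ card (touch (A \<union> B)) * ?n ^ card (bd A \<inter> bd B)"
        by (simp add: power_add[symmetric])
      then show ?thesis by (simp add: power_mult_distrib[symmetric] edge_norm_bond_factor mult.assoc)
    qed
    also have "(\<Sum>j | j \<in> cfg ?tB \<and> ?ok j.
        \<Sum>i | i \<in> cfg ?tA \<and> restrict i (bd A) = ?mix j. site_weight T A s i * site_weight T B s j)
      = (\<Sum>(j, i)\<in>(SIGMA j:{j. j \<in> cfg ?tB \<and> ?ok j}. {i. i \<in> cfg ?tA \<and> restrict i (bd A) = ?mix j}).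
          site_weight T A s i * site_weight T B s j)"
      using finc by (intro sum.Sigma) auto
    \<comment> \<open>Compatible pairs glue to one labelling and restriction undoes this.
      Compatibility is contained in \<open>?mix\<close>, since an edge touching both regions lies on
      both boundaries.\<close>
    also have "\<dots> = (\<Sum>j | j \<in> cfg (touch (A \<union> B)) \<and> restrict j (bd (A \<union> B)) = x. site_weight T (A \<union> B) s j)"
    proof (rule sum.reindex_bij_witness[where i = "\<lambda>j. (restrict j ?tB, restrict j ?tA)"
          and j = "\<lambda>(j, i). \<lambda>e\<in>?tA \<union> ?tB. if e \<in> ?tB then j e else i e"])
      note bdU = bd_Un[OF dis] and tI = touch_Int[OF dis] and bt = bd_subset_touch[of A] bd_subset_touch[of B]
      {
        fix ji assume "ji \<in> (SIGMA j:{j. j \<in> cfg ?tB \<and> ?ok j}. {i. i \<in> cfg ?tA \<and> restrict i (bd A) = ?mix j})"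
        then obtain j i where ji: "ji = (j, i)" "j \<in> cfg ?tB" "i \<in> cfg ?tA"
          and ok: "\<And>e. e \<in> bd B \<Longrightarrow> e \<notin> bd A \<Longrightarrow> j e = x e"
          and mix: "restrict i (bd A) = ?mix j" by auto
        have iA: "i e = (if e \<in> bd B then j e else x e)" if "e \<in> bd A" for e
          using fun_cong[OF mix, of e] that by simp
        have ij: "i e = j e" if "e \<in> ?tA" "e \<in> ?tB" for e
        proof -
          have "e \<in> bd A" "e \<in> bd B" using that tI by blast+
          then show ?thesis using iA by simp
        qed
        let ?g = "\<lambda>e\<in>?tA \<union> ?tB. if e \<in> ?tB then j e else i e"
        have gB: "?g e = j e" if "e \<in> ?tB" for e using that by simp
        have gA: "?g e = i e" if "e \<in> ?tA" for e using that ij by simp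
        show "(restrict ((\<lambda>(j, i). \<lambda>e\<in>?tA \<union> ?tB. if e \<in> ?tB then j e else i e) ji) ?tB,
            restrict ((\<lambda>(j, i). \<lambda>e\<in>?tA \<union> ?tB. if e \<in> ?tB then j e else i e) ji) ?tA) = ji"
          unfolding ji(1) using ji(2,3) gA gB by (auto intro!: cfg_eqI)
        have "restrict ?g (bd (A \<union> B)) = x"
        proof (rule cfg_eqI[OF restrict_cfg x])
          fix e assume e: "e \<in> bd (A \<union> B)"
          then consider "e \<in> bd A" "e \<notin> bd B" | "e \<in> bd B" "e \<notin> bd A" using bdU by auto
          then have "?g e = x e"
          proof cases
            case 1
            then show ?thesis using gA[of e] iA[of e] bt by auto
          next
            case 2
            then show ?thesis using gB[of e] ok[of e] bt by auto
          qed
          then show "restrict ?g (bd (A \<union> B)) e = x e" using e by simp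
        qed
        then show "(\<lambda>(j, i). \<lambda>e\<in>?tA \<union> ?tB. if e \<in> ?tB then j e else i e) ji
            \<in> {j. j \<in> cfg (touch (A \<union> B)) \<and> restrict j (bd (A \<union> B)) = x}"
          unfolding ji(1) by (simp add: touch_Un)
        have "site_weight T A s ?g = site_weight T A s i" "site_weight T B s ?g = site_weight T B s j"
          using gA gB by (auto intro!: site_weight_cong)
        then show "site_weight T (A \<union> B) s ((\<lambda>(j, i). \<lambda>e\<in>?tA \<union> ?tB. if e \<in> ?tB then j e else i e) ji) =
            (case ji of (j, i) \<Rightarrow> site_weight T A s i * site_weight T B s j)"
          unfolding ji(1) by (simp only: case_prod_conv site_weight_Un[OF fin dis])
      }
      {
        fix j assume "j \<in> {j. j \<in> cfg (touch (A \<union> B)) \<and> restrict j (bd (A \<union> B)) = x}"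
        then have j: "j \<in> cfg (?tA \<union> ?tB)" "restrict j (bd (A \<union> B)) = x" by (auto simp: touch_Un)
        have jx: "j e = x e" if "e \<in> bd (A \<union> B)" for e using fun_cong[OF j(2), of e] that by simp
        show "(\<lambda>(j, i). \<lambda>e\<in>?tA \<union> ?tB. if e \<in> ?tB then j e else i e) (restrict j ?tB, restrict j ?tA) = j"
          using j(1) by (auto intro!: cfg_eqI)
        have "restrict (restrict j ?tA) (bd A) = ?mix (restrict j ?tB)"
        proof (rule cfg_eqI[OF restrict_cfg restrict_cfg])
          fix e assume "e \<in> bd A"
          then show "restrict (restrict j ?tA) (bd A) e = ?mix (restrict j ?tB) e"
            using bt jx[of e] bdU by auto
        qed
        then show "(restrict j ?tB, restrict j ?tA)
            \<in> (SIGMA j:{j. j \<in> cfg ?tB \<and> ?ok j}. {i. i \<in> cfg ?tA \<and> restrict i (bd A) = ?mix j})"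
          using bt jx bdU by auto
      }
    qed
    also have "?n ^ card (touch (A \<union> B)) * \<dots> = peps_map T (A \<union> B) s x"
      by (rule peps_map_eq[OF s x, symmetric])
    finally show ?thesis by simp
  qed
qed

text \<open>The edges in \<open>E\<close> do not touch the boundary of \<open>A\<close>, so
  \<open>vhat_ext\<close> carries their labels through unchanged and an operator on them can act
  before or after it.\<close>

lemma vhat_ext_mm_ext:
  fixes T :: "('p::finite, 'b::finite) peps"
  assumes fin: "finite A" "finite B" and dis: "A \<inter> B = {}" and E: "E \<subseteq> bd B - bd A"
  shows "mm (cfg (bd (A \<union> B))) (vhat_ext T A B) (ext E (bd (A \<union> B)) K) =
    mm (cfg A \<times> cfg (bd B)) (tens (second_factor (cfg A) (cfg (bd B))) (second_factor (cfg A) (cfg (bd B)))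
      (ext E (bd B) K)) (vhat_ext T A B)"
proof (intro ext)
  fix py :: "(vertex \<Rightarrow> 'p) \<times> (edge \<Rightarrow> 'b)" and x
  obtain p y where py: "py = (p, y)" by (cases py)
  let ?lhs = "mm (cfg (bd (A \<union> B))) (vhat_ext T A B) (ext E (bd (A \<union> B)) K)"
  let ?rhs = "mm (cfg A \<times> cfg (bd B)) (tens (second_factor (cfg A) (cfg (bd B))) (second_factor (cfg A) (cfg (bd B)))
      (ext E (bd B) K)) (vhat_ext T A B)"
  show "?lhs py x = ?rhs py x"
  proof (cases "p \<in> cfg A \<and> y \<in> cfg (bd B) \<and> x \<in> cfg (bd (A \<union> B))")
    case False
    then have "?lhs py x = 0"
      unfolding mm_def py
      by (intro sum.neutral ballI) (metis mult_eq_0_iff vhat_ext_outside ext_def)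
    moreover have "?rhs py x = 0"
      unfolding mm_def py using False
      by (intro sum.neutral ballI) (auto simp: vhat_ext_outside tens_def second_factor_def)
    ultimately show ?thesis by simp
  next
    case True
    then have p: "p \<in> cfg A" and y: "y \<in> cfg (bd B)" and x: "x \<in> cfg (bd (A \<union> B))" by auto
    note bdU = bd_Un[OF dis]
    \<comment> \<open>On each side the matching conditions leave one intermediate configuration:
      \<open>w\<close> on the left, \<open>u\<close> on the right.\<close>
    define w where "w = (\<lambda>e\<in>bd (A \<union> B). if e \<in> bd B then y e else x e)"
    define u where "u = (\<lambda>e\<in>bd B. if e \<in> bd A then y e else x e)"
    have w: "w \<in> cfg (bd (A \<union> B))" and u: "u \<in> cfg (bd B)" by (simp_all add: w_def u_def)
    have "?lhs (p, y) x = vhat_ext T A B (p, y) w * ext E (bd (A \<union> B)) K w x"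
      unfolding mm_def
    proof (rule sum_single)
      fix v :: "edge \<Rightarrow> 'b" assume v: "v \<in> cfg (bd (A \<union> B))" "v \<noteq> w"
      show "vhat_ext T A B (p, y) v * ext E (bd (A \<union> B)) K v x = 0"
      proof (rule ccontr)
        assume "vhat_ext T A B (p, y) v * ext E (bd (A \<union> B)) K v x \<noteq> 0"
        then have "\<forall>e\<in>bd B - bd A. y e = v e" "\<forall>e\<in>bd (A \<union> B) - E. v e = x e"
          using vhat_ext_eq[OF y v(1), of T p] by (auto simp: ext_def split: if_splits)
        then have "v = w" using E bdU by (intro cfg_eqI[OF v(1) w]) (auto simp: w_def)
        then show False using v(2) by simp
      qed
    qed (use fin w in simp_all)
    moreover have "?rhs (p, y) x = ext E (bd B) K y u * vhat_ext T A B (p, u) x"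
    proof -
      have "?rhs (p, y) x = (\<Sum>v\<in>cfg (bd B). ext E (bd B) K y v * vhat_ext T A B (p, v) x)"
        using mm_tens_second_factor[of "cfg A" "(p, y)" "second_factor (cfg A) (cfg (bd B))"] fin p y
        by (simp add: second_factor_def)
      also have "\<dots> = ext E (bd B) K y u * vhat_ext T A B (p, u) x"
      proof (rule sum_single)
        fix v :: "edge \<Rightarrow> 'b" assume v: "v \<in> cfg (bd B)" "v \<noteq> u"
        show "ext E (bd B) K y v * vhat_ext T A B (p, v) x = 0"
        proof (rule ccontr)
          assume "ext E (bd B) K y v * vhat_ext T A B (p, v) x \<noteq> 0"
          then have "\<forall>e\<in>bd B - bd A. v e = x e" "\<forall>e\<in>bd B - E. y e = v e"
            using vhat_ext_eq[OF v(1) x, of T p] by (auto simp: ext_def split: if_splits)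
          moreover have "s \<notin> E" if "s \<in> bd A" for s using E that by auto
          ultimately have "v = u" by (intro cfg_eqI[OF v(1) u]) (auto simp: u_def)
          then show False using v(2) by simp
        qed
      qed (use fin u in simp_all)
      finally show ?thesis .
    qed
    moreover have "vhat_ext T A B (p, y) w = vhat_ext T A B (p, u) x"
    proof -
      have "(\<lambda>e\<in>bd A. if e \<in> bd B then y e else w e) = (\<lambda>e\<in>bd A. if e \<in> bd B then u e else x e)"
        using bdU by (auto simp: fun_eq_iff w_def u_def)
      moreover have "\<forall>e\<in>bd B - bd A. y e = w e" "\<forall>e\<in>bd B - bd A. u e = x e"
        using bdU by (auto simp: w_def u_def)
      ultimately show ?thesis unfolding vhat_ext_eq[OF y w] vhat_ext_eq[OF u x] by simp
    qed
    moreover have "ext E (bd (A \<union> B)) K w x = ext E (bd B) K y u"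
    proof -
      have "(\<forall>s\<in>bd (A \<union> B) - E. w s = x s) \<longleftrightarrow> (\<forall>s\<in>bd B - bd A - E. y s = x s)"
        using bdU E by (auto simp: w_def)
      moreover have "(\<forall>s\<in>bd B - E. y s = u s) \<longleftrightarrow> (\<forall>s\<in>bd B - bd A - E. y s = x s)"
        using bdU E by (auto simp: u_def)
      moreover have "restrict w E = restrict y E" "restrict u E = restrict x E"
        unfolding restrict_eq_iff using bdU E by (auto simp: w_def u_def)
      ultimately show ?thesis using w x y u by (simp add: ext_def)
    qed
    ultimately show ?thesis by (simp add: py mult.commute)
  qed
qed

text \<open>With no edge on the boundaries of both \<open>A\<close> and \<open>C\<close>, the
  contraction of \<open>A\<close> and that of \<open>C\<close> use different labels. Joining them
  along the boundary of \<open>ABC\<close> therefore gives the same kernel as joining them along the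
  boundary of \<open>B\<close>.\<close>

lemma vhat_ext_exchange:
  fixes T :: "('p::finite, 'b::finite) peps"
  assumes fin: "finite A" "finite B" "finite C"
    and dis: "A \<inter> B = {}" "B \<inter> C = {}" "A \<inter> C = {}" and AC: "bd A \<inter> bd C = {}"
  shows "mm (cfg (bd (A \<union> B \<union> C))) (vhat_ext T C (A \<union> B)) (adj (vhat_ext T A (B \<union> C))) =
    mm (cfg (A \<union> C) \<times> cfg (bd B))
      (adj (tens (split_fst A C (cfg (bd B))) (second_factor (cfg C) (cfg (bd (A \<union> B)))) (vhat_ext T A B)))
      (tens (split_fst C A (cfg (bd B))) (second_factor (cfg A) (cfg (bd (B \<union> C)))) (vhat_ext T C B))"
    (is "?lhs = ?rhs")
proof (intro ext)
  fix cx ay :: "(vertex \<Rightarrow> 'p) \<times> (edge \<Rightarrow> 'b)"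
  obtain c x a y where cx: "cx = (c, x)" and ay: "ay = (a, y)" by (cases cx, cases ay)
  note bAB = bd_Un[OF dis(1)] and bBC = bd_Un[OF dis(2)]
  have dis': "(A \<union> B) \<inter> C = {}" "A \<inter> (B \<union> C) = {}" "C \<inter> (A \<union> B) = {}" "C \<inter> B = {}" using dis by auto
  have bABC: "bd (A \<union> B \<union> C) = (bd A - bd B) \<union> (bd B - bd A - bd C) \<union> (bd C - bd B)"
    unfolding bd_Un[OF dis'(1)] bAB using AC by auto
  have eqs: "C \<union> (A \<union> B) = A \<union> B \<union> C" "A \<union> (B \<union> C) = A \<union> B \<union> C" "C \<union> B = B \<union> C" "C \<union> A = A \<union> C" by auto
  have shared: "bd A \<inter> bd (B \<union> C) = bd A \<inter> bd B" "bd C \<inter> bd (A \<union> B) = bd C \<inter> bd B"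
    using AC bAB bBC by auto
  show "?lhs cx ay = ?rhs cx ay"
  proof (cases "c \<in> cfg C \<and> x \<in> cfg (bd (A \<union> B)) \<and> a \<in> cfg A \<and> y \<in> cfg (bd (B \<union> C))")
    case False
    then have "vhat_ext T C (A \<union> B) (c, x) w * cnj (vhat_ext T A (B \<union> C) (a, y) w) = 0" for w
      by (auto simp: vhat_ext_outside)
    then have "?lhs cx ay = 0" unfolding cx ay mm_def adj_def by (intro sum.neutral ballI)
    moreover have "?rhs cx ay = 0"
      using False by (auto simp: mm_def cx ay adj_def tens_def second_factor_def intro!: sum.neutral)
    ultimately show ?thesis by simp
  next
    case True
    then have c: "c \<in> cfg C" and x: "x \<in> cfg (bd (A \<union> B))" and a: "a \<in> cfg A" and y: "y \<in> cfg (bd (B \<union> C))"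
      by auto
    \<comment> \<open>The only intermediate indices that survive: \<open>w\<close> on the left, the
      pair of \<open>q\<close> and \<open>u\<close> on the right.\<close>
    define w where "w = (\<lambda>e\<in>bd (A \<union> B \<union> C). if e \<in> bd (A \<union> B) then x e else y e)"
    define q where "q = (\<lambda>s\<in>A \<union> C. if s \<in> A then a s else c s)"
    define u where "u = (\<lambda>e\<in>bd B. if e \<in> bd A then y e else x e)"
    have w: "w \<in> cfg (bd (A \<union> B \<union> C))" and q: "q \<in> cfg (A \<union> C)" and u: "u \<in> cfg (bd B)"
      by (simp_all add: w_def q_def u_def)
    have qA: "restrict q A = a" and qC: "restrict q C = c"
      using a c dis(3) by (auto intro!: cfg_eqI simp: q_def)
    note v1 = vhat_ext_eq[where A = C and B = "A \<union> B" and T = T, unfolded eqs, OF x]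
      and v2 = vhat_ext_eq[where A = A and B = "B \<union> C" and T = T, unfolded eqs, OF y]
      and v3 = vhat_ext_eq[where A = A and B = B and T = T, OF _ x]
      and v4 = vhat_ext_eq[where A = C and B = B and T = T, unfolded eqs, OF _ y]
    have "?lhs cx ay = vhat_ext T C (A \<union> B) (c, x) w * cnj (vhat_ext T A (B \<union> C) (a, y) w)"
      unfolding mm_def adj_def cx ay
    proof (rule sum_single)
      fix v :: "edge \<Rightarrow> 'b" assume v: "v \<in> cfg (bd (A \<union> B \<union> C))" "v \<noteq> w"
      show "vhat_ext T C (A \<union> B) (c, x) v * cnj (vhat_ext T A (B \<union> C) (a, y) v) = 0"
      proof (rule ccontr)
        assume "vhat_ext T C (A \<union> B) (c, x) v * cnj (vhat_ext T A (B \<union> C) (a, y) v) \<noteq> 0"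
        then have "\<forall>e\<in>bd (A \<union> B) - bd C. x e = v e" "\<forall>e\<in>bd (B \<union> C) - bd A. y e = v e"
          using v1[OF v(1), of c] v2[OF v(1), of a] by (auto split: if_splits)
        then have "v = w" using AC bAB bBC bABC
          by (intro cfg_eqI[OF v(1) w]) (auto simp: w_def)
        then show False using v(2) by simp
      qed
    qed (use fin w in simp_all)
    moreover have "?rhs cx ay = cnj (vhat_ext T A B (a, u) x) * vhat_ext T C B (c, u) y"
    proof -
      have "?rhs cx ay = (\<Sum>(r, v)\<in>cfg (A \<union> C) \<times> cfg (bd B). if restrict r C = c \<and> restrict r A = a
          then cnj (vhat_ext T A B (a, v) x) * vhat_ext T C B (c, v) y else 0)"
        unfolding mm_def adj_def cx ay using True
        by (intro sum.cong) (auto simp: tens_def split_fst_def second_factor_def eqs)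
      also have "\<dots> = (case (q, u) of (r, v) \<Rightarrow> if restrict r C = c \<and> restrict r A = a
          then cnj (vhat_ext T A B (a, v) x) * vhat_ext T C B (c, v) y else 0)"
      proof (rule sum_single)
        fix rv :: "(vertex \<Rightarrow> 'p) \<times> (edge \<Rightarrow> 'b)"
        assume rv: "rv \<in> cfg (A \<union> C) \<times> cfg (bd B)" "rv \<noteq> (q, u)"
        then obtain r v where rv': "rv = (r, v)" and r: "r \<in> cfg (A \<union> C)" and v: "v \<in> cfg (bd B)" by auto
        have "\<not> (restrict r C = c \<and> restrict r A = a \<and> vhat_ext T A B (a, v) x \<noteq> 0 \<and> vhat_ext T C B (c, v) y \<noteq> 0)"
        proof
          assume *: "restrict r C = c \<and> restrict r A = a \<and> vhat_ext T A B (a, v) x \<noteq> 0 \<and> vhat_ext T C B (c, v) y \<noteq> 0"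
          then have "r = q" by (intro cfg_eqI[OF r q]) (auto simp: q_def)
          have "\<forall>e\<in>bd B - bd A. v e = x e" "\<forall>e\<in>bd B - bd C. v e = y e"
            using * v3[OF v, of a] v4[OF v, of c] by (auto split: if_splits)
          then have "v = u" using AC by (intro cfg_eqI[OF v u]) (auto simp: u_def)
          then show False using rv(2) rv' \<open>r = q\<close> by simp
        qed
        then show "(case rv of (r, v) \<Rightarrow> if restrict r C = c \<and> restrict r A = a
          then cnj (vhat_ext T A B (a, v) x) * vhat_ext T C B (c, v) y else 0) = 0"
          unfolding rv' by auto
      qed (use fin q u in simp_all)
      finally show ?thesis by (simp add: qA qC)
    qed
    moreover have "vhat_ext T C (A \<union> B) (c, x) w * cnj (vhat_ext T A (B \<union> C) (a, y) w)
        = cnj (vhat_ext T A B (a, u) x) * vhat_ext T C B (c, u) y"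
    proof -
      have 1: "\<forall>e\<in>bd (A \<union> B) - bd C. x e = w e" "\<forall>e\<in>bd B - bd A. u e = x e"
        using bAB bABC AC by (auto simp: w_def u_def)
      \<comment> \<open>On edges of \<open>B\<close> away from \<open>A\<close> and \<open>C\<close>
        both outer indices carry a label; either side vanishes unless these labels agree.\<close>
      have 2: "(\<forall>e\<in>bd (B \<union> C) - bd A. y e = w e) \<longleftrightarrow> (\<forall>e\<in>bd B - bd C. u e = y e)"
      proof -
        have "(\<forall>e\<in>bd (B \<union> C) - bd A. y e = w e) \<longleftrightarrow> (\<forall>e\<in>bd B - bd A - bd C. y e = x e)"
          using bAB bBC bABC AC by (auto simp: w_def)
        moreover have "(\<forall>e\<in>bd B - bd C. u e = y e) \<longleftrightarrow> (\<forall>e\<in>bd B - bd A - bd C. y e = x e)"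
          using AC by (auto simp: u_def)
        ultimately show ?thesis by simp
      qed
      have 3: "(\<lambda>e\<in>bd C. if e \<in> bd (A \<union> B) then x e else w e) = (\<lambda>e\<in>bd C. if e \<in> bd B then u e else y e)"
        using bAB bABC AC by (auto simp: w_def u_def fun_eq_iff)
      have 4: "(\<lambda>e\<in>bd A. if e \<in> bd (B \<union> C) then y e else w e) = (\<lambda>e\<in>bd A. if e \<in> bd B then u e else x e)"
        using bAB bBC bABC AC by (auto simp: w_def u_def fun_eq_iff)
      show ?thesis
        unfolding v1[OF w] v2[OF w] v3[OF u] v4[OF u] 2 3 4 shared using 1 by simp
    qed
    ultimately show ?thesis by simp
  qed
qed

section \<open>Geometry of the three rectangles\<close>

abbreviation (input) lattice_adjacency :: "vertex set \<Rightarrow> (vertex \<times> vertex) set" where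
  "lattice_adjacency S \<equiv> {(x, y). x \<in> S \<and> y \<in> S \<and> {x, y} \<in> edges}"

lemma edges_horizontal: "{(t, y), (t + 1, y)} \<in> edges"
  unfolding edges_def leg_def nbr_def by (rule CollectI, rule exI[of _ "(t, y)"], rule exI[of _ 0]) simp

lemma edges_vertical: "{(t, y), (t, y + 1)} \<in> edges"
  unfolding edges_def leg_def nbr_def by (rule CollectI, rule exI[of _ "(t, y)"], rule exI[of _ 1]) simp

lemma horizontal_path:
  assumes "a \<le> b" "{a..b} \<times> {y} \<subseteq> S"
  shows "((a, y), (b, y)) \<in> (lattice_adjacency S)\<^sup>*"
  using assms
proof (induction b rule: int_ge_induct)
  case (step b)
  have "((a, y), (b, y)) \<in> (lattice_adjacency S)\<^sup>*" using step.prems by (intro step.IH) auto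
  moreover have "((b, y), (b + 1, y)) \<in> lattice_adjacency S"
    using step.prems step.hyps edges_horizontal by auto
  ultimately show ?case by (rule rtrancl_into_rtrancl)
qed simp

lemma vertical_path:
  assumes "a \<le> b" "{x} \<times> {a..b} \<subseteq> S"
  shows "((x, a), (x, b)) \<in> (lattice_adjacency S)\<^sup>*"
  using assms
proof (induction b rule: int_ge_induct)
  case (step b)
  have "((x, a), (x, b)) \<in> (lattice_adjacency S)\<^sup>*" using step.prems by (intro step.IH) auto
  moreover have "((x, b), (x, b + 1)) \<in> lattice_adjacency S"
    using step.prems step.hyps edges_vertical by auto
  ultimately show ?case by (rule rtrancl_into_rtrancl)
qed simp

lemma lattice_path_sym: "(u, v) \<in> (lattice_adjacency S)\<^sup>* \<Longrightarrow> (v, u) \<in> (lattice_adjacency S)\<^sup>*"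
  by (rule symD[OF sym_rtrancl]) (auto simp: sym_def insert_commute)

text \<open>Covers half-lines and the whole line besides finite intervals, so that half-planes are
  products of such sets.\<close>

definition order_convex :: "int set \<Rightarrow> bool" where
  "order_convex X \<longleftrightarrow> (\<forall>a\<in>X. \<forall>b\<in>X. {a..b} \<subseteq> X)"

text \<open>First a horizontal path to the target column, then a vertical one; convexity keeps both
  inside the product.\<close>

lemma lattice_connected_Times:
  assumes "order_convex X" "order_convex Y"
  shows "lattice_connected (X \<times> Y)"
  unfolding lattice_connected_def
proof (intro ballI)
  fix u v assume "u \<in> X \<times> Y" "v \<in> X \<times> Y"
  then obtain a b c d where uv: "u = (a, b)" "v = (c, d)" "a \<in> X" "b \<in> Y" "c \<in> X" "d \<in> Y" by auto
  have "((a, b), (c, b)) \<in> (lattice_adjacency (X \<times> Y))\<^sup>*"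
  proof (cases "a \<le> c")
    case True
    then show ?thesis using assms uv unfolding order_convex_def
      by (intro horizontal_path) (assumption, blast)
  next
    case False
    then show ?thesis using assms uv unfolding order_convex_def
      by (intro lattice_path_sym[OF horizontal_path]) (simp, blast)
  qed
  also have "((c, b), (c, d)) \<in> (lattice_adjacency (X \<times> Y))\<^sup>*"
  proof (cases "b \<le> d")
    case True
    then show ?thesis using assms uv unfolding order_convex_def
      by (intro vertical_path) (assumption, blast)
  next
    case False
    then show ?thesis using assms uv unfolding order_convex_def
      by (intro lattice_path_sym[OF vertical_path]) (simp, blast)
  qed
  finally show "(u, v) \<in> (lattice_adjacency (X \<times> Y))\<^sup>*" using uv by simp
qed

lemma lattice_connected_Un:
  assumes "lattice_connected S" "lattice_connected S'" "S \<inter> S' \<noteq> {}"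
  shows "lattice_connected (S \<union> S')"
  unfolding lattice_connected_def
proof (intro ballI)
  obtain w where w: "w \<in> S" "w \<in> S'" using assms(3) by auto
  have mono: "(lattice_adjacency S)\<^sup>* \<subseteq> (lattice_adjacency (S \<union> S'))\<^sup>*"
      "(lattice_adjacency S')\<^sup>* \<subseteq> (lattice_adjacency (S \<union> S'))\<^sup>*"
    by (intro rtrancl_mono; auto)+
  have to_w: "(u, w) \<in> (lattice_adjacency (S \<union> S'))\<^sup>*" if "u \<in> S \<union> S'" for u
    using that assms(1,2) w mono unfolding lattice_connected_def by blast
  fix u v assume "u \<in> S \<union> S'" "v \<in> S \<union> S'"
  then show "(u, v) \<in> (lattice_adjacency (S \<union> S'))\<^sup>*"
    using to_w lattice_path_sym rtrancl_trans by meson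
qed

lemma lattice_simply_connected_rect: "lattice_simply_connected (rect x x' y y')"
  unfolding lattice_simply_connected_def
proof
  show "lattice_connected (rect x x' y y')"
    unfolding rect_def by (rule lattice_connected_Times) (auto simp: order_convex_def)
  \<comment> \<open>Four half-planes, nested so that each one added meets the union before it at a
    point diagonally outside the rectangle.\<close>
  have "- rect x x' y y' = (({..<x} \<times> UNIV \<union> UNIV \<times> {..<y}) \<union> {x'..} \<times> UNIV) \<union> UNIV \<times> {y'..}"
    by (auto simp: rect_def)
  moreover have "lattice_connected ((({..<x} \<times> UNIV \<union> UNIV \<times> {..<y}) \<union> {x'..} \<times> UNIV) \<union> UNIV \<times> {y'..})"
  proof (intro lattice_connected_Un lattice_connected_Times)
    have "(x - 1, y - 1) \<in> ({..<x} \<times> UNIV) \<inter> (UNIV \<times> {..<y})" by simp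
    then show "({..<x} \<times> UNIV) \<inter> (UNIV \<times> {..<y}) \<noteq> {}" by blast
    have "(x', y - 1) \<in> ({..<x} \<times> UNIV \<union> UNIV \<times> {..<y}) \<inter> ({x'..} \<times> UNIV)" by simp
    then show "({..<x} \<times> UNIV \<union> UNIV \<times> {..<y}) \<inter> ({x'..} \<times> UNIV) \<noteq> {}" by blast
    have "(x', y') \<in> (({..<x} \<times> UNIV \<union> UNIV \<times> {..<y}) \<union> {x'..} \<times> UNIV) \<inter> (UNIV \<times> {y'..})" by simp
    then show "(({..<x} \<times> UNIV \<union> UNIV \<times> {..<y}) \<union> {x'..} \<times> UNIV) \<inter> (UNIV \<times> {y'..}) \<noteq> {}" by blast
  qed (auto simp: order_convex_def)
  ultimately show "lattice_connected (- rect x x' y y')" by simp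
qed

text \<open>The edge across the common side in row \<open>y\<close> lies on both boundaries, and the
  union is again a rectangle, so simple connectedness of rectangles covers all three
  regions.\<close>

lemma contiguous_rect:
  assumes "x\<^sub>0 < x\<^sub>1" "x\<^sub>1 < x\<^sub>2" "y < y'"
  shows "contiguous (rect x\<^sub>0 x\<^sub>1 y y') (rect x\<^sub>1 x\<^sub>2 y y')"
proof -
  have "{(x\<^sub>1 - 1, y), (x\<^sub>1, y)} \<in> bd (rect x\<^sub>0 x\<^sub>1 y y') \<inter> bd (rect x\<^sub>1 x\<^sub>2 y y')"
    using assms edges_horizontal[of "x\<^sub>1 - 1" y] by (auto simp: bd_def rect_def)
  moreover have "rect x\<^sub>0 x\<^sub>1 y y' \<union> rect x\<^sub>1 x\<^sub>2 y y' = rect x\<^sub>0 x\<^sub>2 y y'"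
    using assms by (auto simp: rect_def)
  moreover have "finite (rect x\<^sub>0 x\<^sub>1 y y')" "finite (rect x\<^sub>1 x\<^sub>2 y y')" by (auto simp: rect_def)
  moreover have "rect x\<^sub>0 x\<^sub>1 y y' \<noteq> {}" "rect x\<^sub>1 x\<^sub>2 y y' \<noteq> {}" "rect x\<^sub>0 x\<^sub>1 y y' \<inter> rect x\<^sub>1 x\<^sub>2 y y' = {}"
    using assms by (auto simp: rect_def)
  ultimately show ?thesis unfolding contiguous_def by (auto simp: lattice_simply_connected_rect)
qed

lemma contiguous_commute: "contiguous A B \<Longrightarrow> contiguous B A"
  unfolding contiguous_def by (simp add: Int_commute Un_commute)

text \<open>An edge on both boundaries would join a site of \<open>A\<close> to one of
  \<open>C\<close>, but an edge changes the first coordinate by at most one.\<close>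

lemma bd_Int_distant:
  assumes "\<And>u w. u \<in> A \<Longrightarrow> w \<in> C \<Longrightarrow> fst u + 1 < fst w"
  shows "bd A \<inter> bd C = {}"
proof (rule equals0I)
  fix e assume "e \<in> bd A \<inter> bd C"
  then obtain u w where e: "e \<in> edges" "u \<in> e" "u \<in> A" "w \<in> e" "w \<in> C" by (auto simp: bd_def)
  obtain k where k: "k < 4" "e = leg u k" using edge_eq_leg[OF e(1,2)] by auto
  consider "k = 0" | "k = 1" | "k = 2" | "k = 3" using k(1) by linarith
  then have "fst (nbr u k) \<le> fst u + 1" by cases (cases u; simp add: nbr_def)+
  then have "fst w \<le> fst u + 1" using e(4) k(2) by (auto simp: leg_def)
  then show False using assms[OF e(3,5)] by simp
qed

text \<open>These edges are vertical, in columns of the middle rectangle, with exactly one end in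
  it; the outer rectangles have no site in those columns.\<close>

lemma row_cut_subset_bd:
  assumes "x\<^sub>1 \<le> s" "t \<le> x\<^sub>2" "y < y'" "v = y \<or> v = y'"
  shows "row_cut v s t \<subseteq> bd (rect x\<^sub>1 x\<^sub>2 y y') - bd (rect x\<^sub>0 x\<^sub>1 y y') - bd (rect x\<^sub>2 x\<^sub>3 y y')"
proof
  fix e assume "e \<in> row_cut v s t"
  then obtain u where u: "s \<le> u" "u < t" "e = {(u, v - 1), (u, v)}" by (auto simp: row_cut_def)
  have "e \<in> edges" using edges_vertical[of u "v - 1"] u(3) by simp
  then show "e \<in> bd (rect x\<^sub>1 x\<^sub>2 y y') - bd (rect x\<^sub>0 x\<^sub>1 y y') - bd (rect x\<^sub>2 x\<^sub>3 y y')"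
    using assms u by (auto simp: bd_def rect_def)
qed

lemma three_rectangles_geometry:
  assumes "three_rectangles l A B C B\<^sub>L z B\<^sub>R"
  shows "contiguous A B" "contiguous C B" "A \<inter> C = {}" "bd A \<inter> bd C = {}"
    and "B\<^sub>L \<union> z \<union> B\<^sub>R \<subseteq> bd B - bd A - bd C"
proof -
  obtain x\<^sub>0 x\<^sub>1 x\<^sub>2 x\<^sub>3 y y' s t s' t' where h: "0 < l" "x\<^sub>0 < x\<^sub>1" "x\<^sub>1 < x\<^sub>2" "x\<^sub>2 < x\<^sub>3" "y < y'" "3 * l \<le> x\<^sub>2 - x\<^sub>1"
      "l \<le> s - x\<^sub>1" "l \<le> t - s" "l \<le> x\<^sub>2 - t" "l \<le> s' - x\<^sub>1" "l \<le> t' - s'" "l \<le> x\<^sub>2 - t'"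
    and ABC: "A = rect x\<^sub>0 x\<^sub>1 y y'" "B = rect x\<^sub>1 x\<^sub>2 y y'" "C = rect x\<^sub>2 x\<^sub>3 y y'"
    and parts: "B\<^sub>L = row_cut y x\<^sub>1 s \<union> row_cut y' x\<^sub>1 s'" "z = row_cut y s t \<union> row_cut y' s' t'"
      "B\<^sub>R = row_cut y t x\<^sub>2 \<union> row_cut y' t' x\<^sub>2"
    using assms unfolding three_rectangles_def by blast
  show "contiguous A B" "contiguous C B"
    unfolding ABC using h by (auto intro!: contiguous_rect contiguous_commute[OF contiguous_rect])
  show "A \<inter> C = {}" using h by (auto simp: ABC rect_def)
  show "bd A \<inter> bd C = {}"
    by (rule bd_Int_distant) (use h in \<open>auto simp: ABC rect_def\<close>)
  show "B\<^sub>L \<union> z \<union> B\<^sub>R \<subseteq> bd B - bd A - bd C"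
    unfolding parts ABC using h by (intro Un_least row_cut_subset_bd) auto
qed

section \<open>Maps with spectator sites\<close>

abbreviation idtens :: "'c set \<Rightarrow> 'j set \<Rightarrow> ('j, 'j) kernel \<Rightarrow> ('c \<times> 'j, 'c \<times> 'j) kernel" where
  "idtens C J \<equiv> tens (second_factor C J) (second_factor C J)"

lemma idtens_mm: "finite C \<Longrightarrow> mm (C \<times> J) (idtens C J M) (idtens C J N) = idtens C J (mm J M N)"
  using tens_mm[OF factorizes_second_factor, of C "second_factor C J" J M "second_factor C J" N]
  by (simp add: second_factor_def mem_Times_iff)

lemma id_tensor_eq_idtens:
  assumes "M \<in> ops J J"
  shows "id_tensor C M = idtens C J M"
  using assms by (auto simp: id_tensor_def tens_def second_factor_def idm_def ops_def fun_eq_iff)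

text \<open>Spectators added first over \<open>A\<close> and then over \<open>C\<close> amount to
  spectators over \<open>A \<union> C\<close>, since a configuration there is determined by its two
  restrictions.\<close>

lemma tens_split_cfg_assoc:
  "tens (split_cfg (A \<union> B) C) (split_fst A C J) (tens (split_cfg B A) (second_factor (cfg A) J) M)
    = tens (split_cfg B (A \<union> C)) (second_factor (cfg (A \<union> C)) J) M"
proof (intro ext)
  fix s and qy :: "('a \<Rightarrow> 'b) \<times> 'c"
  obtain q y where qy: "qy = (q, y)" by (cases qy)
  have 1: "restrict s (A \<union> C) = q \<longleftrightarrow> restrict s C = restrict q C \<and> restrict s A = restrict q A"
    if "q \<in> cfg (A \<union> C)"
  proof
    assume "restrict s C = restrict q C \<and> restrict s A = restrict q A"
    then show "restrict s (A \<union> C) = q"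
      by (intro cfg_eqI[OF restrict_cfg that]) (auto simp: restrict_eq_iff)
  next
    assume "restrict s (A \<union> C) = q"
    then show "restrict s C = restrict q C \<and> restrict s A = restrict q A"
      by (auto simp: restrict_eq_iff)
  qed
  have 2: "(A \<union> B) \<inter> A = A" "(A \<union> B) \<inter> B = B" "A \<union> B \<union> C = B \<union> (A \<union> C)" "B \<union> A = A \<union> B" by auto
  show "tens (split_cfg (A \<union> B) C) (split_fst A C J) (tens (split_cfg B A) (second_factor (cfg A) J) M) s qy
    = tens (split_cfg B (A \<union> C)) (second_factor (cfg (A \<union> C)) J) M s qy"
    unfolding qy tens_def split_cfg_def split_fst_def second_factor_def
    by (auto simp: 1 2)
qed

lemma tens_split_fst_assoc:
  "tens (split_fst A C J) (split_fst A C J) (idtens (cfg A) J M) = idtens (cfg (A \<union> C)) J M"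
proof (intro ext)
  fix pu qy :: "('a \<Rightarrow> 'b) \<times> 'c"
  obtain p u q y where eq: "pu = (p, u)" "qy = (q, y)" by (cases pu, cases qy)
  have "p = q \<longleftrightarrow> restrict p C = restrict q C \<and> restrict p A = restrict q A"
    if "p \<in> cfg (A \<union> C)" "q \<in> cfg (A \<union> C)"
    using that by (auto simp: restrict_eq_iff intro: cfg_eqI)
  then show "tens (split_fst A C J) (split_fst A C J) (idtens (cfg A) J M) pu qy = idtens (cfg (A \<union> C)) J M pu qy"
    unfolding eq tens_def split_fst_def second_factor_def by auto
qed

text \<open>\<open>peps_map\<close> of \<open>R\<close> tensored with the identity on the sites of
  \<open>C\<close>. With complementary \<open>C\<close>, the maps of different regions share one
  site space.\<close>

definition site_map :: "('p::finite, 'b::finite) peps \<Rightarrow> vertex set \<Rightarrow> vertex set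
    \<Rightarrow> (vertex \<Rightarrow> 'p, (vertex \<Rightarrow> 'p) \<times> (edge \<Rightarrow> 'b)) kernel" where
  "site_map T R C = tens (split_cfg R C) (second_factor (cfg C) (cfg (bd R))) (peps_map T R)"

definition transfer_map :: "('p::finite, 'b::finite) peps \<Rightarrow> vertex set \<Rightarrow> vertex set \<Rightarrow> vertex set
    \<Rightarrow> ((vertex \<Rightarrow> 'p) \<times> (edge \<Rightarrow> 'b), (vertex \<Rightarrow> 'p) \<times> (edge \<Rightarrow> 'b)) kernel" where
  "transfer_map T A B C = tens (split_fst A C (cfg (bd B))) (second_factor (cfg C) (cfg (bd (A \<union> B)))) (vhat_ext T A B)"

text \<open>\<open>peps_map_Un\<close> tensored with the identity on \<open>C\<close>; from the
  viewpoint of \<open>B\<close> the spectators are then \<open>A \<union> C\<close>.\<close>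

lemma site_map_Un:
  assumes "finite A" "finite B" "finite C" "A \<inter> B = {}" "A \<inter> C = {}"
  shows "site_map T (A \<union> B) C = mm (cfg (A \<union> C) \<times> cfg (bd B)) (site_map T B (A \<union> C)) (transfer_map T A B C)"
proof -
  have "site_map T (A \<union> B) C = mm (fst (split_fst A C (cfg (bd B))))
      (tens (split_cfg (A \<union> B) C) (split_fst A C (cfg (bd B)))
        (tens (split_cfg B A) (second_factor (cfg A) (cfg (bd B))) (peps_map T B)))
      (transfer_map T A B C)"
    unfolding transfer_map_def site_map_def peps_map_Un[OF assms(1,2,4)]
    by (rule tens_mm[OF factorizes_split_fst[OF assms(5)], symmetric])
      (use assms(3) in \<open>auto simp: split_cfg_def\<close>)
  then show ?thesis unfolding tens_split_cfg_assoc by (simp add: split_fst_def site_map_def)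
qed

text \<open>Tensoring with the identity on \<open>C\<close> respects products. The lemma serves both
  pulling through and the commutation with local boundary operators.\<close>

lemma transfer_map_intertwine:
  assumes fin: "finite C" and dis: "A \<inter> C = {}"
    and eq: "mm (cfg A \<times> cfg (bd B)) (idtens (cfg A) (cfg (bd B)) M) (vhat_ext T A B)
      = mm (cfg (bd (A \<union> B))) (vhat_ext T A B) N"
  shows "mm (cfg (A \<union> C) \<times> cfg (bd B)) (idtens (cfg (A \<union> C)) (cfg (bd B)) M) (transfer_map T A B C)
    = mm (cfg C \<times> cfg (bd (A \<union> B))) (transfer_map T A B C) (idtens (cfg C) (cfg (bd (A \<union> B))) N)"
proof -
  let ?a = "split_fst A C (cfg (bd B))" and ?b = "second_factor (cfg C) (cfg (bd (A \<union> B)))"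
  have "mm (fst ?a) (tens ?a ?a (idtens (cfg A) (cfg (bd B)) M)) (tens ?a ?b (vhat_ext T A B))
     = mm (fst ?b) (tens ?a ?b (vhat_ext T A B)) (tens ?b ?b N)"
    using fin tens_mm[OF factorizes_split_fst[OF dis, of "cfg (bd B)"], of ?a "idtens (cfg A) (cfg (bd B)) M" ?b "vhat_ext T A B"]
      tens_mm[OF factorizes_second_factor[of "cfg C" "cfg (bd (A \<union> B))"], of ?a "vhat_ext T A B" ?b N]
    unfolding eq by (simp add: split_fst_def case_prod_beta)
  then show ?thesis
    unfolding tens_split_fst_assoc transfer_map_def by (simp add: split_fst_def second_factor_def)
qed

section \<open>Inverses of the local factors and estimates for one region\<close>

lemma opinv_eqI:
  assumes "finite I" "X \<in> ops I I" "mm I M X = idm I" "mm I X M = idm I"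
  shows "opinv I M = X"
  unfolding opinv_def
proof (rule the_equality)
  fix Y assume Y: "Y \<in> ops I I \<and> mm I M Y = idm I \<and> mm I Y M = idm I"
  have "Y = mm I (mm I X M) Y" using assms(1,4) Y by (simp add: mm_idm_left[where J = I])
  also have "\<dots> = X" using assms(1,2) Y by (simp add: mm_assoc mm_idm_right)
  finally show "Y = X" .
qed (use assms in simp)

text \<open>The commutation with \<open>\<sigma>\<close> is multiplied by the inverse
  \<open>s\<close> on both sides.\<close>

lemma commute_opinv:
  assumes "finite I" "J \<in> ops I I" "s \<in> ops I I" "mm I \<sigma> s = idm I" "mm I s \<sigma> = idm I"
    and "mm I J \<sigma> = mm I \<sigma> J"
  shows "mm I J s = mm I s J"
proof -
  have ops: "mm I J s \<in> ops I I" "mm I s J \<in> ops I I" using assms(2,3) by blast+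
  have "mm I J s = mm I (mm I s \<sigma>) (mm I J s)"
    unfolding assms(5) by (rule mm_idm_left[OF assms(1) ops(1), symmetric])
  also have "\<dots> = mm I s (mm I (mm I \<sigma> J) s)" by (simp add: mm_assoc)
  also have "\<dots> = mm I (mm I s J) (mm I \<sigma> s)" by (simp add: assms(6)[symmetric] mm_assoc)
  also have "\<dots> = mm I s J" unfolding assms(4) by (rule mm_idm_right[OF assms(1) ops(2)])
  finally show ?thesis .
qed

lemma mm_ext_ext_inverse:
  fixes X X' Y Y' :: "('s \<Rightarrow> 'n::finite, 's \<Rightarrow> 'n) kernel"
  assumes E: "E \<subseteq> R" "F \<subseteq> R" and fin: "finite R"
    and "mm (cfg E) X X' = idm (cfg E)" "mm (cfg F) Y Y' = idm (cfg F)"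
  shows "mm (cfg R) (mm (cfg R) (ext E R X) (ext F R Y)) (mm (cfg R) (ext F R Y') (ext E R X')) = idm (cfg R)"
proof -
  have "mm (cfg R) (mm (cfg R) (ext E R X) (ext F R Y)) (mm (cfg R) (ext F R Y') (ext E R X'))
      = mm (cfg R) (ext E R X) (mm (cfg R) (mm (cfg R) (ext F R Y) (ext F R Y')) (ext E R X'))"
    by (simp add: mm_assoc)
  also have "\<dots> = mm (cfg R) (ext E R X) (ext E R X')"
    using assms by (simp add: mm_ext ext_idm mm_idm_left[OF _ ext_ops])
  finally show ?thesis using assms by (simp add: mm_ext ext_idm)
qed

lemma invertible_op_obtain:
  assumes "invertible_op I I M"
  obtains X where "X \<in> ops I I" "mm I M X = idm I" "mm I X M = idm I"
  using assms unfolding invertible_op_def by blast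

text \<open>All factors carry the same spectators, so \<open>tens_mm\<close> multiplies them out.
  This brings the approximate projector of one region to the sites of the union.\<close>

lemma ext_site_map_sandwich:
  assumes fin: "finite R" "finite C" and dis: "R \<inter> C = {}"
  shows "ext R (R \<union> C) (mm (cfg (bd R)) (peps_map T R) (mm (cfg (bd R)) s (adj (peps_map T R)))) =
    mm (cfg C \<times> cfg (bd R)) (site_map T R C)
      (mm (cfg C \<times> cfg (bd R)) (idtens (cfg C) (cfg (bd R)) s) (adj (site_map T R C)))"
proof -
  let ?a = "split_cfg R C" and ?b = "second_factor (cfg C) (cfg (bd R))"
  have eq: "R \<union> C - R = C" using dis by auto
  have b: "\<And>i. i \<in> fst ?b \<Longrightarrow> snd (snd ?b) i \<in> cfg C" "\<And>i. i \<in> fst ?a \<Longrightarrow> snd (snd ?a) i \<in> cfg C"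
    by (auto simp: second_factor_def split_cfg_def)
  have 1: "mm (fst ?b) (tens ?b ?b s) (tens ?b ?a (adj (peps_map T R))) = tens ?b ?a (mm (cfg (bd R)) s (adj (peps_map T R)))"
    using fin by (intro tens_mm[OF factorizes_second_factor]) (simp_all add: b)
  have 2: "mm (fst ?b) (tens ?a ?b (peps_map T R)) (tens ?b ?a M) = tens ?a ?a (mm (cfg (bd R)) (peps_map T R) M)" for M
    using fin by (intro tens_mm[OF factorizes_second_factor]) (simp_all add: b)
  have f: "fst ?b = cfg C \<times> cfg (bd R)" by (simp add: second_factor_def)
  show ?thesis
    unfolding site_map_def adj_tens f[symmetric] 1 2 by (simp add: ext_eq_tens eq)
qed

text \<open>All consequences of the approximation hypothesis for one region. \<open>J\<close>
  commutes with \<open>\<sigma>\<close>, hence with \<open>s\<close> and \<open>adj s\<close>, and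
  is absorbed by the adjoint of the PEPS map. Both versions are needed, as the left factor of the
  product enters through its adjoint.\<close>

lemma region_estimates:
  fixes T :: "('p::finite, 'b::finite) peps"
  assumes fin: "finite R" and approx: "approximates_bd_state T \<epsilon> R \<sigma>"
    and s: "s \<in> ops (cfg (bd R)) (cfg (bd R))" "mm (cfg (bd R)) \<sigma> s = idm (cfg (bd R))"
      "mm (cfg (bd R)) s \<sigma> = idm (cfg (bd R))"
  shows "0 \<le> \<epsilon>"
    and "opbound (cfg R) (cfg R) (mdiff (mm (cfg (bd R)) (peps_map T R) (mm (cfg (bd R)) s (adj (peps_map T R))))
      (image_proj T R)) \<epsilon>"
    and "opbound (cfg R) (cfg R) (image_proj T R) 1"
    and "mm (cfg (bd R)) (bd_proj T R) (mm (cfg (bd R)) s (adj (peps_map T R))) = mm (cfg (bd R)) s (adj (peps_map T R))"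
    and "mm (cfg (bd R)) (bd_proj T R) (mm (cfg (bd R)) (adj s) (adj (peps_map T R)))
      = mm (cfg (bd R)) (adj s) (adj (peps_map T R))"
proof -
  let ?I = "cfg (bd R)" and ?V = "peps_map T R" and ?J = "bd_proj T R"
  have finc: "finite (cfg R :: (vertex \<Rightarrow> 'p) set)" "finite (cfg (bd R) :: (edge \<Rightarrow> 'b) set)"
    using fin by simp_all
  note g = gram_facts[OF finc peps_map_ops[of T R]]
  have J: "?J = supp_proj ?I (mm (cfg R) (adj ?V) ?V)" by (simp add: bd_proj_def bd_state_def)
  let ?r = "opsqrt ?I (mm (cfg R) (adj ?V) ?V)"
  have comm: "mm ?I ?J \<sigma> = mm ?I \<sigma> ?J"
    and le: "opnorm ?I ?I (mdiff (mm ?I ?r (mm ?I s ?r)) ?J) \<le> \<epsilon>"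
    using approx opinv_eqI[OF finc(2) s] unfolding approximates_bd_state_def Let_def bd_state_def by auto
  show \<epsilon>: "0 \<le> \<epsilon>" using opnorm_nonneg[OF finc(2,2)] le by (rule order_trans)
  have "opbound ?I ?I (mdiff (mm ?I ?r (mm ?I s ?r)) ?J) \<epsilon>"
    using opbound_opnorm[OF finc(2,2)] le by (rule opbound_mono)
  then show "opbound (cfg R) (cfg R) (mdiff (mm ?I ?V (mm ?I s (adj ?V))) (image_proj T R)) \<epsilon>"
    unfolding image_proj_def J using gram_approximate_projector[OF finc peps_map_ops] \<epsilon> by blast
  show "opbound (cfg R) (cfg R) (image_proj T R) 1"
    unfolding image_proj_def by (rule opbound_projector[OF g(14)])
  have Jp: "?J \<in> ops ?I ?I" "adj ?J = ?J" using g(4) unfolding J is_projector_def by auto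
  have JV: "mm ?I ?J (adj ?V) = adj ?V"
    using arg_cong[OF g(13), of adj] unfolding J[symmetric] by (simp add: adj_mm Jp)
  have Js: "mm ?I ?J s = mm ?I s ?J" by (rule commute_opinv[OF finc(2) Jp(1) s comm])
  have Js': "mm ?I ?J (adj s) = mm ?I (adj s) ?J"
    using arg_cong[OF Js, of adj] by (simp add: adj_mm Jp)
  show "mm ?I ?J (mm ?I s (adj ?V)) = mm ?I s (adj ?V)"
    by (simp only: mm_assoc[symmetric] Js) (simp only: mm_assoc JV)
  show "mm ?I ?J (mm ?I (adj s) (adj ?V)) = mm ?I (adj s) (adj ?V)"
    by (simp only: mm_assoc[symmetric] Js') (simp only: mm_assoc JV)
qed

lemma idtens_site_map:
  assumes fin: "finite C"
    and "mm (cfg (bd R)) J (mm (cfg (bd R)) s (adj (peps_map T R))) = mm (cfg (bd R)) s (adj (peps_map T R))"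
  defines "K \<equiv> cfg C \<times> cfg (bd R)"
  shows "mm K (idtens (cfg C) (cfg (bd R)) J) (mm K (idtens (cfg C) (cfg (bd R)) s) (adj (site_map T R C)))
    = mm K (idtens (cfg C) (cfg (bd R)) s) (adj (site_map T R C))"
proof -
  let ?a = "split_cfg R C" and ?b = "second_factor (cfg C) (cfg (bd R))"
  have b: "\<And>i. i \<in> fst ?b \<Longrightarrow> snd (snd ?b) i \<in> cfg C" by (auto simp: second_factor_def)
  have t: "mm (fst ?b) (tens ?b ?b L) (tens ?b ?a M) = tens ?b ?a (mm (cfg (bd R)) L M)" for L M
    using fin by (intro tens_mm[OF factorizes_second_factor]) (simp_all add: b)
  have K: "K = fst ?b" by (simp add: K_def second_factor_def)
  show ?thesis unfolding K site_map_def adj_tens t assms(2) ..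
qed

text \<open>Pulling through with spectator sites. \<open>id_tensor\<close> and \<open>idtens\<close>
  agree on kernels vanishing off the index set, which holds for the boundary projector.\<close>

lemma bd_proj_transfer_map:
  fixes T :: "('p::finite, 'b::finite) peps"
  assumes "pulling_through T" "contiguous A B" "finite C" "A \<inter> C = {}"
  shows "mm (cfg (A \<union> C) \<times> cfg (bd B)) (idtens (cfg (A \<union> C)) (cfg (bd B)) (bd_proj T B)) (transfer_map T A B C)
    = mm (cfg C \<times> cfg (bd (A \<union> B))) (transfer_map T A B C) (idtens (cfg C) (cfg (bd (A \<union> B))) (bd_proj T (A \<union> B)))"
proof (rule transfer_map_intertwine[OF assms(3,4)])
  have finB: "finite B" using assms(2) by (simp add: contiguous_def)
  then have "is_projector (cfg (bd B)) (bd_proj T B)"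
    using gram_facts(4)[OF _ _ peps_map_ops[of T B]] by (simp add: bd_proj_def bd_state_def)
  then show "mm (cfg A \<times> cfg (bd B)) (idtens (cfg A) (cfg (bd B)) (bd_proj T B)) (vhat_ext T A B)
      = mm (cfg (bd (A \<union> B))) (vhat_ext T A B) (bd_proj T (A \<union> B))"
    using assms(1,2) id_tensor_eq_idtens[of "bd_proj T B" "cfg (bd B)" "cfg A"]
    unfolding pulling_through_def is_projector_def by metis
qed

lemma ext_transfer_map:
  assumes "finite A" "finite B" "finite C" "A \<inter> B = {}" "A \<inter> C = {}" "E \<subseteq> bd B - bd A"
  shows "mm (cfg (A \<union> C) \<times> cfg (bd B)) (idtens (cfg (A \<union> C)) (cfg (bd B)) (ext E (bd B) K)) (transfer_map T A B C)
    = mm (cfg C \<times> cfg (bd (A \<union> B))) (transfer_map T A B C)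
        (idtens (cfg C) (cfg (bd (A \<union> B))) (ext E (bd (A \<union> B)) K))"
  using assms by (intro transfer_map_intertwine vhat_ext_mm_ext[symmetric])

text \<open>The map of \<open>ABC\<close> is written through \<open>AB\<close> on the left and
  through \<open>BC\<close> on the right. \<open>X1\<close> moves left past \<open>?G2\<close>,
  \<open>X2\<close> right past the adjoint of \<open>?G1\<close>, and the exchange lemma moves the
  junction to the boundary of \<open>B\<close>. There \<open>W' (W U) U' = 1\<close> is inserted,
  and \<open>W'\<close>, \<open>U'\<close> move outwards to complete the inverses for
  \<open>AB\<close> and \<open>BC\<close>.\<close>

lemma boundary_factorization:
  fixes T :: "('p::finite, 'b::finite) peps"
  assumes fin: "finite A" "finite B" "finite C"
    and dis: "A \<inter> B = {}" "B \<inter> C = {}" "A \<inter> C = {}" and AC: "bd A \<inter> bd C = {}"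
    and az: "az \<subseteq> bd (A \<union> B) - bd C" and zb: "zb \<subseteq> bd (B \<union> C) - bd A"
    and zc: "zc \<subseteq> bd B - bd A" and dz: "dz \<subseteq> bd B - bd C"
    and X: "mm (cfg zc) W' W = idm (cfg zc)" "mm (cfg dz) U U' = idm (cfg dz)"
  defines "K0 \<equiv> cfg (A \<union> C) \<times> cfg (bd B)" and "K1 \<equiv> cfg C \<times> cfg (bd (A \<union> B))" and "K2 \<equiv> cfg A \<times> cfg (bd (B \<union> C))"
  shows "mm (cfg (bd (A \<union> B \<union> C))) (peps_map T (A \<union> B \<union> C))
      (mm (cfg (bd (A \<union> B \<union> C)))
        (mm (cfg (bd (A \<union> B \<union> C))) (ext az (bd (A \<union> B \<union> C)) X1) (ext zb (bd (A \<union> B \<union> C)) X2))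
        (adj (peps_map T (A \<union> B \<union> C))))
    = mm K1 (site_map T (A \<union> B) C) (mm K1
        (idtens (cfg C) (cfg (bd (A \<union> B))) (mm (cfg (bd (A \<union> B))) (ext az (bd (A \<union> B)) X1) (ext zc (bd (A \<union> B)) W')))
        (mm K0 (adj (transfer_map T A B C)) (mm K0
          (idtens (cfg (A \<union> C)) (cfg (bd B)) (mm (cfg (bd B)) (ext zc (bd B) W) (ext dz (bd B) U)))
          (mm K2 (transfer_map T C B A) (mm K2
            (idtens (cfg A) (cfg (bd (B \<union> C))) (mm (cfg (bd (B \<union> C))) (ext dz (bd (B \<union> C)) U') (ext zb (bd (B \<union> C)) X2)))
            (adj (site_map T (B \<union> C) A)))))))"
proof -
  let ?R = "bd (A \<union> B \<union> C)" and ?AB = "bd (A \<union> B)" and ?BC = "bd (B \<union> C)"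
  have eqs: "C \<union> (A \<union> B) = A \<union> B \<union> C" "A \<union> (B \<union> C) = A \<union> B \<union> C" "C \<union> B = B \<union> C" "C \<union> A = A \<union> C" by auto
  have dis': "C \<inter> (A \<union> B) = {}" "A \<inter> (B \<union> C) = {}" "C \<inter> B = {}" "C \<inter> A = {}" using dis by auto
  let ?V = "peps_map T (A \<union> B \<union> C)"
  let ?V1 = "site_map T (A \<union> B) C" and ?V2 = "site_map T (B \<union> C) A"
  let ?G1 = "vhat_ext T A (B \<union> C)" and ?G2 = "vhat_ext T C (A \<union> B)"
  let ?F1 = "transfer_map T A B C" and ?F2 = "transfer_map T C B A"
  let ?L1 = "idtens (cfg C) (cfg ?AB)" and ?L2 = "idtens (cfg A) (cfg ?BC)" and ?L0 = "idtens (cfg (A \<union> C)) (cfg (bd B))"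
  have finc: "finite (cfg (A \<union> C) :: (vertex \<Rightarrow> 'p) set)" "finite (cfg C :: (vertex \<Rightarrow> 'p) set)"
    "finite (cfg A :: (vertex \<Rightarrow> 'p) set)" using fin by simp_all
  have VG: "?V = mm K1 ?V1 ?G2" "?V = mm K2 ?V2 ?G1"
    using peps_map_Un[of C "A \<union> B" T] peps_map_Un[of A "B \<union> C" T] fin dis'
    by (simp_all add: eqs site_map_def K1_def K2_def)
  have G2: "mm (cfg ?R) ?G2 (ext az ?R X1) = mm K1 (?L1 (ext az ?AB X1)) ?G2"
    using vhat_ext_mm_ext[of C "A \<union> B" az T X1] fin dis'(1) az by (simp add: eqs K1_def)
  \<comment> \<open>The commutation rule holds for operators to the right of \<open>?G1\<close>; the
    rule for its adjoint follows from the case \<open>adj X2\<close>. The same device is used for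
    \<open>?F1\<close> below.\<close>
  have "mm (cfg ?R) ?G1 (ext zb ?R (adj X2)) = mm K2 (?L2 (ext zb ?BC (adj X2))) ?G1"
    using vhat_ext_mm_ext[of A "B \<union> C" zb T "adj X2"] fin dis'(2) zb by (simp add: eqs K2_def)
  from arg_cong[OF this, of adj]
  have G1: "mm (cfg ?R) (ext zb ?R X2) (adj ?G1) = mm K2 (adj ?G1) (?L2 (ext zb ?BC X2))"
    by (simp add: adj_mm adj_ext adj_tens)
  have GG: "mm (cfg ?R) ?G2 (adj ?G1) = mm K0 (adj ?F1) ?F2"
    unfolding transfer_map_def K0_def eqs(3) by (rule vhat_ext_exchange[OF fin dis AC])
  have "mm K0 (?L0 (ext zc (bd B) (adj W'))) ?F1 = mm K1 ?F1 (?L1 (ext zc ?AB (adj W')))"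
    unfolding K0_def K1_def by (rule ext_transfer_map[OF fin dis(1,3) zc])
  from arg_cong[OF this, of adj]
  have F1: "mm K1 (?L1 (ext zc ?AB W')) (adj ?F1) = mm K0 (adj ?F1) (?L0 (ext zc (bd B) W'))"
    by (simp add: adj_mm adj_ext adj_tens)
  have F2: "mm K2 ?F2 (?L2 (ext dz ?BC U')) = mm K0 (?L0 (ext dz (bd B) U')) ?F2"
    using ext_transfer_map[OF fin(3,2,1) dis'(3,4) dz, of U' T] by (simp add: K0_def K2_def eqs)
  let ?\<sigma> = "mm (cfg (bd B)) (ext zc (bd B) W) (ext dz (bd B) U)"
  have L1: "?L1 (mm (cfg ?AB) M N) = mm K1 (?L1 M) (?L1 N)" for M N
    unfolding K1_def using idtens_mm[OF finc(2)] by metis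
  have L2: "?L2 (mm (cfg ?BC) M N) = mm K2 (?L2 M) (?L2 N)" for M N
    unfolding K2_def using idtens_mm[OF finc(3)] by metis
  have L0: "mm K0 (?L0 M) (?L0 N) = ?L0 (mm (cfg (bd B)) M N)" for M N
    unfolding K0_def using idtens_mm[OF finc(1)] by metis
  have "mm (cfg (bd B)) (ext zc (bd B) W') (mm (cfg (bd B)) ?\<sigma> (ext dz (bd B) U')) = idm (cfg (bd B))"
  proof -
    have "mm (cfg (bd B)) (ext zc (bd B) W') (mm (cfg (bd B)) ?\<sigma> (ext dz (bd B) U'))
      = mm (cfg (bd B)) (mm (cfg (bd B)) (ext zc (bd B) W') (ext zc (bd B) W))
          (mm (cfg (bd B)) (ext dz (bd B) U) (ext dz (bd B) U'))"
      by (simp only: mm_assoc)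
    also have "\<dots> = mm (cfg (bd B)) (idm (cfg (bd B))) (idm (cfg (bd B)))"
    proof -
      have s: "zc \<subseteq> bd B" "dz \<subseteq> bd B" "finite (bd B)" using zc dz fin by auto
      show ?thesis by (simp only: mm_ext[OF s(1,3)] mm_ext[OF s(2,3)] X ext_idm[OF s(1)] ext_idm[OF s(2)])
    qed
    finally show ?thesis using fin by (simp add: mm_idm_left[OF _ ops_idm])
  qed
  then have "mm K0 (?L0 (ext zc (bd B) W')) (mm K0 (?L0 ?\<sigma>) (?L0 (ext dz (bd B) U'))) = idm K0"
    unfolding L0 using tens_idm[OF factorizes_second_factor[of "cfg (A \<union> C)" "cfg (bd B)"]]
    by (simp add: second_factor_def K0_def)
  moreover have "mm K0 (idm K0) ?F2 = ?F2"
  proof (rule mm_idm_left)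
    show "finite K0" unfolding K0_def using fin by simp
    show "?F2 \<in> ops K0 K2"
      using ops_tens[of "split_fst C A (cfg (bd B))" "second_factor (cfg A) (cfg (bd (C \<union> B)))"]
      by (simp add: transfer_map_def split_fst_def second_factor_def K0_def K2_def eqs)
  qed
  ultimately have mid: "mm K0 (?L0 (ext zc (bd B) W')) (mm K0 (?L0 ?\<sigma>) (mm K0 (?L0 (ext dz (bd B) U')) ?F2)) = ?F2"
    by (simp only: mm_assoc[symmetric])
  let ?Z = "mm K2 (?L2 (ext zb ?BC X2)) (adj ?V2)"
  have VX1: "mm (cfg ?R) ?V (ext az ?R X1) = mm K1 ?V1 (mm K1 (?L1 (ext az ?AB X1)) ?G2)"
    unfolding VG(1) by (simp only: mm_assoc G2)
  have VX2: "mm (cfg ?R) (ext zb ?R X2) (adj ?V) = mm K2 (adj ?G1) ?Z"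
  proof -
    have "mm (cfg ?R) (ext zb ?R X2) (adj ?V) = mm K2 (mm (cfg ?R) (ext zb ?R X2) (adj ?G1)) (adj ?V2)"
      unfolding VG(2) by (simp only: adj_mm mm_assoc)
    then show ?thesis unfolding G1 by (simp only: mm_assoc)
  qed
  have "mm (cfg ?R) ?V (mm (cfg ?R) (mm (cfg ?R) (ext az ?R X1) (ext zb ?R X2)) (adj ?V))
      = mm (cfg ?R) (mm (cfg ?R) ?V (ext az ?R X1)) (mm (cfg ?R) (ext zb ?R X2) (adj ?V))"
    by (simp only: mm_assoc)
  also have "\<dots> = mm K1 ?V1 (mm K1 (?L1 (ext az ?AB X1)) (mm K2 (mm (cfg ?R) ?G2 (adj ?G1)) ?Z))"
    unfolding VX1 VX2 by (simp only: mm_assoc)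
  also have "mm K2 (mm (cfg ?R) ?G2 (adj ?G1)) ?Z = mm K0 (adj ?F1) (mm K2 ?F2 ?Z)"
    unfolding GG by (simp only: mm_assoc)
  also have "\<dots> = mm K0 (adj ?F1) (mm K2 (mm K0 (?L0 (ext zc (bd B) W')) (mm K0 (?L0 ?\<sigma>) (mm K0 (?L0 (ext dz (bd B) U')) ?F2))) ?Z)"
    unfolding mid ..
  also have "\<dots> = mm K0 (mm K0 (adj ?F1) (?L0 (ext zc (bd B) W'))) (mm K0 (?L0 ?\<sigma>) (mm K2 (mm K0 (?L0 (ext dz (bd B) U')) ?F2) ?Z))"
    by (simp only: mm_assoc)
  also have "\<dots> = mm K1 (?L1 (ext zc ?AB W')) (mm K0 (adj ?F1) (mm K0 (?L0 ?\<sigma>) (mm K2 ?F2 (mm K2 (?L2 (ext dz ?BC U')) ?Z))))"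
    unfolding F1[symmetric] F2[symmetric] by (simp only: mm_assoc)
  finally show ?thesis unfolding L1 L2 by (simp only: mm_assoc)
qed

lemma mdiff_ext: "mdiff (ext S R K) (ext S R L) = ext S R (mdiff K L)"
  by (auto simp: mdiff_def ext_def fun_eq_iff)

lemma opbound_idtens: "finite C \<Longrightarrow> opbound J J M c \<Longrightarrow> 0 \<le> c \<Longrightarrow> opbound (C \<times> J) (C \<times> J) (idtens C J M) c"
  using opbound_tens[OF factorizes_second_factor factorizes_second_factor, of C J J M c]
  by (simp add: second_factor_def)

lemma site_map_gram:
  assumes "finite R" "finite C" "R \<inter> C = {}"
  shows "mm (cfg (R \<union> C)) (adj (site_map T R C)) (site_map T R C) = idtens (cfg C) (cfg (bd R)) (bd_state T R)"
proof -
  have "mm (fst (split_cfg R C)) (adj (site_map T R C)) (site_map T R C) = idtens (cfg C) (cfg (bd R)) (bd_state T R)"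
    unfolding site_map_def adj_tens bd_state_def
    using assms(2) by (intro tens_mm[OF factorizes_split_cfg[OF assms(3)]]) (auto simp: second_factor_def)
  then show ?thesis by (simp add: split_cfg_def)
qed

theorem mainTheorem4:
  fixes T :: "('p::finite, 'b::finite) peps"
    and A B C :: "vertex set" and B\<^sub>L z B\<^sub>R :: "edge set"
    and l :: int and \<epsilon> :: real
  assumes "mpo_injective T"
    and "pulling_through T"
    and "three_rectangles l A B C B\<^sub>L z B\<^sub>R"
    and "approx_factorizable T \<epsilon> A B C B\<^sub>L z B\<^sub>R"
    and "\<epsilon> \<le> 1"
  shows "opnorm (cfg (A \<union> B \<union> C)) (cfg (A \<union> B \<union> C))
           (mdiff (mm (cfg (A \<union> B \<union> C)) (ext (A \<union> B) (A \<union> B \<union> C) (image_proj T (A \<union> B)))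
                                        (ext (B \<union> C) (A \<union> B \<union> C) (image_proj T (B \<union> C))))
                  (image_proj T (A \<union> B \<union> C)))
         \<le> 8 * \<epsilon>"
proof -
  note geo = three_rectangles_geometry[OF assms(3)]
  have fin: "finite A" "finite B" "finite C" and dis: "A \<inter> B = {}" "B \<inter> C = {}" "A \<inter> C = {}"
    using geo(1-3) by (auto simp: contiguous_def)
  have dis': "(A \<union> B) \<inter> C = {}" "A \<inter> (B \<union> C) = {}" "(B \<union> C) \<inter> A = {}" "C \<inter> A = {}" "C \<inter> B = {}" "B \<inter> (A \<union> C) = {}"
    using dis by auto
  have eqs: "C \<union> B = B \<union> C" "C \<union> A = A \<union> C" "B \<union> C \<union> A = A \<union> B \<union> C" "B \<union> (A \<union> C) = A \<union> B \<union> C" by auto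
  let ?S = "A \<union> B \<union> C"
  let ?R = "bd (A \<union> B \<union> C)" and ?AB = "bd (A \<union> B)" and ?BC = "bd (B \<union> C)"
  define az where "az = (bd A \<inter> ?R) \<union> B\<^sub>L \<union> z"
  define zb where "zb = z \<union> ((bd C \<inter> ?R) \<union> B\<^sub>R)"
  define dz where "dz = (bd A \<inter> bd B) \<union> B\<^sub>L \<union> z"
  define zc where "zc = z \<union> ((bd B \<inter> bd C) \<union> B\<^sub>R)"
  have bAB: "?AB = (bd A - bd B) \<union> (bd B - bd A)" and bBC: "?BC = (bd B - bd C) \<union> (bd C - bd B)"
    using bd_Un dis by blast+
  have bABC: "?R = (bd A - bd B) \<union> (bd B - bd A - bd C) \<union> (bd C - bd B)"
    unfolding bd_Un[OF dis'(1)] bAB using geo(4) by auto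
  \<comment> \<open>Each factor avoids the boundary of the region whose transfer map it has to
    pass.\<close>
  have azs: "az \<subseteq> ?AB - bd C" and zbs: "zb \<subseteq> ?BC - bd A" and zcs: "zc \<subseteq> bd B - bd A" and dzs: "dz \<subseteq> bd B - bd C"
    using geo(4,5) unfolding az_def zb_def zc_def dz_def bAB bBC bABC by auto
  have sub: "az \<subseteq> ?AB" "az \<subseteq> ?R" "zb \<subseteq> ?BC" "zb \<subseteq> ?R" "zc \<subseteq> bd B" "zc \<subseteq> ?AB" "dz \<subseteq> bd B" "dz \<subseteq> ?BC"
    using azs zbs zcs dzs geo(4) unfolding bAB bBC bABC by auto
  have finb: "finite ?AB" "finite ?BC" "finite ?R" "finite (bd B)" using fin by simp_all
  obtain Daz Dzb Wdz Wzc where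
      inv: "invertible_op (cfg az) (cfg az) Daz" "invertible_op (cfg zb) (cfg zb) Dzb"
        "invertible_op (cfg dz) (cfg dz) Wdz" "invertible_op (cfg zc) (cfg zc) Wzc"
    and app: "approximates_bd_state T \<epsilon> ?S (mm (cfg ?R) (ext zb ?R Dzb) (ext az ?R Daz))"
      "approximates_bd_state T \<epsilon> (A \<union> B) (mm (cfg ?AB) (ext zc ?AB Wzc) (ext az ?AB Daz))"
      "approximates_bd_state T \<epsilon> (B \<union> C) (mm (cfg ?BC) (ext zb ?BC Dzb) (ext dz ?BC Wdz))"
      "approximates_bd_state_inv T \<epsilon> B (mm (cfg (bd B)) (ext zc (bd B) Wzc) (ext dz (bd B) Wdz))"
    using assms(4) unfolding approx_factorizable_def Let_def az_def zb_def dz_def zc_def by blast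
  obtain Daz' where Daz: "mm (cfg az) Daz Daz' = idm (cfg az)" "mm (cfg az) Daz' Daz = idm (cfg az)"
    using inv(1) by (rule invertible_op_obtain)
  obtain Dzb' where Dzb: "mm (cfg zb) Dzb Dzb' = idm (cfg zb)" "mm (cfg zb) Dzb' Dzb = idm (cfg zb)"
    using inv(2) by (rule invertible_op_obtain)
  obtain Wdz' where Wdz: "mm (cfg dz) Wdz Wdz' = idm (cfg dz)" "mm (cfg dz) Wdz' Wdz = idm (cfg dz)"
    using inv(3) by (rule invertible_op_obtain)
  obtain Wzc' where Wzc: "mm (cfg zc) Wzc Wzc' = idm (cfg zc)" "mm (cfg zc) Wzc' Wzc = idm (cfg zc)"
    using inv(4) by (rule invertible_op_obtain)
  \<comment> \<open>The inverses of the three approximants: local inverses in reverse order.\<close>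
  let ?sAB = "mm (cfg ?AB) (ext az ?AB Daz') (ext zc ?AB Wzc')"
  let ?sBC = "mm (cfg ?BC) (ext dz ?BC Wdz') (ext zb ?BC Dzb')"
  let ?sABC = "mm (cfg ?R) (ext az ?R Daz') (ext zb ?R Dzb')"
  let ?\<sigma>B = "mm (cfg (bd B)) (ext zc (bd B) Wzc) (ext dz (bd B) Wdz)"
  note AB = region_estimates[OF _ app(2) ops_mm[OF ext_ops ext_ops]
      mm_ext_ext_inverse[OF sub(6,1) finb(1) Wzc(1) Daz(1)] mm_ext_ext_inverse[OF sub(1,6) finb(1) Daz(2) Wzc(2)]]
    and BC = region_estimates[OF _ app(3) ops_mm[OF ext_ops ext_ops]
      mm_ext_ext_inverse[OF sub(3,8) finb(2) Dzb(1) Wdz(1)] mm_ext_ext_inverse[OF sub(8,3) finb(2) Wdz(2) Dzb(2)]]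
    and ABC = region_estimates[OF _ app(1) ops_mm[OF ext_ops ext_ops]
      mm_ext_ext_inverse[OF sub(4,2) finb(3) Dzb(1) Daz(1)] mm_ext_ext_inverse[OF sub(2,4) finb(3) Daz(2) Dzb(2)]]
  have finu: "finite (A \<union> B)" "finite (B \<union> C)" "finite ?S" "finite (A \<union> C)" using fin by auto
  have \<epsilon>0: "0 \<le> \<epsilon>" by (rule AB(1)[OF finu(1)])
  let ?K0 = "cfg (A \<union> C) \<times> cfg (bd B)" and ?K1 = "cfg C \<times> cfg ?AB" and ?K2 = "cfg A \<times> cfg ?BC"
  let ?L1 = "idtens (cfg C) (cfg ?AB)" and ?L2 = "idtens (cfg A) (cfg ?BC)" and ?L0 = "idtens (cfg (A \<union> C)) (cfg (bd B))"
  let ?V0 = "site_map T B (A \<union> C)" and ?V1 = "site_map T (A \<union> B) C" and ?V2 = "site_map T (B \<union> C) A"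
  let ?F1 = "transfer_map T A B C" and ?F2 = "transfer_map T C B A"
  define r where "r = opsqrt (cfg (bd B)) (bd_state T B)"
  define J where "J = bd_proj T B"
  define q where "q = supp_inv (cfg (bd B)) r"
  have g: "r \<in> ops (cfg (bd B)) (cfg (bd B))" "adj r = r" "mm (cfg (bd B)) r r = bd_state T B"
      "is_projector (cfg (bd B)) J" "mm (cfg (bd B)) J r = r" "mm (cfg (bd B)) r q = J" "mm (cfg (bd B)) q r = J"
    using gram_facts(1-5,9,10)[OF _ _ peps_map_ops[of T B]] fin finb
    unfolding r_def J_def q_def bd_proj_def bd_state_def by simp_all
  have L0: "mm ?K0 (?L0 M) (?L0 N) = ?L0 (mm (cfg (bd B)) M N)" for M N
    using finu(4) by (intro idtens_mm) simp
  have "opbound (cfg ?S) (cfg ?S) (mdiff (mm (cfg ?S) (ext (A \<union> B) ?S (image_proj T (A \<union> B)))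
      (ext (B \<union> C) ?S (image_proj T (B \<union> C)))) (image_proj T ?S)) (8 * \<epsilon>)"
  \<comment> \<open>All boundary operators are tensored with the identity on the remaining sites, so
    the three regions share the site space of \<open>?S\<close>.\<close>
  proof (rule product_of_approximate_projectors[where ?K0.0 = ?K0 and ?K1.0 = ?K1 and ?K2.0 = ?K2 and ?V0.0 = ?V0
        and ?V1.0 = ?V1 and ?V2.0 = ?V2 and ?F1.0 = ?F1 and ?F2.0 = ?F2 and ?s1.0 = "?L1 ?sAB" and ?s2.0 = "?L2 ?sBC"
        and \<sigma> = "?L0 ?\<sigma>B" and r = "?L0 r" and J = "?L0 J" and q = "?L0 q"])
    show "?V1 = mm ?K0 ?V0 ?F1" using site_map_Un[OF fin dis(1,3), of T] .
    show "?V2 = mm ?K0 ?V0 ?F2"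
      using site_map_Un[OF fin(3,2,1) dis'(5,4), of T] by (simp add: eqs)
    show "ext (A \<union> B) ?S (mm (cfg ?AB) (peps_map T (A \<union> B)) (mm (cfg ?AB) ?sAB (adj (peps_map T (A \<union> B)))))
        = mm ?K1 ?V1 (mm ?K1 (?L1 ?sAB) (adj ?V1))"
      by (rule ext_site_map_sandwich[OF finu(1) fin(3) dis'(1)])
    show "ext (B \<union> C) ?S (mm (cfg ?BC) (peps_map T (B \<union> C)) (mm (cfg ?BC) ?sBC (adj (peps_map T (B \<union> C)))))
        = mm ?K2 ?V2 (mm ?K2 (?L2 ?sBC) (adj ?V2))"
      using ext_site_map_sandwich[OF finu(2) fin(1) dis'(3)] by (simp add: eqs)
    show "mm (cfg ?R) (peps_map T ?S) (mm (cfg ?R) ?sABC (adj (peps_map T ?S)))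
        = mm ?K1 ?V1 (mm ?K1 (?L1 ?sAB) (mm ?K0 (adj ?F1) (mm ?K0 (?L0 ?\<sigma>B) (mm ?K2 ?F2 (mm ?K2 (?L2 ?sBC) (adj ?V2))))))"
      by (rule boundary_factorization[OF fin dis geo(4) azs zbs zcs dzs Wzc(2) Wdz(1)])
    show "adj (?L0 r) = ?L0 r" "adj (?L0 J) = ?L0 J"
      using g(2,4) by (simp_all add: adj_tens is_projector_def)
    show "mm ?K0 (?L0 r) (?L0 r) = mm (cfg ?S) (adj ?V0) ?V0"
      using site_map_gram[OF fin(2) finu(4) dis'(6), of T] by (simp add: L0 g(3) eqs)
    show "mm ?K0 (?L0 J) (?L0 r) = ?L0 r" "mm ?K0 (?L0 J) (?L0 J) = ?L0 J"
      "mm ?K0 (?L0 r) (?L0 q) = ?L0 J" "mm ?K0 (?L0 q) (?L0 r) = ?L0 J"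
      using g(4) by (simp_all add: L0 g(5-7) is_projector_def)
    \<comment> \<open>\<open>J\<close> passes through the transfer map, becomes the boundary
      projector of the larger region and is absorbed there.\<close>
    have F1: "mm ?K0 (?L0 J) ?F1 = mm ?K1 ?F1 (?L1 (bd_proj T (A \<union> B)))"
      unfolding J_def by (rule bd_proj_transfer_map[OF assms(2) geo(1) fin(3) dis(3)])
    have F2: "mm ?K0 (?L0 J) ?F2 = mm ?K2 ?F2 (?L2 (bd_proj T (B \<union> C)))"
      unfolding J_def using bd_proj_transfer_map[OF assms(2) geo(2) fin(1) dis'(4)] by (simp add: eqs)
    have "mm ?K1 (?L1 (bd_proj T (A \<union> B))) (mm ?K1 (?L1 (adj ?sAB)) (adj ?V1)) = mm ?K1 (?L1 (adj ?sAB)) (adj ?V1)"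
      using AB(5)[OF finu(1)] fin(3) by (intro idtens_site_map) simp_all
    then show "mm ?K0 (?L0 J) (mm ?K1 ?F1 (mm ?K1 (adj (?L1 ?sAB)) (adj ?V1))) = mm ?K1 ?F1 (mm ?K1 (adj (?L1 ?sAB)) (adj ?V1))"
      unfolding mm_assoc[of ?K1 ?K0, symmetric] adj_tens by (simp only: F1) (simp only: mm_assoc)
    have "mm ?K2 (?L2 (bd_proj T (B \<union> C))) (mm ?K2 (?L2 ?sBC) (adj ?V2)) = mm ?K2 (?L2 ?sBC) (adj ?V2)"
      using BC(4)[OF finu(2)] fin(1) by (intro idtens_site_map) simp_all
    then show "mm ?K0 (?L0 J) (mm ?K2 ?F2 (mm ?K2 (?L2 ?sBC) (adj ?V2))) = mm ?K2 ?F2 (mm ?K2 (?L2 ?sBC) (adj ?V2))"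
      unfolding mm_assoc[of ?K2 ?K0, symmetric] by (simp only: F2) (simp only: mm_assoc)
    have "opnorm (cfg (bd B)) (cfg (bd B)) (mdiff (mm (cfg (bd B)) q (mm (cfg (bd B)) J (mm (cfg (bd B)) ?\<sigma>B (mm (cfg (bd B)) J q)))) J) \<le> \<epsilon>"
      using app(4) unfolding approximates_bd_state_inv_def Let_def J_def q_def r_def .
    then have "opbound (cfg (bd B)) (cfg (bd B)) (mdiff (mm (cfg (bd B)) q (mm (cfg (bd B)) J (mm (cfg (bd B)) ?\<sigma>B (mm (cfg (bd B)) J q)))) J) \<epsilon>"
      using finb(4) by (intro opbound_mono[OF opbound_opnorm]) simp_all
    then have "opbound ?K0 ?K0 (?L0 (mdiff (mm (cfg (bd B)) q (mm (cfg (bd B)) J (mm (cfg (bd B)) ?\<sigma>B (mm (cfg (bd B)) J q)))) J)) \<epsilon>"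
      using finu(4) \<epsilon>0 by (intro opbound_idtens) simp_all
    then show "opbound ?K0 ?K0 (mdiff (mm ?K0 (?L0 q) (mm ?K0 (?L0 J) (mm ?K0 (?L0 ?\<sigma>B) (mm ?K0 (?L0 J) (?L0 q))))) (?L0 J)) \<epsilon>"
      by (simp only: L0 mdiff_tens)
    show "opbound (cfg ?S) (cfg ?S) (mdiff (ext (A \<union> B) ?S (mm (cfg ?AB) (peps_map T (A \<union> B))
        (mm (cfg ?AB) ?sAB (adj (peps_map T (A \<union> B)))))) (ext (A \<union> B) ?S (image_proj T (A \<union> B)))) \<epsilon>"
      unfolding mdiff_ext using AB(2)[OF finu(1)] finu(3) \<epsilon>0 by (intro opbound_ext) auto
    show "opbound (cfg ?S) (cfg ?S) (mdiff (ext (B \<union> C) ?S (mm (cfg ?BC) (peps_map T (B \<union> C))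
        (mm (cfg ?BC) ?sBC (adj (peps_map T (B \<union> C)))))) (ext (B \<union> C) ?S (image_proj T (B \<union> C)))) \<epsilon>"
      unfolding mdiff_ext using BC(2)[OF finu(2)] finu(3) \<epsilon>0 by (intro opbound_ext) auto
    show "opbound (cfg ?S) (cfg ?S) (mdiff (mm (cfg ?R) (peps_map T ?S) (mm (cfg ?R) ?sABC (adj (peps_map T ?S))))
        (image_proj T ?S)) \<epsilon>"
      by (rule ABC(2)[OF finu(3)])
    show "opbound (cfg ?S) (cfg ?S) (ext (A \<union> B) ?S (image_proj T (A \<union> B))) 1"
      using AB(3)[OF finu(1)] finu(3) by (intro opbound_ext) auto
    show "opbound (cfg ?S) (cfg ?S) (ext (B \<union> C) ?S (image_proj T (B \<union> C))) 1"
      using BC(3)[OF finu(2)] finu(3) by (intro opbound_ext) auto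
  qed (use \<epsilon>0 assms(5) in simp_all)
  then show ?thesis using \<epsilon>0 by (intro opnorm_le) simp_all
qed

end
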